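(* Under the standing setting and the order 1 method described in the context, there exist constants $C>0$ and $h_0\in(0,1)$ such that for all $h\in(0,h_0)$, \[ \mathbb{E}\big[\mathrm{Cost}(\overline X)\big]\le C\, h^{-1}\log(h^{-1}). \]
   Context: Standing setting. Let $d,m\ge 1$ and $T>0$. For $x\in\mathbb{R}^d$ and non-empty $A\subset\mathbb{R}^d$ write $d(x,A)=\inf_{y\in A}|x-y|$ (Euclidean norm). $D\subset\mathbb{R}^d$ is a non-empty bounded domain whose boundary $\partial D$ is $C^4$. $\mathrm{reach}(D)>0$ denotes the supremum of all $R>0$ such that every $x\in\mathbb{R}^d$ with $d(x,\partial D)<R$ has a unique nearest point on $\partial D$. For $r>0$ let $D_r=\{x\in\mathbb{R}^d: d(x,D)<r\}$. The coefficients $a:\mathbb{R}^d\to\mathbb{R}^d$, $b:\mathbb{R}^d\to\mathbb{R}^{d\times m}$ satisfy: (B1) every component $a_i$, $b_{ij}$ is $C^3$ and it and all its partial derivatives up to order $3$ are bounded on $\mathbb{R}^d$; (B2) there exist $\bar R_D\in(0,\mathrm{reach}(D)/2)$ and $\hat c_b>0$ with $\xi^\top b(x)b(x)^\top\xi\ge \hat c_b|\xi|^2$ for all $x\in D_{\bar R_D}$, $\xi\in\mathbb{R}^d$; (B3) there exists $\widehat C_b>0$ with $\xi^\top b(x)b(x)^\top\xi\le \widehat C_b|\xi|^2$ for all $x,\xi\in\mathbb{R}^d$. $W=(W^1,\dots,W^m)$ is a standard $m$-dimensional Wiener process on a filtered probability space $(\Omega,\mathcal F,(\mathcal F_t)_{t\ge0},\mathbb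 P)$, $x_0\in D$ is deterministic, and $X$ is the strong solution of $\mathrm{d}X=a(X)\,\mathrm{d}t+b(X)\,\mathrm{d}W$, $X(0)=x_0$. The (truncated) exit time is $\tau=\inf\{t\ge0: X(t)\notin D\}\wedge T$. Order 1 method. For $j=1,\dots,m$ let $\mathcal L^j=\sum_{i=1}^d b_{ij}\partial_{x_i}$. For a step-size parameter $h\in(0,1)$ set $\delta=\sqrt{8\widehat C_b\, d\, h\log(h^{-1})}$ and define $\Delta t(x)=h$ if $d(x,\partial D)>\delta$ and $\Delta t(x)=h^2$ otherwise. The numerical solution is defined recursively by $t_0=0$, $\overline X(t_0)=x_0$, $\Delta t_n=\Delta t(\overline X(t_n))$, $t_{n+1}=t_n+\Delta t_n$ and, for $i=1,\dots,d$ (Milstein scheme), \[ \overline X_i(t_{n+1})=\overline X_i(t_n)+a_i(\overline X(t_n))\Delta t_n+\sum_{j=1}^m b_{ij}(\overline X(t_n))\Delta W^j_n+\sum_{j_1,j_2=1}^m \mathcal L^{j_1}b_{ij_2}(\overline X(t_n))\,I^n_{(j_1,j_2)}, \] where $\Delta W^j_n=W^j(t_{n+1})-W^j(t_n)$ and $I^n_{(j_1,j_2)}=\int_{t_n}^{t_{n+1}}\int_{t_n}^{s_2}\mathrm{d}W^{j_1}(s_1)\,\mathrm{d}W^{j_2}(s_2)$. The numerical solution is extended to continuous time by $\overline X(t)=\overline X(t_n)$ for $t\in[t_n,t_{n+1})$. The numerical exit time is $\nu=\min\{t_n: \overline X(t_n)\notin D\}\wedge T$, and the computational cost is $\mathrm{Cost}(\overline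 X)=\int_0^{\nu}\frac{1}{\Delta t(\overline X(t))}\,\mathrm{d}t$ (the number of time steps taken before $\nu$). *)

theory Defs
  imports "HOL-Analysis.Analysis" "HOL-Probability.Probability"
begin

definition pderiv_i :: "'d::finite \<Rightarrow> (real^'d \<Rightarrow> real) \<Rightarrow> real^'d \<Rightarrow> real" where
  "pderiv_i i f x = frechet_derivative f (at x) (axis i 1)"

fun Ck :: "nat \<Rightarrow> (real^'d::finite \<Rightarrow> real) \<Rightarrow> bool" where
  "Ck 0 f = continuous_on UNIV f"
| "Ck (Suc k) f = (continuous_on UNIV f \<and> (\<forall>x. f differentiable (at x))
                   \<and> (\<forall>i. Ck k (pderiv_i i f)))"

fun Ck_bdd :: "nat \<Rightarrow> (real^'d::finite \<Rightarrow> real) \<Rightarrow> bool" where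
  "Ck_bdd 0 f = (continuous_on UNIV f \<and> bounded (range f))"
| "Ck_bdd (Suc k) f = (continuous_on UNIV f \<and> bounded (range f) \<and> (\<forall>x. f differentiable (at x))
                   \<and> (\<forall>i. Ck_bdd k (pderiv_i i f)))"

definition Ck_boundary :: "nat \<Rightarrow> (real^'d::finite) set \<Rightarrow> bool" where
  "Ck_boundary k D \<longleftrightarrow> (\<forall>p\<in>frontier D. \<exists>r>0. \<exists>\<phi>. Ck k \<phi>
      \<and> (\<forall>x\<in>ball p r. \<exists>i. pderiv_i i \<phi> x \<noteq> 0)
      \<and> D \<inter> ball p r = {x\<in>ball p r. \<phi> x < 0})"

definition reach :: "(real^'d::finite) set \<Rightarrow> real" where
  "reach D = Sup {R. R > 0 \<and> (\<forall>x. infdist x (frontier D) < R \<longrightarrow>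
        (\<exists>!y. y \<in> frontier D \<and> dist x y = infdist x (frontier D)))}"

definition enlarge :: "(real^'d::finite) set \<Rightarrow> real \<Rightarrow> (real^'d) set" where
  "enlarge D r = {x. infdist x D < r}"

definition wiener_process :: "'w measure \<Rightarrow> (real \<Rightarrow> 'w measure) \<Rightarrow> (real \<Rightarrow> 'w \<Rightarrow> real^'m::finite) \<Rightarrow> bool" where
  "wiener_process M F W \<longleftrightarrow> prob_space M
    \<and> (\<forall>t\<ge>0. subalgebra M (F t))
    \<and> (\<forall>s t. 0 \<le> s \<longrightarrow> s \<le> t \<longrightarrow> sets (F s) \<subseteq> sets (F t))
    \<and> (\<forall>t\<ge>0. W t \<in> borel_measurable (F t))
    \<and> (\<forall>\<omega>\<in>space M. W 0 \<omega> = 0 \<and> continuous_on {0..} (\<lambda>t. W t \<omega>))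
    \<and> (\<forall>s t. 0 \<le> s \<longrightarrow> s < t \<longrightarrow>
          distr M lborel (\<lambda>\<omega>. W t \<omega> - W s \<omega>)
            = density lborel (\<lambda>x. ennreal (\<Prod>j\<in>UNIV. normal_density 0 (sqrt (t - s)) (x $ j)))
        \<and> (\<forall>A\<in>sets (F s). \<forall>B\<in>sets borel.
             measure M (A \<inter> {\<omega>\<in>space M. W t \<omega> - W s \<omega> \<in> B})
               = measure M A * measure M {\<omega>\<in>space M. W t \<omega> - W s \<omega> \<in> B}))"

text \<open>Iterated Ito integral I_(j1,j2) over [s,t], defined pathwise as the limit of
  left-point Riemann sums along dyadic partitions (a.s. equal to the Ito integral).\<close>
definition iter_int :: "(real \<Rightarrow> 'w \<Rightarrow> real^'m::finite) \<Rightarrow> 'w \<Rightarrow> real \<Rightarrow> real \<Rightarrow> 'm \<Rightarrow> 'm \<Rightarrow> real" where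
  "iter_int W \<omega> s t j1 j2 = lim (\<lambda>k::nat.
     \<Sum>l<2^k. (W (s + real l * (t - s) / 2^k) \<omega> $ j1 - W s \<omega> $ j1)
             * (W (s + real (Suc l) * (t - s) / 2^k) \<omega> $ j2 - W (s + real l * (t - s) / 2^k) \<omega> $ j2))"

definition step_size :: "(real^'d::finite) set \<Rightarrow> real \<Rightarrow> real \<Rightarrow> real^'d \<Rightarrow> real" where
  "step_size D Cb h x =
     (if infdist x (frontier D) > sqrt (8 * Cb * real CARD('d) * h * ln (1 / h)) then h else h^2)"

definition milstein_step :: "(real^'d::finite \<Rightarrow> real^'d) \<Rightarrow> (real^'d \<Rightarrow> real^'m::finite^'d)
    \<Rightarrow> real^'d \<Rightarrow> real \<Rightarrow> real^'m \<Rightarrow> ('m \<Rightarrow> 'm \<Rightarrow> real) \<Rightarrow> real^'d" where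
  "milstein_step a b x dt dW I = (\<chi> i. x $ i + a x $ i * dt + (\<Sum>j\<in>UNIV. b x $ i $ j * dW $ j)
      + (\<Sum>j1\<in>UNIV. \<Sum>j2\<in>UNIV.
           (\<Sum>k\<in>UNIV. b x $ k $ j1 * pderiv_i k (\<lambda>y. b y $ i $ j2) x) * I j1 j2))"

primrec scheme :: "(real^'d::finite \<Rightarrow> real^'d) \<Rightarrow> (real^'d \<Rightarrow> real^'m::finite^'d)
    \<Rightarrow> (real \<Rightarrow> 'w \<Rightarrow> real^'m) \<Rightarrow> (real^'d \<Rightarrow> real) \<Rightarrow> real^'d \<Rightarrow> 'w \<Rightarrow> nat \<Rightarrow> real \<times> (real^'d)" where
  "scheme a b W dt x0 \<omega> 0 = (0, x0)"
| "scheme a b W dt x0 \<omega> (Suc n) =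
     (let tn = fst (scheme a b W dt x0 \<omega> n); xn = snd (scheme a b W dt x0 \<omega> n);
          tn' = tn + dt xn
      in (tn', milstein_step a b xn (dt xn) (W tn' \<omega> - W tn \<omega>) (iter_int W \<omega> tn tn')))"

definition cost :: "(real^'d::finite \<Rightarrow> real^'d) \<Rightarrow> (real^'d \<Rightarrow> real^'m::finite^'d)
    \<Rightarrow> (real \<Rightarrow> 'w \<Rightarrow> real^'m) \<Rightarrow> (real^'d) set \<Rightarrow> real \<Rightarrow> real \<Rightarrow> real^'d \<Rightarrow> real \<Rightarrow> 'w \<Rightarrow> real" where
  "cost a b W D Cb T x0 h \<omega> =
    (let dt = step_size D Cb h;
         tn = (\<lambda>n. fst (scheme a b W dt x0 \<omega> n));
         Xn = (\<lambda>n. snd (scheme a b W dt x0 \<omega> n));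
         nu = (if \<exists>n. Xn n \<notin> D then min (tn (LEAST n. Xn n \<notin> D)) T else T);
         Xc = (\<lambda>t. Xn (LEAST n. t < tn (Suc n)))
     in integral {0..nu} (\<lambda>t. 1 / dt (Xc t)))"

end

theory Submission
  imports Defs "HOL-Real_Asymp.Real_Asymp"
begin

text \<open>
  All large steps together number at most \<open>T/h + 1\<close>, so the claim reduces to showing that the
  scheme spends only time \<open>O(\<delta>\<^sup>2)\<close> in the boundary strip of width \<open>\<delta>\<close> before it leaves \<open>D\<close>:
  dividing by the small step \<open>h\<^sup>2\<close> gives \<open>O(h\<^sup>-\<^sup>1 log h\<^sup>-\<^sup>1)\<close>.

  Let \<open>\<rho>\<close> be a \<open>C\<^sup>1\<^sup>,\<^sup>1\<close> function, positive in \<open>D\<close>, vanishing on the boundary with non-zero gradient there.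
  The Lyapunov function \<open>V = 2B\<delta>\<rho> - \<rho>\<^sup>2\<close>, capped at its value for \<open>\<rho> = (B - 1)\<delta>\<close>, takes values of order
  \<open>\<delta>\<^sup>2\<close>. Where \<open>V\<close> is capped it cannot increase. Elsewhere the quadratic term together with the
  ellipticity of \<open>b\<close> makes \<open>V\<close> decrease in conditional mean by at least \<open>\<kappa>\<Delta>t\<close>, because the drift, the
  curvature of \<open>\<rho>\<close>, the Milstein correction and the rare jumps longer than \<open>\<delta>\<close> only contribute
  \<open>O(\<Delta>t (\<delta> + \<Delta>t + \<Delta>t/\<delta>\<^sup>2))\<close>. Summing over the steps before the exit bounds the expected time in the strip.

  The iterated integrals enter only through their conditional second moments, which come, together
  with the convergence of the dyadic sums, from the orthogonality of the increments of these sums.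
\<close>

section \<open>Global defining function of the domain\<close>

text \<open>The distance to the boundary is replaced by \<open>\<rho>\<close>, glued from local
  defining functions by cut-offs. A comparison is needed in one direction only,
  \<open>\<rho>\<close> at most a multiple of the distance: the zone of small steps then lies in a
  strip of \<open>\<rho>\<close>. The price is that this strip also holds points with the large step
  \<open>h\<close>, so the decrease of \<open>V\<close> has to be shown for both step sizes. For
  \<open>\<Delta> = h\<close> the long jumps cost h^2 / \<delta>^2, which is small against
  \<open>h\<close> only because h / \<delta>^2 = 1 / (k log(1/h)) tends to 0: this is what the
  logarithm in \<delta> pays for. The second obstacle is that the times t_n are random, whereas the
  independence of Wiener increments is given for deterministic times. As t_n is a sum of steps
  \<open>h\<close> and h^2 it takes finitely many values, and splitting the sample space by the
  values of t_n and of the next step leaves only deterministic times. Conditional expectations are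
  likewise replaced by expectations on events of \<open>F s\<close>.\<close>

definition c11_on :: "'a::euclidean_space set \<Rightarrow> ('a \<Rightarrow> real) \<Rightarrow> ('a \<Rightarrow> 'a) \<Rightarrow> bool" where
  "c11_on K f g \<longleftrightarrow> continuous_on UNIV f \<and> continuous_on UNIV g \<and>
     (\<exists>C. \<forall>x\<in>K. \<forall>y\<in>K. \<bar>f y - f x - g x \<bullet> (y - x)\<bar> \<le> C * norm (y - x) ^ 2)"

lemma c11_onE:
  assumes "c11_on K f g"
  obtains C where "C \<ge> 0"
    "\<And>x y. x \<in> K \<Longrightarrow> y \<in> K \<Longrightarrow> \<bar>f y - f x - g x \<bullet> (y - x)\<bar> \<le> C * norm (y - x) ^ 2"
proof -
  obtain C where C: "\<forall>x\<in>K. \<forall>y\<in>K. \<bar>f y - f x - g x \<bullet> (y - x)\<bar> \<le> C * norm (y - x) ^ 2"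
    using assms by (auto simp: c11_on_def)
  show ?thesis
  proof (rule that[of "\<bar>C\<bar>"])
    fix x y assume "x \<in> K" "y \<in> K"
    then have "\<bar>f y - f x - g x \<bullet> (y - x)\<bar> \<le> C * norm (y - x) ^ 2" using C by blast
    also have "\<dots> \<le> \<bar>C\<bar> * norm (y - x) ^ 2" by (intro mult_right_mono) auto
    finally show "\<bar>f y - f x - g x \<bullet> (y - x)\<bar> \<le> \<bar>C\<bar> * norm (y - x) ^ 2" .
  qed auto
qed

lemma continuous_on_compact_bound:
  fixes f :: "'a::euclidean_space \<Rightarrow> 'b::real_normed_vector"
  assumes "continuous_on UNIV f" "compact K"
  obtains B where "B \<ge> 0" "\<And>x. x \<in> K \<Longrightarrow> norm (f x) \<le> B"
proof -
  have "bounded (f ` K)"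
    using assms by (intro compact_imp_bounded compact_continuous_image) (auto intro: continuous_on_subset)
  then obtain B where "\<forall>y\<in>f ` K. norm y \<le> B" by (auto simp: bounded_iff)
  then show ?thesis using that[of "max 0 B"] by (auto intro: order_trans[OF _ max.cobounded2])
qed

text \<open>No path from \<open>x\<close> to \<open>y\<close> is followed: one factor of the
  quadratic error is bounded by the diameter 2R of \<open>K\<close>, and the linear term by the
  maximum of \<open>g\<close> on the compact set.\<close>

lemma c11_on_Lipschitz:
  assumes "c11_on K f g" "compact K"
  obtains L where "L \<ge> 0" "\<And>x y. x \<in> K \<Longrightarrow> y \<in> K \<Longrightarrow> \<bar>f y - f x\<bar> \<le> L * norm (y - x)"
proof -
  obtain C where C: "C \<ge> 0"
    "\<And>x y. x \<in> K \<Longrightarrow> y \<in> K \<Longrightarrow> \<bar>f y - f x - g x \<bullet> (y - x)\<bar> \<le> C * norm (y - x) ^ 2"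
    by (rule c11_onE[OF assms(1)]) auto
  obtain G where G: "G \<ge> 0" "\<And>x. x \<in> K \<Longrightarrow> norm (g x) \<le> G"
    using continuous_on_compact_bound[of g K] assms by (auto simp: c11_on_def)
  obtain R where R: "R \<ge> 0" "\<And>x. x \<in> K \<Longrightarrow> norm (id x) \<le> R"
    using continuous_on_compact_bound[of id K] assms by (auto simp: continuous_on_id id_def)
  show ?thesis
  proof (rule that[of "C * (2 * R) + G"])
    show "C * (2 * R) + G \<ge> 0" using C(1) G(1) R(1) by simp
    fix x y assume xy: "x \<in> K" "y \<in> K"
    have "norm (y - x) \<le> 2 * R"
      using R(2)[OF xy(1)] R(2)[OF xy(2)] norm_triangle_ineq4[of y x] by (simp add: id_def)
    then have "norm (y - x) ^ 2 \<le> 2 * R * norm (y - x)"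
      by (simp add: power2_eq_square mult_right_mono)
    then have "C * norm (y - x) ^ 2 \<le> C * (2 * R) * norm (y - x)"
      using C(1) by (simp add: mult.assoc mult_left_mono)
    moreover have "\<bar>g x \<bullet> (y - x)\<bar> \<le> G * norm (y - x)"
      using Cauchy_Schwarz_ineq2[of "g x" "y - x"] G(2)[OF xy(1)]
      by (meson mult_right_mono norm_ge_zero order_trans)
    ultimately show "\<bar>f y - f x\<bar> \<le> (C * (2 * R) + G) * norm (y - x)"
      using C(2)[OF xy] by (simp add: distrib_right)
  qed
qed

text \<open>The remainder of the product is \<open>f x\<close> times that of \<open>g\<close>, plus
  \<open>g x\<close> times that of \<open>f\<close>, plus the product of both increments; the last
  is quadratic by the Lipschitz bounds.\<close>

lemma c11_on_mult:
  assumes f: "c11_on K f f'" and g: "c11_on K g g'" and K: "compact K"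
  shows "c11_on K (\<lambda>x. f x * g x) (\<lambda>x. f x *\<^sub>R g' x + g x *\<^sub>R f' x)"
proof -
  obtain Cf where Cf: "Cf \<ge> 0"
    "\<And>x y. x \<in> K \<Longrightarrow> y \<in> K \<Longrightarrow> \<bar>f y - f x - f' x \<bullet> (y - x)\<bar> \<le> Cf * norm (y - x) ^ 2"
    by (rule c11_onE[OF f]) auto
  obtain Cg where Cg: "Cg \<ge> 0"
    "\<And>x y. x \<in> K \<Longrightarrow> y \<in> K \<Longrightarrow> \<bar>g y - g x - g' x \<bullet> (y - x)\<bar> \<le> Cg * norm (y - x) ^ 2"
    by (rule c11_onE[OF g]) auto
  obtain Lf where Lf: "Lf \<ge> 0" "\<And>x y. x \<in> K \<Longrightarrow> y \<in> K \<Longrightarrow> \<bar>f y - f x\<bar> \<le> Lf * norm (y - x)"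
    by (rule c11_on_Lipschitz[OF f K]) auto
  obtain Lg where Lg: "Lg \<ge> 0" "\<And>x y. x \<in> K \<Longrightarrow> y \<in> K \<Longrightarrow> \<bar>g y - g x\<bar> \<le> Lg * norm (y - x)"
    by (rule c11_on_Lipschitz[OF g K]) auto
  obtain Bf where Bf: "Bf \<ge> 0" "\<And>x. x \<in> K \<Longrightarrow> norm (f x) \<le> Bf"
    using continuous_on_compact_bound[of f K] f K by (auto simp: c11_on_def)
  obtain Bg where Bg: "Bg \<ge> 0" "\<And>x. x \<in> K \<Longrightarrow> norm (g x) \<le> Bg"
    using continuous_on_compact_bound[of g K] g K by (auto simp: c11_on_def)
  have cont: "continuous_on UNIV f" "continuous_on UNIV f'" "continuous_on UNIV g" "continuous_on UNIV g'"
    using f g by (auto simp: c11_on_def)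
  have "\<bar>f y * g y - f x * g x - (f x *\<^sub>R g' x + g x *\<^sub>R f' x) \<bullet> (y - x)\<bar>
      \<le> (Bf * Cg + Bg * Cf + Lf * Lg) * norm (y - x) ^ 2" if xy: "x \<in> K" "y \<in> K" for x y
  proof -
    let ?v = "y - x"
    have "f y * g y - f x * g x - (f x *\<^sub>R g' x + g x *\<^sub>R f' x) \<bullet> ?v
       = f x * (g y - g x - g' x \<bullet> ?v) + g x * (f y - f x - f' x \<bullet> ?v) + (f y - f x) * (g y - g x)"
      by (simp add: inner_add_left algebra_simps)
    also have "\<bar>\<dots>\<bar> \<le> \<bar>f x\<bar> * \<bar>g y - g x - g' x \<bullet> ?v\<bar> + \<bar>g x\<bar> * \<bar>f y - f x - f' x \<bullet> ?v\<bar>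
        + \<bar>f y - f x\<bar> * \<bar>g y - g x\<bar>"
      by (simp only: abs_mult[symmetric])
    also have "\<dots> \<le> Bf * (Cg * norm ?v ^ 2) + Bg * (Cf * norm ?v ^ 2) + (Lf * norm ?v) * (Lg * norm ?v)"
      using Bf Bg Cf Cg Lf Lg xy
      by (intro add_mono mult_mono) auto
    also have "\<dots> = (Bf * Cg + Bg * Cf + Lf * Lg) * norm ?v ^ 2"
      by (simp add: algebra_simps power2_eq_square)
    finally show ?thesis .
  qed
  then show ?thesis
    unfolding c11_on_def using cont by (intro conjI exI continuous_intros) auto
qed

lemma c11_on_sum:
  assumes "finite P" "\<And>p. p \<in> P \<Longrightarrow> c11_on K (f p) (g p)"
  shows "c11_on K (\<lambda>x. \<Sum>p\<in>P. f p x) (\<lambda>x. \<Sum>p\<in>P. g p x)"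
  using assms
proof (induction P)
  case empty
  show ?case by (auto simp: c11_on_def intro!: exI[of _ 0])
next
  case (insert q P)
  then have 1: "c11_on K (f q) (g q)" and 2: "c11_on K (\<lambda>x. \<Sum>p\<in>P. f p x) (\<lambda>x. \<Sum>p\<in>P. g p x)" by auto
  obtain C1 where C1: "\<And>x y. x \<in> K \<Longrightarrow> y \<in> K \<Longrightarrow>
      \<bar>f q y - f q x - g q x \<bullet> (y - x)\<bar> \<le> C1 * norm (y - x) ^ 2"
    by (rule c11_onE[OF 1]) auto
  obtain C2 where C2: "\<And>x y. x \<in> K \<Longrightarrow> y \<in> K \<Longrightarrow>
      \<bar>(\<Sum>p\<in>P. f p y) - (\<Sum>p\<in>P. f p x) - (\<Sum>p\<in>P. g p x) \<bullet> (y - x)\<bar> \<le> C2 * norm (y - x) ^ 2"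
    by (rule c11_onE[OF 2]) auto
  have "\<bar>(\<Sum>p\<in>insert q P. f p y) - (\<Sum>p\<in>insert q P. f p x) - (\<Sum>p\<in>insert q P. g p x) \<bullet> (y - x)\<bar>
     \<le> (C1 + C2) * norm (y - x) ^ 2" if "x \<in> K" "y \<in> K" for x y
    using C1[OF that] C2[OF that] insert(1,2) by (simp add: inner_add_left distrib_right)
  moreover have "continuous_on UNIV (\<lambda>x. \<Sum>p\<in>insert q P. f p x)" "continuous_on UNIV (\<lambda>x. \<Sum>p\<in>insert q P. g p x)"
    using insert(4) by (auto intro!: continuous_on_sum simp: c11_on_def)
  ultimately show ?case unfolding c11_on_def by blast
qed

lemma c11_on_const: "c11_on K (\<lambda>_. c) (\<lambda>_. 0)"
  by (auto simp: c11_on_def intro!: exI[of _ 0])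

lemma c11_on_uminus: "c11_on K f g \<Longrightarrow> c11_on K (\<lambda>x. - f x) (\<lambda>x. - g x)"
  by (auto simp: c11_on_def abs_minus_commute algebra_simps intro!: continuous_intros)

section \<open>Radial cut-off functions\<close>

lemma pos_part_square_quadratic:
  fixes s t :: real
  shows "\<bar>(max 0 t)\<^sup>2 - (max 0 s)\<^sup>2 - 2 * max 0 s * (t - s)\<bar> \<le> (t - s)\<^sup>2"
proof -
  consider "s \<ge> 0" "t \<ge> 0" | "s \<ge> 0" "t < 0" | "s < 0" "t \<ge> 0" | "s < 0" "t < 0" by linarith
  then show ?thesis
  proof cases
    case 1
    then have "(max 0 t)\<^sup>2 - (max 0 s)\<^sup>2 - 2 * max 0 s * (t - s) = (t - s)\<^sup>2"
      by (simp add: power2_eq_square algebra_simps)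
    then show ?thesis by simp
  next
    case 2
    have "(max 0 t)\<^sup>2 - (max 0 s)\<^sup>2 - 2 * max 0 s * (t - s) = s * (s - 2 * t)"
      using 2 by (simp add: power2_eq_square algebra_simps)
    moreover have "0 \<le> s * (s - 2 * t)" using 2 by simp
    moreover have "s * (s - 2 * t) \<le> (t - s)\<^sup>2" by (simp add: power2_eq_square algebra_simps)
    ultimately show ?thesis by simp
  next
    case 3
    have "t \<le> t - s" using 3 by simp
    then have "t\<^sup>2 \<le> (t - s)\<^sup>2" using 3 by (intro power_mono) auto
    then show ?thesis using 3 by simp
  qed auto
qed

text \<open>A polynomial cut-off. Squaring the positive part makes the gradient Lipschitz across the
  sphere, which is all the regularity that \<open>c11_on\<close> asks for. There is no normalisation
  to a partition of unity, since later only signs and positive combinations matter.\<close>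

definition bump :: "'a::euclidean_space \<Rightarrow> real \<Rightarrow> 'a \<Rightarrow> real" where
  "bump p r x = (max 0 (r\<^sup>2 - (norm (x - p))\<^sup>2))\<^sup>2"

definition bump_grad :: "'a::euclidean_space \<Rightarrow> real \<Rightarrow> 'a \<Rightarrow> 'a" where
  "bump_grad p r x = - (4 * max 0 (r\<^sup>2 - (norm (x - p))\<^sup>2)) *\<^sub>R (x - p)"

lemma bump_outside: "r > 0 \<Longrightarrow> x \<notin> ball p r \<Longrightarrow> bump p r x = 0 \<and> bump_grad p r x = 0"
  using power_mono[of r "norm (x - p)" 2]
  by (auto simp: bump_def bump_grad_def dist_norm norm_minus_commute)

lemma bump_pos: "x \<in> ball p r \<Longrightarrow> 0 < bump p r x"
  using power_strict_mono[of "norm (x - p)" r 2]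
  by (auto simp: bump_def dist_norm norm_minus_commute)

text \<open>With s and t the values of r^2 - |. - p|^2 at x and y, the difference t - s is the
  linear term minus |y - x|^2. The gradient term is therefore off by 2 max(0, s) |y - x|^2, at most
  2 r^2 |y - x|^2, and the error (t - s)^2 of the squared positive part is at most (2R)^2 |y -
  x|^2.\<close>

lemma c11_on_bump:
  assumes "compact K"
  shows "c11_on K (bump p r) (bump_grad p r)"
proof -
  obtain R where R: "R \<ge> 0" "\<And>x. x \<in> K \<Longrightarrow> norm (x - p) \<le> R"
    by (rule continuous_on_compact_bound[of "\<lambda>x. x - p" K]) (use assms in \<open>auto intro!: continuous_intros\<close>)
  have "\<bar>bump p r y - bump p r x - bump_grad p r x \<bullet> (y - x)\<bar> \<le> ((2 * R)\<^sup>2 + 2 * r\<^sup>2) * norm (y - x) ^ 2"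
    if xy: "x \<in> K" "y \<in> K" for x y
  proof -
    define s where "s = r\<^sup>2 - (norm (x - p))\<^sup>2"
    define t where "t = r\<^sup>2 - (norm (y - p))\<^sup>2"
    have ts: "t - s = - 2 * ((x - p) \<bullet> (y - x)) - norm (y - x) ^ 2"
      unfolding s_def t_def power2_norm_eq_inner by (simp add: inner_diff inner_commute algebra_simps)
    have ts': "t - s = (norm (x - p) - norm (y - p)) * (norm (x - p) + norm (y - p))"
      unfolding s_def t_def by (simp add: power2_eq_square algebra_simps)
    have "\<bar>norm (x - p) - norm (y - p)\<bar> \<le> norm (y - x)"
      using norm_triangle_ineq3[of "x - p" "y - p"] by (simp add: norm_minus_commute)
    then have "\<bar>t - s\<bar> \<le> norm (y - x) * (2 * R)"
      unfolding ts' abs_mult using R(2)[OF xy(1)] R(2)[OF xy(2)] by (intro mult_mono) auto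
    then have "\<bar>t - s\<bar>\<^sup>2 \<le> (norm (y - x) * (2 * R))\<^sup>2" by (intro power_mono) auto
    then have 1: "(t - s)\<^sup>2 \<le> (2 * R)\<^sup>2 * norm (y - x) ^ 2" by (simp add: power_mult_distrib mult.commute)
    have 2: "bump_grad p r x \<bullet> (y - x) = 2 * max 0 s * (t - s) + 2 * max 0 s * norm (y - x) ^ 2"
      unfolding ts bump_grad_def s_def[symmetric] by (simp add: algebra_simps)
    have 3: "max 0 s \<le> r\<^sup>2" "max 0 s \<ge> 0" by (auto simp: s_def)
    have "bump p r y - bump p r x - bump_grad p r x \<bullet> (y - x)
       = ((max 0 t)\<^sup>2 - (max 0 s)\<^sup>2 - 2 * max 0 s * (t - s)) - 2 * max 0 s * norm (y - x) ^ 2"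
      unfolding 2 by (simp add: bump_def s_def t_def)
    also have "\<bar>\<dots>\<bar> \<le> (t - s)\<^sup>2 + 2 * max 0 s * norm (y - x) ^ 2"
    proof -
      have "0 \<le> 2 * max 0 s * norm (y - x) ^ 2" using 3(2) by simp
      then show ?thesis using pos_part_square_quadratic[of t s] by linarith
    qed
    also have "\<dots> \<le> (2 * R)\<^sup>2 * norm (y - x) ^ 2 + 2 * r\<^sup>2 * norm (y - x) ^ 2"
      using 1 3 by (intro add_mono mult_right_mono mult_left_mono) auto
    finally show ?thesis by (simp add: algebra_simps)
  qed
  moreover have "continuous_on UNIV (bump p r)" "continuous_on UNIV (bump_grad p r)"
    unfolding bump_def[abs_def] bump_grad_def[abs_def] by (intro continuous_intros)+
  ultimately show ?thesis unfolding c11_on_def by blast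
qed


section \<open>Quadratic remainder of twice continuously differentiable functions\<close>

lemma has_derivative_gradient:
  fixes f :: "real^'d::finite \<Rightarrow> real"
  assumes "f differentiable (at x)"
  shows "(f has_derivative (\<lambda>v. (\<chi> i. pderiv_i i f x) \<bullet> v)) (at x)"
proof -
  let ?f' = "frechet_derivative f (at x)"
  have d: "(f has_derivative ?f') (at x)" using assms by (simp add: frechet_derivative_works)
  then have lin: "linear ?f'" using has_derivative_linear by blast
  have "?f' v = (\<chi> i. pderiv_i i f x) \<bullet> v" for v
  proof -
    have "?f' v = ?f' (\<Sum>i\<in>UNIV. (v $ i) *\<^sub>R axis i 1)"
      using basis_expansion[of v] by (simp add: scalar_mult_eq_scaleR)
    also have "\<dots> = (\<Sum>i\<in>UNIV. v $ i * ?f' (axis i 1))"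
      using lin by (simp add: linear_sum linear_scale)
    finally show ?thesis by (simp add: inner_vec_def pderiv_i_def mult.commute)
  qed
  then have "?f' = (\<lambda>v. (\<chi> i. pderiv_i i f x) \<bullet> v)" by auto
  then show ?thesis using d by simp
qed

lemma onorm_inner_le: "onorm (\<lambda>v. g \<bullet> v) \<le> norm (g::'a::euclidean_space)"
  by (rule onorm_bound) (auto simp: Cauchy_Schwarz_ineq2)

lemma Ck_gradient_continuous:
  assumes "Ck (Suc k) f"
  shows "continuous_on UNIV (\<lambda>x. \<chi> i. pderiv_i i f x)"
proof -
  have "continuous_on UNIV (pderiv_i i f)" for i
    using assms by (cases k) auto
  then show ?thesis by (intro continuous_on_vec_lambda) auto
qed

lemma Ck_Lipschitz_on:
  assumes f: "Ck (Suc k) f" and K: "compact K" "convex K"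
  obtains L where "L \<ge> 0" "\<And>x y. x \<in> K \<Longrightarrow> y \<in> K \<Longrightarrow> \<bar>f y - f x\<bar> \<le> L * norm (y - x)"
proof -
  obtain L where L: "L \<ge> 0" "\<And>x. x \<in> K \<Longrightarrow> norm (\<chi> i. pderiv_i i f x) \<le> L"
    by (rule continuous_on_compact_bound[OF Ck_gradient_continuous[OF f] K(1)]) auto
  have d: "(f has_derivative (\<lambda>v. (\<chi> i. pderiv_i i f x) \<bullet> v)) (at x within K)" for x
    using f by (intro has_derivative_at_withinI[OF has_derivative_gradient]) auto
  have "norm (f y - f x) \<le> L * norm (y - x)" if "x \<in> K" "y \<in> K" for x y
    using differentiable_bound[OF K(2) d order_trans[OF onorm_inner_le L(2)] that(2,1)] by auto
  then show ?thesis using that L by auto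
qed

text \<open>The partial derivatives are Lipschitz on the convex \<open>K\<close>, so along the
  segment the gradient varies by at most a multiple of |y - x|, and the linearisation at
  \<open>x\<close> errs by the square.\<close>

lemma Ck_c11_on:
  fixes f :: "real^'d::finite \<Rightarrow> real"
  assumes f: "Ck (Suc (Suc k)) f" and K: "compact K" "convex K"
  shows "c11_on K f (\<lambda>x. \<chi> i. pderiv_i i f x)"
proof -
  let ?g = "\<lambda>x. \<chi> i. pderiv_i i f x"
  have "\<exists>L\<ge>0. \<forall>x\<in>K. \<forall>y\<in>K. \<bar>pderiv_i i f y - pderiv_i i f x\<bar> \<le> L * norm (y - x)" for i
  proof -
    have *: "Ck (Suc k) (pderiv_i i f)" using f by auto
    obtain L where "L \<ge> 0"
      "\<And>x y. x \<in> K \<Longrightarrow> y \<in> K \<Longrightarrow> \<bar>pderiv_i i f y - pderiv_i i f x\<bar> \<le> L * norm (y - x)"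
      by (rule Ck_Lipschitz_on[OF * K]) auto
    then show ?thesis by (intro exI[of _ L]) simp
  qed
  then obtain L where L: "\<And>i. L i \<ge> 0"
      "\<And>i x y. x \<in> K \<Longrightarrow> y \<in> K \<Longrightarrow> \<bar>pderiv_i i f y - pderiv_i i f x\<bar> \<le> L i * norm (y - x)"
    by metis
  let ?L = "\<Sum>i\<in>UNIV. L i"
  have Lg: "norm (?g y - ?g x) \<le> ?L * norm (y - x)" if "x \<in> K" "y \<in> K" for x y
  proof -
    have "norm (?g y - ?g x) \<le> (\<Sum>i\<in>UNIV. \<bar>pderiv_i i f y - pderiv_i i f x\<bar>)"
      using norm_le_l1_cart[of "?g y - ?g x"] by simp
    also have "\<dots> \<le> (\<Sum>i\<in>UNIV. L i * norm (y - x))" using L(2)[OF that] by (intro sum_mono)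
    finally show ?thesis by (simp add: sum_distrib_right)
  qed
  have "\<bar>f y - f x - ?g x \<bullet> (y - x)\<bar> \<le> ?L * norm (y - x) ^ 2" if xy: "x \<in> K" "y \<in> K" for x y
  proof -
    have sub: "closed_segment x y \<subseteq> K" using xy K(2) closed_segment_subset by blast
    have "norm (f y - f x - ?g x \<bullet> (y - x)) \<le> norm (y - x) * (?L * norm (y - x))"
    proof (rule differentiable_bound_linearization[where S = "closed_segment x y" and f' = "\<lambda>x v. ?g x \<bullet> v"])
      show "x + t *\<^sub>R (y - x) \<in> closed_segment x y" if "t \<in> {0..1}" for t
        using that by (auto simp: closed_segment_def algebra_simps intro!: exI[of _ t])
      show "(f has_derivative (\<bullet>) (?g z)) (at z within closed_segment x y)" for z
        using f by (intro has_derivative_at_withinI[OF has_derivative_gradient]) auto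
      show "onorm ((\<bullet>) (?g z) - (\<bullet>) (?g x)) \<le> ?L * norm (y - x)" if z: "z \<in> closed_segment x y" for z
      proof -
        have "(\<bullet>) (?g z) - (\<bullet>) (?g x) = (\<bullet>) (?g z - ?g x)" by (auto simp: inner_diff_left)
        then have "onorm ((\<bullet>) (?g z) - (\<bullet>) (?g x)) \<le> norm (?g z - ?g x)" using onorm_inner_le by metis
        also have "\<dots> \<le> ?L * norm (z - x)" using Lg xy z sub by blast
        also have "\<dots> \<le> ?L * norm (y - x)"
          using segment_bound(1)[OF z] L(1) by (intro mult_left_mono sum_nonneg) (auto simp: norm_minus_commute)
        finally show ?thesis .
      qed
    qed auto
    then show ?thesis by (simp add: power2_eq_square algebra_simps)
  qed
  moreover have "continuous_on UNIV f" using f by auto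
  ultimately show ?thesis unfolding c11_on_def using Ck_gradient_continuous[OF f] by blast
qed

section \<open>Patching local defining functions\<close>

text \<open>Two inward conormals at a common boundary point are positively aligned: a direction entering
  \<open>D\<close> strictly for one defining function cannot leave it for the other.\<close>
lemma conormals_aligned:
  fixes x :: "'a::euclidean_space"
  assumes c1: "c11_on K f f'" and c2: "c11_on K g g'" and x: "x \<in> interior K" "f x = 0" "g x = 0"
    and e: "e > 0" and fg: "\<And>y. y \<in> ball x e \<Longrightarrow> f y > 0 \<Longrightarrow> g y > 0"
    and nz: "f' x \<noteq> 0" "g' x \<noteq> 0"
  shows "f' x \<bullet> g' x > 0"
proof -
  obtain Cf where Cf: "Cf \<ge> 0"
    "\<And>x y. x \<in> K \<Longrightarrow> y \<in> K \<Longrightarrow> \<bar>f y - f x - f' x \<bullet> (y - x)\<bar> \<le> Cf * norm (y - x) ^ 2"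
    by (rule c11_onE[OF c1]) auto
  obtain Cg where Cg: "Cg \<ge> 0"
    "\<And>x y. x \<in> K \<Longrightarrow> y \<in> K \<Longrightarrow> \<bar>g y - g x - g' x \<bullet> (y - x)\<bar> \<le> Cg * norm (y - x) ^ 2"
    by (rule c11_onE[OF c2]) auto
  obtain r where r: "r > 0" "ball x r \<subseteq> K" using x(1) mem_interior by blast
  have xK: "x \<in> K" using x(1) interior_subset by blast
  \<comment> \<open>For small t the point x + t w lies in \<open>f > 0\<close>, hence in
    \<open>g > 0\<close>; dividing the expansion of \<open>g\<close> by t and letting t tend to 0
    leaves a weak inequality.\<close>
  have key: "g' x \<bullet> w \<ge> 0" if w: "f' x \<bullet> w > 0" for w
  proof -
    have w0: "w \<noteq> 0" using w by auto
    have lim1: "((\<lambda>t. f' x \<bullet> w - Cf * t * norm w ^ 2) \<longlongrightarrow> f' x \<bullet> w - Cf * 0 * norm w ^ 2) (at_right 0)"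
      by (intro tendsto_intros)
    then have e1: "\<forall>\<^sub>F t in at_right 0. f' x \<bullet> w - Cf * t * norm w ^ 2 > 0"
      using w by (intro order_tendstoD(1)[OF lim1]) auto
    have lim2: "((\<lambda>t. t * norm w) \<longlongrightarrow> 0 * norm w) (at_right 0)" by (intro tendsto_intros)
    then have e2: "\<forall>\<^sub>F t in at_right 0. t * norm w < min e r"
      using e r by (intro order_tendstoD(2)[OF lim2]) auto
    have "\<forall>\<^sub>F t in at_right 0. 0 \<le> g' x \<bullet> w + Cg * t * norm w ^ 2"
      using e1 e2 eventually_at_right_less[of 0]
    proof eventually_elim
      case (elim t)
      let ?y = "x + t *\<^sub>R w"
      have y: "?y \<in> ball x e" "?y \<in> ball x r" using elim by (auto simp: dist_norm)
      have "f ?y \<ge> t * (f' x \<bullet> w) - Cf * (t * norm w) ^ 2"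
        using Cf(2)[OF xK, of ?y] y r x elim by (auto simp: inner_scaleR_right power_mult_distrib)
      also have "t * (f' x \<bullet> w) - Cf * (t * norm w) ^ 2 = t * (f' x \<bullet> w - Cf * t * norm w ^ 2)"
        by (simp add: power2_eq_square algebra_simps)
      finally have "f ?y > 0" using mult_pos_pos[OF elim(3,1)] by linarith
      then have "g ?y > 0" using fg y by blast
      moreover have "g ?y \<le> t * (g' x \<bullet> w) + Cg * (t * norm w) ^ 2"
        using Cg(2)[OF xK, of ?y] y r x elim by (auto simp: power_mult_distrib)
      moreover have "t * (g' x \<bullet> w) + Cg * (t * norm w) ^ 2 = t * (g' x \<bullet> w + Cg * t * norm w ^ 2)"
        by (simp add: power2_eq_square algebra_simps)
      ultimately have "0 < t * (g' x \<bullet> w + Cg * t * norm w ^ 2)" by linarith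
      then show ?case using elim by (simp add: zero_less_mult_iff)
    qed
    moreover have "((\<lambda>t. g' x \<bullet> w + Cg * t * norm w ^ 2) \<longlongrightarrow> g' x \<bullet> w + Cg * 0 * norm w ^ 2) (at_right 0)"
      by (intro tendsto_intros)
    ultimately show ?thesis
      using tendsto_lowerbound[of _ "g' x \<bullet> w + Cg * 0 * norm w ^ 2" "at_right (0::real)" 0]
        trivial_limit_at_right_real by auto
  qed
  \<comment> \<open>The weak inequality becomes strict by testing with w = f' x - d g' x: d is so
    small that w still satisfies f' x . w > 0, and \<open>key\<close> then bounds f' x . g' x below
    by d |g' x|^2.\<close>
  define d where "d = norm (f' x) ^ 2 / (1 + \<bar>f' x \<bullet> g' x\<bar>) / 2"
  have d: "d > 0" using nz by (simp add: d_def)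
  have "d * \<bar>f' x \<bullet> g' x\<bar> < norm (f' x) ^ 2"
  proof -
    have "d * \<bar>f' x \<bullet> g' x\<bar> \<le> d * (1 + \<bar>f' x \<bullet> g' x\<bar>)" using d by (intro mult_left_mono) auto
    also have "\<dots> = norm (f' x) ^ 2 / 2" by (simp add: d_def field_simps)
    also have "\<dots> < norm (f' x) ^ 2" using nz by simp
    finally show ?thesis .
  qed
  moreover have "d * (f' x \<bullet> g' x) \<le> d * \<bar>f' x \<bullet> g' x\<bar>" using d by (intro mult_left_mono) auto
  ultimately have "f' x \<bullet> (f' x - d *\<^sub>R g' x) > 0"
    by (simp add: inner_diff_right power2_norm_eq_inner)
  from key[OF this] have "d * norm (g' x) ^ 2 \<le> f' x \<bullet> g' x"
    by (simp add: inner_diff_right power2_norm_eq_inner inner_commute)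
  moreover have "d * norm (g' x) ^ 2 > 0" using d nz by simp
  ultimately show ?thesis by linarith
qed


text \<open>\<open>Ck_boundary\<close> describes \<open>D\<close> locally by
  \<open>\<phi> < 0\<close> but does not state \<open>\<phi> = 0\<close> on the frontier. This
  follows: \<open>\<phi>\<close> is nonnegative off \<open>D\<close>, and \<open>\<phi> > 0\<close>
  at a frontier point would persist on a neighbourhood, which meets \<open>D\<close>. Interior
  points receive the constant 1, so that the patches cover the whole closure.\<close>

lemma local_defining_function:
  fixes D :: "(real^'d::finite) set"
  assumes D: "open D" and bd: "Ck_boundary (Suc (Suc k)) D" and K: "compact K" "convex K"
    and p: "p \<in> closure D"
  obtains r \<psi> g where "r > 0" "c11_on K \<psi> g" "\<And>x. x \<in> ball p r \<Longrightarrow> x \<in> D \<longleftrightarrow> \<psi> x > 0"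
    "\<And>x. x \<in> ball p r \<Longrightarrow> x \<in> frontier D \<Longrightarrow> \<psi> x = 0 \<and> g x \<noteq> 0"
proof (cases "p \<in> D")
  case True
  then obtain r where r: "r > 0" "ball p r \<subseteq> D" using D by (auto simp: open_contains_ball)
  show ?thesis
  proof (rule that[OF r(1) c11_on_const[of K 1]])
    show "x \<in> D \<longleftrightarrow> (1::real) > 0" if "x \<in> ball p r" for x using r that by auto
    show "(1::real) = 0 \<and> (0::real^'d) \<noteq> 0" if "x \<in> ball p r" "x \<in> frontier D" for x
      using r that D by (auto simp: frontier_def interior_open)
  qed
next
  case False
  then have "p \<in> frontier D" using p D by (simp add: frontier_def interior_open)
  then obtain r \<phi> where r: "r > 0" and \<phi>: "Ck (Suc (Suc k)) \<phi>"
      and nz: "\<And>x. x \<in> ball p r \<Longrightarrow> \<exists>i. pderiv_i i \<phi> x \<noteq> 0"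
      and eq: "D \<inter> ball p r = {x\<in>ball p r. \<phi> x < 0}"
    using bd unfolding Ck_boundary_def by meson
  have cont: "continuous_on UNIV \<phi>" using \<phi> by simp
  show ?thesis
  proof (rule that[OF r c11_on_uminus[OF Ck_c11_on[OF \<phi> K]]])
    show iff: "x \<in> D \<longleftrightarrow> - \<phi> x > 0" if "x \<in> ball p r" for x
    proof -
      have "x \<in> D \<inter> ball p r \<longleftrightarrow> \<phi> x < 0" unfolding eq using that by simp
      then show ?thesis using that by simp
    qed
    show "- \<phi> x = 0 \<and> - (\<chi> i. pderiv_i i \<phi> x) \<noteq> 0" if x: "x \<in> ball p r" "x \<in> frontier D" for x
    proof -
      have "x \<notin> D" using x D by (simp add: frontier_def interior_open)
      then have "\<phi> x \<ge> 0" using iff[OF x(1)] by simp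
      moreover have "\<not> \<phi> x > 0"
      proof
        assume *: "\<phi> x > 0"
        have "open (ball p r \<inter> \<phi> -` {0<..})"
          using cont by (intro open_Int open_vimage) auto
        moreover have "x \<in> ball p r \<inter> \<phi> -` {0<..}" using x * by auto
        moreover have "x \<in> closure D" using x by (simp add: frontier_def)
        ultimately obtain y where "y \<in> D" "y \<in> ball p r \<inter> \<phi> -` {0<..}"
          unfolding closure_iff_nhds_not_empty by blast
        then show False using iff[of y] by auto
      qed
      moreover have "(\<chi> i. pderiv_i i \<phi> x) \<noteq> 0" using nz[OF x(1)] by (auto simp: vec_eq_iff)
      ultimately show ?thesis by simp
    qed
  qed
qed

text \<open>On the frontier the active local functions vanish, so the gradient of the sum is a
  combination of local conormals with nonnegative weights, one of them positive; by
  \<open>conormals_aligned\<close> they cannot cancel. Compactness turns this into uniform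
  constants.\<close>

lemma global_defining_function:
  fixes D :: "(real^'d::finite) set"
  assumes D: "open D" "bounded D" "D \<noteq> {}" and bd: "Ck_boundary (Suc (Suc k)) D"
  obtains \<rho> g C L c \<eta> where
    "continuous_on UNIV \<rho>" "continuous_on UNIV g" "C \<ge> 0" "L \<ge> 1" "c > 0" "\<eta> > 0"
    "\<And>x y. x \<in> D \<Longrightarrow> norm (y - x) \<le> 1 \<Longrightarrow> \<bar>\<rho> y - \<rho> x - g x \<bullet> (y - x)\<bar> \<le> C * norm (y - x) ^ 2"
    "\<And>x. x \<in> D \<Longrightarrow> norm (g x) \<le> L"
    "\<And>x. x \<in> D \<Longrightarrow> \<rho> x > 0"
    "\<And>x. x \<in> D \<Longrightarrow> \<rho> x \<le> L * infdist x (frontier D)"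
    "\<And>x. x \<in> D \<Longrightarrow> \<rho> x \<le> \<eta> \<Longrightarrow> c \<le> norm (g x)"
proof -
  obtain R where R: "\<And>x. x \<in> D \<Longrightarrow> norm x \<le> R" using D(2) by (auto simp: bounded_iff)
  \<comment> \<open>One unit larger than \<open>D\<close>, so that the expansion reaches every
    \<open>y\<close> within distance 1 of a point of \<open>D\<close>.\<close>
  define K where "K = cball (0::real^'d) (R + 1)"
  have K: "compact K" "convex K" by (auto simp: K_def)
  have "closure D \<subseteq> cball 0 R" using R by (intro closure_minimal) auto
  then have clK: "closure D \<subseteq> interior K" unfolding K_def interior_cball by force
  then have DK: "closure D \<subseteq> K" using interior_subset by blast
  have cpt: "compact (closure D)" using D(2) by (simp add: compact_closure)
  have "\<forall>p. \<exists>r \<psi> g. p \<in> closure D \<longrightarrow> r > 0 \<and> c11_on K \<psi> g \<and> (\<forall>x\<in>ball p r. x \<in> D \<longleftrightarrow> \<psi> x > 0)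
      \<and> (\<forall>x\<in>ball p r. x \<in> frontier D \<longrightarrow> \<psi> x = 0 \<and> g x \<noteq> 0)"
  proof
    fix p
    show "\<exists>r \<psi> g. p \<in> closure D \<longrightarrow> r > 0 \<and> c11_on K \<psi> g \<and> (\<forall>x\<in>ball p r. x \<in> D \<longleftrightarrow> \<psi> x > 0)
      \<and> (\<forall>x\<in>ball p r. x \<in> frontier D \<longrightarrow> \<psi> x = 0 \<and> g x \<noteq> 0)"
    proof (cases "p \<in> closure D")
      case True
      show ?thesis
        by (rule local_defining_function[OF D(1) bd K True]) blast
    qed auto
  qed
  then obtain r \<psi> g where loc0: "\<forall>p. p \<in> closure D \<longrightarrow> r p > 0 \<and> c11_on K (\<psi> p) (g p)
      \<and> (\<forall>x\<in>ball p (r p). x \<in> D \<longleftrightarrow> \<psi> p x > 0)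
      \<and> (\<forall>x\<in>ball p (r p). x \<in> frontier D \<longrightarrow> \<psi> p x = 0 \<and> g p x \<noteq> 0)"
    unfolding choice_iff by (elim exE)
  have loc: "\<And>p. p \<in> closure D \<Longrightarrow> r p > 0"
      "\<And>p. p \<in> closure D \<Longrightarrow> c11_on K (\<psi> p) (g p)"
      "\<And>p x. p \<in> closure D \<Longrightarrow> x \<in> ball p (r p) \<Longrightarrow> x \<in> D \<longleftrightarrow> \<psi> p x > 0"
      "\<And>p x. p \<in> closure D \<Longrightarrow> x \<in> ball p (r p) \<Longrightarrow> x \<in> frontier D \<Longrightarrow> \<psi> p x = 0 \<and> g p x \<noteq> 0"
    using loc0 by blast+
  obtain P where P: "P \<subseteq> closure D" "finite P" "closure D \<subseteq> (\<Union>p\<in>P. ball p (r p))"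
  proof (rule compactE_image[OF cpt, of "closure D" "\<lambda>p. ball p (r p)"])
    show "closure D \<subseteq> (\<Union>p\<in>closure D. ball p (r p))" using loc(1) by force
  qed auto
  define \<rho> where "\<rho> x = (\<Sum>p\<in>P. bump p (r p) x * \<psi> p x)" for x
  define G where "G x = (\<Sum>p\<in>P. bump p (r p) x *\<^sub>R g p x + \<psi> p x *\<^sub>R bump_grad p (r p) x)" for x
  have c11: "c11_on K \<rho> G"
    unfolding \<rho>_def[abs_def] G_def[abs_def] using P loc(2) K
    by (intro c11_on_sum c11_on_mult c11_on_bump) auto
  have \<rho>_pos: "\<rho> x > 0" if x: "x \<in> D" for x
  proof -
    have nn: "bump p (r p) x * \<psi> p x \<ge> 0" if "p \<in> P" for p
    proof (cases "x \<in> ball p (r p)")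
      case True
      then show ?thesis using loc(3)[of p x] bump_pos[OF True] x P that by (auto intro!: mult_nonneg_nonneg)
    next
      case False
      then show ?thesis using bump_outside[OF loc(1) False] P that by auto
    qed
    obtain q where q: "q \<in> P" "x \<in> ball q (r q)" using P(3) x closure_subset by blast
    have "0 < bump q (r q) x * \<psi> q x" using loc(3)[of q x] bump_pos[OF q(2)] x q P by auto
    then show ?thesis unfolding \<rho>_def using nn P(2) q(1) by (intro sum_pos2[of P q]) auto
  qed
  have \<rho>_frontier: "\<rho> x = 0" and G_frontier: "G x \<noteq> 0" if x: "x \<in> frontier D" for x
  proof -
    have xcl: "x \<in> closure D" using x by (simp add: frontier_def)
    have "bump p (r p) x * \<psi> p x = 0" if "p \<in> P" for p
      using bump_outside[OF loc(1), of p x] loc(4)[of p x] x P that by auto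
    then show "\<rho> x = 0" unfolding \<rho>_def by (rule sum.neutral[OF ballI])
    have Gx: "G x = (\<Sum>p\<in>P. bump p (r p) x *\<^sub>R g p x)"
      unfolding G_def using bump_outside[OF loc(1), of _ x] loc(4)[of _ x] x P
      by (intro sum.cong) auto
    obtain q where q: "q \<in> P" "x \<in> ball q (r q)" using P(3) xcl by blast
    have al: "g q x \<bullet> g p x > 0" if p: "p \<in> P" "x \<in> ball p (r p)" for p
    proof -
      obtain e1 where e1: "e1 > 0" "ball x e1 \<subseteq> ball p (r p)"
        using p(2) open_ball open_contains_ball by blast
      obtain e2 where e2: "e2 > 0" "ball x e2 \<subseteq> ball q (r q)"
        using q(2) open_ball open_contains_ball by blast
      show ?thesis
      proof (rule conormals_aligned[of K "\<psi> q" "g q" "\<psi> p" "g p" x "min e1 e2"])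
        show "\<psi> p y > 0" if "y \<in> ball x (min e1 e2)" "\<psi> q y > 0" for y
        proof -
          have "y \<in> ball p (r p)" "y \<in> ball q (r q)" using that e1 e2 by auto
          then show ?thesis using that loc(3)[of p y] loc(3)[of q y] P p q by auto
        qed
      qed (use loc(2,4) P p q x clK xcl e1 e2 in auto)
    qed
    \<comment> \<open>Tested against one active conormal \<open>g q x\<close>, all terms are
      nonnegative and the one of \<open>q\<close> is positive.\<close>
    have "G x \<bullet> g q x = (\<Sum>p\<in>P. bump p (r p) x * (g p x \<bullet> g q x))"
      unfolding Gx by (simp add: inner_sum_left)
    also have "\<dots> > 0"
    proof (rule sum_pos2[OF P(2) q(1)])
      show "0 < bump q (r q) x * (g q x \<bullet> g q x)" using al[OF q] bump_pos[OF q(2)] by auto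
      show "0 \<le> bump p (r p) x * (g p x \<bullet> g q x)" if "p \<in> P" for p
      proof (cases "x \<in> ball p (r p)")
        case True
        then show ?thesis using al[OF that True] bump_pos[OF True] by (simp add: inner_commute)
      next
        case False
        then show ?thesis using bump_outside[OF loc(1) False] P that by auto
      qed
    qed
    finally show "G x \<noteq> 0" by auto
  qed
  have cont: "continuous_on UNIV \<rho>" "continuous_on UNIV G" using c11 by (auto simp: c11_on_def)
  obtain C where C: "C \<ge> 0"
    "\<And>x y. x \<in> K \<Longrightarrow> y \<in> K \<Longrightarrow> \<bar>\<rho> y - \<rho> x - G x \<bullet> (y - x)\<bar> \<le> C * norm (y - x) ^ 2"
    by (rule c11_onE[OF c11]) auto
  obtain L1 where L1: "L1 \<ge> 0" "\<And>x y. x \<in> K \<Longrightarrow> y \<in> K \<Longrightarrow> \<bar>\<rho> y - \<rho> x\<bar> \<le> L1 * norm (y - x)"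
    by (rule c11_on_Lipschitz[OF c11 K(1)]) auto
  obtain L2 where L2: "L2 \<ge> 0" "\<And>x. x \<in> K \<Longrightarrow> norm (G x) \<le> L2"
    by (rule continuous_on_compact_bound[OF cont(2) K(1)]) auto
  define L where "L = max 1 (max L1 L2)"
  \<comment> \<open>\<open>\<rho>\<close> is positive inside and \<open>G\<close> is nonzero on the
    frontier, so the minimum \<open>m\<close> of the maximum is positive. Where
    \<open>\<rho>\<close> is at most m/2, the norm of \<open>G\<close> must attain this maximum:
    hence \<open>\<eta>\<close> = m/2 and \<open>c\<close> = m.\<close>
  have "\<exists>m>0. \<forall>x\<in>closure D. m \<le> max (\<rho> x) (norm (G x))"
  proof -
    have "continuous_on (closure D) (\<lambda>x. max (\<rho> x) (norm (G x)))"
      using cont by (intro continuous_intros) (auto intro: continuous_on_subset)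
    moreover have "closure D \<noteq> {}" using D(3) by simp
    ultimately obtain z where z: "z \<in> closure D"
        "\<And>x. x \<in> closure D \<Longrightarrow> max (\<rho> z) (norm (G z)) \<le> max (\<rho> x) (norm (G x))"
      using continuous_attains_inf[OF cpt] by blast
    have "max (\<rho> z) (norm (G z)) > 0"
    proof (cases "z \<in> D")
      case True then show ?thesis using \<rho>_pos[of z] by auto
    next
      case False
      then have "z \<in> frontier D" using z D(1) by (simp add: frontier_def interior_open)
      then show ?thesis using G_frontier[of z] by (simp add: less_max_iff_disj)
    qed
    then show ?thesis using z by blast
  qed
  then obtain m where m: "m > 0" "\<And>x. x \<in> closure D \<Longrightarrow> m \<le> max (\<rho> x) (norm (G x))" by blast
  have fne: "frontier D \<noteq> {}"
    using D(2,3) by (intro frontier_not_empty) auto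
  show ?thesis
  proof (rule that[OF cont C(1) _ m(1), of L "m/2"])
    show "L \<ge> 1" by (simp add: L_def)
    show "m / 2 > 0" using m by simp
    fix x assume x: "x \<in> D"
    have xcl: "x \<in> closure D" using x closure_subset by blast
    then have xK: "x \<in> K" using DK by blast
    show "\<bar>\<rho> y - \<rho> x - G x \<bullet> (y - x)\<bar> \<le> C * norm (y - x) ^ 2" if "norm (y - x) \<le> 1" for y
    proof -
      have "norm y \<le> R + 1" using R[OF x] that norm_triangle_sub[of y x] by linarith
      then have "y \<in> K" by (simp add: K_def)
      then show ?thesis using C(2)[OF xK] by blast
    qed
    show "norm (G x) \<le> L" using L2(2)[OF xK] by (simp add: L_def)
    show "\<rho> x > 0" using \<rho>_pos x by blast
    show "\<rho> x \<le> L * infdist x (frontier D)"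
    proof -
      obtain q where q: "q \<in> frontier D" "infdist x (frontier D) = dist x q"
        using infdist_attains_inf[OF frontier_closed fne] by blast
      have "q \<in> K" using q(1) DK by (auto simp: frontier_def)
      then have "\<rho> x \<le> L1 * norm (x - q)"
        using L1(2)[of q x] xK \<rho>_frontier[OF q(1)] by auto
      also have "\<dots> \<le> L * norm (x - q)" by (intro mult_right_mono) (auto simp: L_def)
      finally show ?thesis using q by (simp add: dist_norm)
    qed
    show "m \<le> norm (G x)" if "\<rho> x \<le> m / 2" using m(2)[OF xcl] that m(1) by (auto simp: max_def split: if_splits)
  qed
qed

section \<open>The Lyapunov function\<close>

text \<open>The cap makes \<open>lyap\<close> bounded by \<open>O(\<delta>\<^sup>2)\<close> also below \<open>-\<delta>\<close>, a region that is reached only by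
  jumps out of \<open>D\<close> longer than a multiple of \<open>\<delta>\<close>.\<close>
definition lyap :: "real \<Rightarrow> real \<Rightarrow> real \<Rightarrow> real" where
  "lyap B \<delta> r = (if - \<delta> \<le> r \<and> r \<le> (B - 1) * \<delta> then 2 * B * \<delta> * r - r\<^sup>2 else (B\<^sup>2 - 1) * \<delta>\<^sup>2)"

text \<open>Completing the square, the parabola is
  \<open>B\<^sup>2 * \<delta>\<^sup>2 - (B * \<delta> - r)\<^sup>2\<close>: it increases up to its
  vertex \<open>B * \<delta>\<close> and reaches the cap at
  \<open>(B - 1) * \<delta>\<close>.\<close>

lemma lyap_le:
  assumes "B \<ge> 1" "\<delta> \<ge> 0"
  shows "lyap B \<delta> r \<le> (B\<^sup>2 - 1) * \<delta>\<^sup>2"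
proof (cases "- \<delta> \<le> r \<and> r \<le> (B - 1) * \<delta>")
  case True
  then have "\<delta> \<le> B * \<delta> - r" by (simp add: algebra_simps)
  then have "\<delta>\<^sup>2 \<le> (B * \<delta> - r)\<^sup>2" using assms by (intro power_mono) auto
  then show ?thesis using True by (simp add: lyap_def power2_eq_square algebra_simps)
qed (auto simp: lyap_def)

text \<open>Between \<open>(B - 1) * \<delta>\<close> and the vertex the parabola lies above the
  cap, so one formula bounds \<open>V\<close> from above after every short jump that starts in the
  strip.\<close>

lemma lyap_le_quadratic:
  assumes "B \<ge> 1" "\<delta> \<ge> 0" "- \<delta> \<le> r" "r \<le> B * \<delta>"
  shows "lyap B \<delta> r \<le> 2 * B * \<delta> * r - r\<^sup>2"
proof (cases "r \<le> (B - 1) * \<delta>")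
  case False
  then have "(B * \<delta> - r)\<^sup>2 \<le> \<delta>\<^sup>2" using assms by (intro power_mono) (auto simp: algebra_simps)
  then show ?thesis using False by (simp add: lyap_def power2_eq_square algebra_simps)
qed (use assms in \<open>auto simp: lyap_def\<close>)

lemma lyap_ge:
  assumes "B \<ge> 1" "\<delta> \<ge> 0"
  shows "- ((2 * B + 1) * \<delta>\<^sup>2) \<le> lyap B \<delta> r"
proof (cases "- \<delta> \<le> r \<and> r \<le> (B - 1) * \<delta>")
  case True
  have "0 \<le> (r + \<delta>) * ((2 * B + 1) * \<delta> - r)" using True assms
    by (intro mult_nonneg_nonneg) (auto simp: algebra_simps intro: order_trans)
  then show ?thesis using True by (simp add: lyap_def power2_eq_square algebra_simps)
next
  case False
  have "0 \<le> (B\<^sup>2 - 1) * \<delta>\<^sup>2" using assms by (intro mult_nonneg_nonneg) auto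
  moreover have "0 \<le> (2 * B + 1) * \<delta>\<^sup>2" using assms by (intro mult_nonneg_nonneg) auto
  ultimately show ?thesis using False by (auto simp: lyap_def)
qed

text \<open>Pathwise version of the decrease. \<open>G\<close> stands for the diffusion part of a
  step, \<open>R\<close> for the drift and the Milstein correction. The terms in
  \<open>n \<bullet> G\<close> stay explicit because their means are under control: the linear one
  averages to zero and the square is bounded below by ellipticity.\<close>

lemma lyap_step:
  fixes L C :: real
  assumes L: "L \<ge> 1" and C: "C \<ge> 0"
  defines "B \<equiv> L + 1"
  obtains A where "A \<ge> 0" "\<And>\<delta> \<Delta> r r' (n :: 'a::euclidean_space) G R.
    0 < \<delta> \<Longrightarrow> \<delta> \<le> 1 \<Longrightarrow> 0 < \<Delta> \<Longrightarrow> 0 < r \<Longrightarrow> r \<le> L * \<delta> \<Longrightarrow> norm n \<le> L \<Longrightarrow>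
    (norm (G + R) \<le> 1 \<Longrightarrow> \<bar>r' - r - n \<bullet> (G + R)\<bar> \<le> C * norm (G + R) ^ 2) \<Longrightarrow>
    lyap B \<delta> r' \<le> lyap B \<delta> r + 2 * (B * \<delta> - r) * (n \<bullet> G) - (n \<bullet> G)\<^sup>2 / 2
      + A * (\<delta> * norm G ^ 2 + norm R ^ 2 + \<delta> * \<Delta> + \<delta> * norm R ^ 2 / \<Delta> + norm G ^ 4 / \<delta>\<^sup>2)"
proof -
  \<comment> \<open>A jump of length at most \<open>k * \<delta>\<close> changes
    \<open>\<rho>\<close> by at most \<open>(L + C) * k * \<delta> = \<delta>\<close>; from
    \<open>0 < r \<le> L * \<delta>\<close> it ends between -\<delta> and
    \<open>B * \<delta>\<close>, the range of \<open>lyap_le_quadratic\<close>.\<close>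
  define k where "k = 1 / (L + C)"
  have k: "0 < k" "k \<le> 1" "(L + C) * k = 1" using L C by (auto simp: k_def)
  define A1 where "A1 = 2 * (2 * B * C + 2 * C\<^sup>2) + B * L + 2 * L\<^sup>2"
  \<comment> \<open>The coefficient of \<open>m\<^sup>2\<close> that results in \<open>bound\<close>
    below from inserting \<open>\<delta> \<le> 2 * m / k\<close> and
    \<open>norm G \<le> m\<close>.\<close>
  define c where "c = 4 * B\<^sup>2 / k\<^sup>2 + 4 * B * L / k + L\<^sup>2 / 2"
  define A2 where "A2 = c + 4 * c / k\<^sup>2"
  have B: "B \<ge> 2" using L by (simp add: B_def)
  have A1: "A1 \<ge> 0" "2 * (2 * B * C + 2 * C\<^sup>2) \<ge> 0" "B * L \<ge> 0" "2 * L\<^sup>2 \<ge> 0"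
    using B L C by (auto simp: A1_def)
  have c: "c \<ge> 0" using B L k by (auto simp: c_def)
  then have A2: "A2 \<ge> c" "A2 \<ge> 4 * c / k\<^sup>2" "A2 \<ge> 0" using k by (auto simp: A2_def)
  show ?thesis
  proof (rule that[of "A1 + A2"])
    show "A1 + A2 \<ge> 0" using A1 A2 by simp
    fix \<delta> \<Delta> r r' :: real and n G R :: 'a
    assume \<delta>: "0 < \<delta>" "\<delta> \<le> 1" and \<Delta>: "0 < \<Delta>" and r: "0 < r" "r \<le> L * \<delta>" and n: "norm n \<le> L"
      and quad: "norm (G + R) \<le> 1 \<Longrightarrow> \<bar>r' - r - n \<bullet> (G + R)\<bar> \<le> C * norm (G + R) ^ 2"
    define z where "z = norm (G + R)"
    define p where "p = n \<bullet> G"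
    define q where "q = n \<bullet> R"
    define e where "e = r' - r - n \<bullet> (G + R)"
    define S where "S = \<delta> * norm G ^ 2 + norm R ^ 2 + \<delta> * \<Delta> + \<delta> * norm R ^ 2 / \<Delta> + norm G ^ 4 / \<delta>\<^sup>2"
    have nn: "0 \<le> \<delta> * norm G ^ 2" "0 \<le> norm R ^ 2" "0 \<le> \<delta> * \<Delta>" "0 \<le> \<delta> * norm R ^ 2 / \<Delta>" "0 \<le> norm G ^ 4 / \<delta>\<^sup>2"
      using \<delta> \<Delta> by auto
    have S0: "S \<ge> 0" using nn by (simp add: S_def)
    have z0: "z \<ge> 0" "z \<le> norm G + norm R" by (auto simp: z_def norm_triangle_ineq)
    have pL: "\<bar>p\<bar> \<le> L * norm G" and qL: "\<bar>q\<bar> \<le> L * norm R"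
      using order_trans[OF Cauchy_Schwarz_ineq2[of n G] mult_right_mono[OF n norm_ge_zero]]
        order_trans[OF Cauchy_Schwarz_ineq2[of n R] mult_right_mono[OF n norm_ge_zero]]
      by (auto simp: p_def q_def)
    have pq: "n \<bullet> (G + R) = p + q" by (simp add: p_def q_def inner_add_right)
    have r'eq: "r' = r + p + q + e" using pq by (simp add: e_def)
    have Vr: "lyap B \<delta> r = 2 * B * \<delta> * r - r\<^sup>2" using r \<delta> by (simp add: lyap_def B_def)
    have LB: "L * \<delta> \<le> B * \<delta>" using \<delta> by (simp add: B_def)
    have \<alpha>: "0 \<le> B * \<delta> - r" "B * \<delta> - r \<le> B * \<delta>" using r LB by auto
    have "lyap B \<delta> r' \<le> lyap B \<delta> r + 2 * (B * \<delta> - r) * p - p\<^sup>2 / 2 + (A1 + A2) * S"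
    \<comment> \<open>Up to distance \<open>k\<delta>\<close> the quadratic formula for \<open>V\<close> applies; beyond it \<open>\<delta>\<close> is dominated by the
      length of the jump, and every term by \<open>\<bar>R\<bar>\<^sup>2\<close> or \<open>\<bar>G\<bar>\<^sup>4/\<delta>\<^sup>2\<close>.\<close>
    proof (cases "z \<le> k * \<delta>")
      case True
      have kd: "k * \<delta> \<le> \<delta>" using k \<delta> by simp
      then have z1: "z \<le> \<delta>" "z \<le> 1" using True \<delta> by linarith+
      have e: "\<bar>e\<bar> \<le> C * z\<^sup>2" using quad z1 by (simp add: e_def z_def)
      have zz: "z\<^sup>2 \<le> z" using z0 z1 by (simp add: power2_eq_square mult_left_le)
      have "\<bar>p + q\<bar> \<le> L * z"
        using Cauchy_Schwarz_ineq2[of n "G + R"] n unfolding pq[symmetric] z_def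
        by (meson mult_right_mono norm_ge_zero order_trans)
      moreover have "C * z\<^sup>2 \<le> C * z" using zz C by (intro mult_left_mono) auto
      moreover have "(L + C) * z \<le> (L + C) * (k * \<delta>)" using True L C by (intro mult_left_mono) auto
      moreover have "(L + C) * (k * \<delta>) = \<delta>" using k by (metis mult.assoc mult_1)
      ultimately have "\<bar>p + q + e\<bar> \<le> \<delta>" using e by (simp add: distrib_right)
      then have "- \<delta> \<le> r'" "r' \<le> B * \<delta>" using r unfolding r'eq by (auto simp: B_def distrib_right)
      then have "lyap B \<delta> r' \<le> 2 * B * \<delta> * r' - r'\<^sup>2" using B \<delta> by (intro lyap_le_quadratic) auto
      also have "\<dots> = lyap B \<delta> r + 2 * (B * \<delta> - r) * p + 2 * (B * \<delta> - r) * q + 2 * (B * \<delta> - r) * e - (p + q + e)\<^sup>2"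
        unfolding Vr r'eq by (simp add: power2_eq_square algebra_simps)
      finally have 1: "lyap B \<delta> r' \<le> lyap B \<delta> r + 2 * (B * \<delta> - r) * p + 2 * (B * \<delta> - r) * q
          + 2 * (B * \<delta> - r) * e - (p + q + e)\<^sup>2" .
      have "(B * \<delta> - r) * q \<le> (B * \<delta>) * (L * norm R)"
        using \<alpha> qL by (intro order_trans[OF mult_left_mono[of q "L * norm R"]] mult_right_mono) auto
      \<comment> \<open>Young's inequality with weight \<Delta>: the mean square of \<open>R\<close>
        will be of order \<Delta>^2, so \<open>\<delta> * norm R ^ 2 / \<Delta>\<close> costs only
        O(\<delta> \<Delta>) in the mean.\<close>
      moreover have "2 * norm R \<le> \<Delta> + norm R ^ 2 / \<Delta>"
      proof -
        have "0 \<le> (norm R - \<Delta>)\<^sup>2 / \<Delta>" using \<Delta> by simp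
        also have "\<dots> = norm R ^ 2 / \<Delta> - 2 * norm R + \<Delta>" using \<Delta> by (simp add: power2_eq_square field_simps)
        finally show ?thesis by simp
      qed
      then have "(B * L * \<delta>) * (2 * norm R) \<le> (B * L * \<delta>) * (\<Delta> + norm R ^ 2 / \<Delta>)"
        using B L \<delta> by (intro mult_left_mono) auto
      ultimately have 2: "2 * (B * \<delta> - r) * q \<le> B * L * (\<delta> * \<Delta> + \<delta> * norm R ^ 2 / \<Delta>)"
        by (simp add: algebra_simps)
      have "(B * \<delta> - r) * e \<le> (B * \<delta>) * (C * z\<^sup>2)"
        using \<alpha> e C by (intro order_trans[OF mult_left_mono[of e "C * z\<^sup>2"]] mult_right_mono) auto
      then have 3: "2 * (B * \<delta> - r) * e \<le> 2 * B * C * (\<delta> * z\<^sup>2)" by (simp add: algebra_simps)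
      \<comment> \<open>Half of p^2 is given up to absorb the cross term between \<open>p\<close>
        and \<open>q + e\<close>.\<close>
      have "0 \<le> (p + 2 * (q + e))\<^sup>2 / 2" by simp
      then have 4: "- (p + q + e)\<^sup>2 \<le> - p\<^sup>2 / 2 + (q + e)\<^sup>2" by (simp add: power2_eq_square algebra_simps)
      have "0 \<le> (q - e)\<^sup>2" by simp
      then have 5: "(q + e)\<^sup>2 \<le> 2 * q\<^sup>2 + 2 * e\<^sup>2" by (simp add: power2_eq_square algebra_simps)
      have "\<bar>q\<bar>\<^sup>2 \<le> (L * norm R)\<^sup>2" using qL by (intro power_mono) auto
      then have 6: "q\<^sup>2 \<le> L\<^sup>2 * norm R ^ 2" by (simp add: power_mult_distrib)
      have "\<bar>e\<bar>\<^sup>2 \<le> (C * z\<^sup>2)\<^sup>2" using e by (intro power_mono) auto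
      also have "\<dots> = C\<^sup>2 * (z\<^sup>2 * z\<^sup>2)" by (simp add: power2_eq_square)
      also have "\<dots> \<le> C\<^sup>2 * (\<delta> * z\<^sup>2)" using zz z1 by (intro mult_left_mono mult_right_mono) auto
      finally have 7: "e\<^sup>2 \<le> C\<^sup>2 * (\<delta> * z\<^sup>2)" by simp
      have "z\<^sup>2 \<le> (norm G + norm R)\<^sup>2" using z0 by (intro power_mono) auto
      also have "\<dots> \<le> 2 * norm G ^ 2 + 2 * norm R ^ 2"
        using sum_squares_bound[of "norm G" "norm R"] by (simp add: power2_eq_square algebra_simps)
      finally have "\<delta> * z\<^sup>2 \<le> \<delta> * (2 * norm G ^ 2 + 2 * norm R ^ 2)" using \<delta> by (intro mult_left_mono) auto
      moreover have "\<delta> * norm R ^ 2 \<le> norm R ^ 2" using \<delta> by (intro mult_left_le_one_le) auto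
      ultimately have 8: "\<delta> * z\<^sup>2 \<le> 2 * (\<delta> * norm G ^ 2 + norm R ^ 2)" by (simp add: algebra_simps)
      have "(2 * B * C + 2 * C\<^sup>2) * (\<delta> * z\<^sup>2) \<le> (2 * B * C + 2 * C\<^sup>2) * (2 * (\<delta> * norm G ^ 2 + norm R ^ 2))"
        using 8 B C by (intro mult_left_mono) auto
      also have "\<dots> = 2 * (2 * B * C + 2 * C\<^sup>2) * (\<delta> * norm G ^ 2 + norm R ^ 2)" by (simp add: algebra_simps)
      also have "\<dots> \<le> 2 * (2 * B * C + 2 * C\<^sup>2) * S"
        using A1 nn unfolding S_def by (intro mult_left_mono) auto
      finally have 9: "(2 * B * C + 2 * C\<^sup>2) * (\<delta> * z\<^sup>2) \<le> 2 * (2 * B * C + 2 * C\<^sup>2) * S" .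
      have 10: "B * L * (\<delta> * \<Delta> + \<delta> * norm R ^ 2 / \<Delta>) \<le> B * L * S"
        using A1 nn unfolding S_def by (intro mult_left_mono) auto
      have 11: "2 * L\<^sup>2 * norm R ^ 2 \<le> 2 * L\<^sup>2 * S"
        using A1 nn unfolding S_def by (intro mult_left_mono) auto
      have "lyap B \<delta> r' \<le> lyap B \<delta> r + 2 * (B * \<delta> - r) * p - p\<^sup>2 / 2 + A1 * S"
        using 1 2 3 4 5 6 7 9 10 11 unfolding A1_def by (simp add: distrib_right)
      moreover have "A2 * S \<ge> 0" using A2 S0 by simp
      ultimately show ?thesis by (simp add: distrib_right)
    next
      case False
      let ?g = "norm G" and ?R = "norm R"
      have dz: "k * \<delta> \<le> ?g + ?R" using False z0 by linarith
      \<comment> \<open>After a long jump \<open>V\<close> is only known to be at most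
        \<open>B\<^sup>2 * \<delta>\<^sup>2\<close>, and before it to be nonnegative; the left side
        adds the two terms in \<open>n \<bullet> G\<close> that the claim keeps. It is used with
        \<open>m\<close> the larger of \<open>norm G\<close> and \<open>norm R\<close>, which is at
        least half of \<open>k * \<delta>\<close>.\<close>
      have bound: "B\<^sup>2 * \<delta>\<^sup>2 + 2 * (B * \<delta>) * (L * ?g) + L\<^sup>2 * ?g\<^sup>2 / 2 \<le> c * m\<^sup>2"
        if m: "k * \<delta> \<le> 2 * m" "?g \<le> m" for m
      proof -
        have m0: "m \<ge> 0" using m by (meson norm_ge_zero order_trans)
        have dm: "\<delta> \<le> 2 * m / k" using m k by (simp add: field_simps)
        have "\<delta>\<^sup>2 \<le> (2 * m / k)\<^sup>2" using dm \<delta> by (intro power_mono) auto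
        then have "B\<^sup>2 * \<delta>\<^sup>2 \<le> B\<^sup>2 * (2 * m / k)\<^sup>2" by (intro mult_left_mono) auto
        moreover have "2 * (B * \<delta>) * (L * ?g) \<le> 2 * (B * (2 * m / k)) * (L * m)"
          using dm m m0 B L \<delta> k by (intro mult_mono) auto
        moreover have "L\<^sup>2 * ?g\<^sup>2 / 2 \<le> L\<^sup>2 * m\<^sup>2 / 2"
          using m by (intro divide_right_mono mult_left_mono power_mono) auto
        moreover have "B\<^sup>2 * (2 * m / k)\<^sup>2 + 2 * (B * (2 * m / k)) * (L * m) + L\<^sup>2 * m\<^sup>2 / 2 = c * m\<^sup>2"
          using k by (simp add: c_def power2_eq_square field_simps)
        ultimately show ?thesis by linarith
      qed
      have "c * (max ?g ?R)\<^sup>2 \<le> A2 * S"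
      proof (cases "?g \<le> ?R")
        case True
        then have "c * (max ?g ?R)\<^sup>2 = c * ?R\<^sup>2" by (simp add: max_def)
        also have "\<dots> \<le> A2 * S" using A2 c nn unfolding S_def by (intro mult_mono) auto
        finally show ?thesis .
      next
        case F: False
        then have "k * \<delta> \<le> 2 * ?g" using dz by simp
        then have "(k * \<delta>)\<^sup>2 \<le> (2 * ?g)\<^sup>2" using k \<delta> by (intro power_mono) auto
        then have "(k * \<delta>)\<^sup>2 * ?g\<^sup>2 \<le> (2 * ?g)\<^sup>2 * ?g\<^sup>2" by (intro mult_right_mono) auto
        then have "?g\<^sup>2 \<le> 4 / k\<^sup>2 * (?g ^ 4 / \<delta>\<^sup>2)"
          using k \<delta> by (simp add: field_simps power2_eq_square power4_eq_xxxx)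
        then have "c * ?g\<^sup>2 \<le> c * (4 / k\<^sup>2 * (?g ^ 4 / \<delta>\<^sup>2))" using c by (intro mult_left_mono) auto
        also have "\<dots> = 4 * c / k\<^sup>2 * (?g ^ 4 / \<delta>\<^sup>2)" by simp
        also have "\<dots> \<le> A2 * S" using A2 c nn k unfolding S_def by (intro mult_mono) auto
        finally show ?thesis using F by (simp add: max_def)
      qed
      moreover have "B\<^sup>2 * \<delta>\<^sup>2 + 2 * (B * \<delta>) * (L * ?g) + L\<^sup>2 * ?g\<^sup>2 / 2 \<le> c * (max ?g ?R)\<^sup>2"
        using dz by (intro bound) auto
      moreover have "lyap B \<delta> r' \<le> B\<^sup>2 * \<delta>\<^sup>2"
        using lyap_le[of B \<delta> r'] B \<delta> by (simp add: left_diff_distrib)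
          (smt (verit) zero_le_power2)
      moreover have "0 \<le> lyap B \<delta> r"
      proof -
        have "0 \<le> r * (2 * B * \<delta> - r)" using r LB \<alpha> by (intro mult_nonneg_nonneg) auto
        then show ?thesis unfolding Vr by (simp add: power2_eq_square algebra_simps)
      qed
      moreover have "- (2 * (B * \<delta> - r) * p) \<le> 2 * (B * \<delta>) * (L * ?g)"
      proof -
        have "(B * \<delta> - r) * (- p) \<le> (B * \<delta>) * (L * ?g)"
          using \<alpha> pL by (intro order_trans[OF mult_left_mono[of "- p" "L * ?g"]] mult_right_mono) auto
        then show ?thesis by (simp add: algebra_simps)
      qed
      moreover have "p\<^sup>2 \<le> L\<^sup>2 * ?g\<^sup>2"
        using power_mono[OF pL, of 2] by (simp add: power_mult_distrib)
      moreover have "A1 * S \<ge> 0" using A1 S0 by simp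
      ultimately show ?thesis unfolding distrib_right by linarith
    qed
    then show "lyap B \<delta> r' \<le> lyap B \<delta> r + 2 * (B * \<delta> - r) * (n \<bullet> G) - (n \<bullet> G)\<^sup>2 / 2
      + (A1 + A2) * (\<delta> * norm G ^ 2 + norm R ^ 2 + \<delta> * \<Delta> + \<delta> * norm R ^ 2 / \<Delta> + norm G ^ 4 / \<delta>\<^sup>2)"
      by (simp add: S_def p_def)
  qed
qed

section \<open>Increments of the Wiener process\<close>

lemma Int_stable_vimages: "Int_stable {Z -` A \<inter> S |A. A \<in> sets N}"
proof (rule Int_stableI)
  fix a b assume "a \<in> {Z -` A \<inter> S |A. A \<in> sets N}" "b \<in> {Z -` A \<inter> S |A. A \<in> sets N}"
  then obtain A B where "A \<in> sets N" "B \<in> sets N" "a = Z -` A \<inter> S" "b = Z -` B \<inter> S" by auto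
  then show "a \<inter> b \<in> {Z -` A \<inter> S |A. A \<in> sets N}"
    by (auto intro!: exI[of _ "A \<inter> B"])
qed

lemma (in prob_space) indep_varI_prob:
  assumes X[measurable]: "random_variable S X" and Y[measurable]: "random_variable T Y"
    and eq: "\<And>A B. A \<in> sets S \<Longrightarrow> B \<in> sets T \<Longrightarrow>
      prob (X -` A \<inter> space M \<inter> (Y -` B \<inter> space M)) = prob (X -` A \<inter> space M) * prob (Y -` B \<inter> space M)"
  shows "indep_var S X T Y"
proof -
  have "indep_set {X -` A \<inter> space M |A. A \<in> sets S} {Y -` A \<inter> space M |A. A \<in> sets T}"
    by (rule indep_setI) (auto intro: measurable_sets[OF X] measurable_sets[OF Y] eq)
  from indep_set_sigma_sets[OF this Int_stable_vimages Int_stable_vimages] show ?thesis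
    unfolding indep_var_eq using X Y by blast
qed

lemma borel_measurable_vec_nth[measurable (raw)]:
  fixes f :: "'a \<Rightarrow> real^'n::finite"
  assumes "f \<in> borel_measurable M"
  shows "(\<lambda>x. f x $ i) \<in> borel_measurable M"
proof -
  have "(\<lambda>v::real^'n. v $ i) \<in> borel_measurable borel"
    by (intro borel_measurable_continuous_onI continuous_intros)
  from measurable_compose[OF assms this] show ?thesis .
qed

lemma borel_measurable_vec_lambda:
  fixes f :: "'n::finite \<Rightarrow> 'a \<Rightarrow> real"
  assumes "\<And>i. f i \<in> borel_measurable M"
  shows "(\<lambda>x. \<chi> i. f i x) \<in> borel_measurable M"
  unfolding borel_measurable_euclidean_space[of "\<lambda>x. \<chi> i. f i x"]
  using assms by (auto simp: Basis_vec_def inner_axis)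

lemma nn_integral_lborel_prod_vec:
  fixes f :: "'n::finite \<Rightarrow> real \<Rightarrow> ennreal"
  assumes "\<And>j. f j \<in> borel_measurable borel"
  shows "(\<integral>\<^sup>+x. (\<Prod>j\<in>UNIV. f j ((x::real^'n) $ j)) \<partial>lborel) = (\<Prod>j\<in>UNIV. \<integral>\<^sup>+x. f j x \<partial>lborel)"
proof -
  have bij: "bij_betw (\<lambda>j::'n. axis j (1::real)) UNIV Basis"
    by (rule bij_betwI[where g = axis_index]) (auto simp: Basis_vec_def axis_index[symmetric])
  have "(\<Prod>j\<in>UNIV. f j ((x::real^'n) $ j)) = (\<Prod>b\<in>Basis. f (axis_index b) (x \<bullet> b))" for x
    by (subst prod.reindex_bij_betw[OF bij, symmetric]) (simp add: inner_axis)
  moreover have "(\<Prod>j\<in>UNIV. \<integral>\<^sup>+x. f j x \<partial>lborel) = (\<Prod>b\<in>(Basis::(real^'n) set). \<integral>\<^sup>+x. f (axis_index b) x \<partial>lborel)"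
    by (subst prod.reindex_bij_betw[OF bij, symmetric]) simp
  ultimately show ?thesis
    using nn_integral_lborel_prod[of "\<lambda>b. f (axis_index (b::real^'n))"] assms by simp
qed

section \<open>Independence and moments of Wiener increments\<close>

locale wiener =
  fixes M :: "'w measure" and F :: "real \<Rightarrow> 'w measure" and W :: "real \<Rightarrow> 'w \<Rightarrow> real^'m::finite"
  assumes wiener: "wiener_process M F W"
begin

sublocale prob_space M
  using wiener by (simp add: wiener_process_def)

lemma subalgebra_F: "0 \<le> t \<Longrightarrow> subalgebra M (F t)"
  using wiener by (simp add: wiener_process_def)

lemma space_F: "0 \<le> t \<Longrightarrow> space (F t) = space M"
  using subalgebra_F by (simp add: subalgebra_def)

lemma sets_F: "0 \<le> t \<Longrightarrow> A \<in> sets (F t) \<Longrightarrow> A \<in> sets M"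
  using subalgebra_F by (auto simp: subalgebra_def)

lemma measurable_F: "0 \<le> t \<Longrightarrow> f \<in> measurable (F t) N \<Longrightarrow> f \<in> measurable M N"
  using measurable_from_subalg subalgebra_F by blast

lemma sets_F_mono: "0 \<le> s \<Longrightarrow> s \<le> t \<Longrightarrow> A \<in> sets (F s) \<Longrightarrow> A \<in> sets (F t)"
  using wiener by (auto simp: wiener_process_def)

lemma measurable_F_mono:
  assumes "0 \<le> s" "s \<le> t" "f \<in> measurable (F s) N"
  shows "f \<in> measurable (F t) N"
proof -
  have "subalgebra (F t) (F s)"
    using assms sets_F_mono[of s t] by (auto simp: subalgebra_def space_F)
  then show ?thesis using measurable_from_subalg assms by blast
qed

lemma measurable_W: "0 \<le> s \<Longrightarrow> s \<le> t \<Longrightarrow> W s \<in> borel_measurable (F t)"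
  using wiener by (intro measurable_F_mono[of s t]) (auto simp: wiener_process_def)

definition incr :: "real \<Rightarrow> real \<Rightarrow> 'w \<Rightarrow> real^'m" where
  "incr s t \<omega> = W t \<omega> - W s \<omega>"

lemma measurable_incr: "0 \<le> s \<Longrightarrow> s \<le> t \<Longrightarrow> t \<le> u \<Longrightarrow> incr s t \<in> borel_measurable (F u)"
  unfolding incr_def[abs_def] by (intro borel_measurable_diff measurable_W) auto

lemma measurable_incr': "0 \<le> s \<Longrightarrow> s \<le> t \<Longrightarrow> incr s t \<in> borel_measurable M"
  using measurable_incr[of s t t] measurable_F[of t] by auto

lemma indep_incr:
  assumes st: "0 \<le> s" "s < t" and Y: "Y \<in> borel_measurable (F s)" and f: "f \<in> borel_measurable borel"
  shows "indep_var borel (Y :: 'w \<Rightarrow> real) borel (\<lambda>\<omega>. f (incr s t \<omega>) :: real)"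
proof (rule indep_varI_prob)
  show "Y \<in> borel_measurable M" using Y st measurable_F by blast
  show "(\<lambda>\<omega>. f (incr s t \<omega>)) \<in> borel_measurable M"
    using measurable_compose[OF measurable_incr' f] st by auto
  fix A B :: "real set" assume AB: "A \<in> sets borel" "B \<in> sets borel"
  have 1: "Y -` A \<inter> space M \<in> sets (F s)"
    using measurable_sets[OF Y AB(1)] space_F st by simp
  have 2: "f -` B \<in> sets borel" using measurable_sets[OF f AB(2)] by simp
  have eq: "(\<lambda>\<omega>. f (incr s t \<omega>)) -` B \<inter> space M = {\<omega>\<in>space M. W t \<omega> - W s \<omega> \<in> f -` B}"
    by (auto simp: incr_def)
  show "prob (Y -` A \<inter> space M \<inter> ((\<lambda>\<omega>. f (incr s t \<omega>)) -` B \<inter> space M))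
      = prob (Y -` A \<inter> space M) * prob ((\<lambda>\<omega>. f (incr s t \<omega>)) -` B \<inter> space M)"
    unfolding eq using wiener st 1 2 unfolding wiener_process_def by blast
qed

text \<open>Takes the place of conditioning on \<open>F s\<close>: a factor known at time
  \<open>s\<close> is multiplied in and the expectation factorises.\<close>

lemma expectation_mult_incr:
  assumes "0 \<le> s" "s < t" "Y \<in> borel_measurable (F s)" "f \<in> borel_measurable borel"
    and "integrable M (Y :: 'w \<Rightarrow> real)" "integrable M (\<lambda>\<omega>. f (incr s t \<omega>) :: real)"
  shows "expectation (\<lambda>\<omega>. Y \<omega> * f (incr s t \<omega>)) = expectation Y * expectation (\<lambda>\<omega>. f (incr s t \<omega>))"
    and "integrable M (\<lambda>\<omega>. Y \<omega> * f (incr s t \<omega>))"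
  using indep_var_lebesgue_integral[OF indep_incr[OF assms(1-4)] assms(5,6)]
    indep_var_integrable[OF indep_incr[OF assms(1-4)] assms(5,6)] by auto

text \<open>The density in \<open>wiener_process\<close> is a product over the coordinates, so
  Tonelli factorises the integral. With all factors but one or two equal to 1 it yields the normal
  law of a component and the independence of two components.\<close>

lemma nn_integral_incr_prod:
  fixes f :: "'m \<Rightarrow> real \<Rightarrow> ennreal"
  assumes st: "0 \<le> s" "s < t" and [measurable]: "\<And>j. f j \<in> borel_measurable borel"
  shows "(\<integral>\<^sup>+\<omega>. (\<Prod>j\<in>UNIV. f j (incr s t \<omega> $ j)) \<partial>M)
     = (\<Prod>j\<in>UNIV. \<integral>\<^sup>+x. ennreal (normal_density 0 (sqrt (t - s)) x) * f j x \<partial>lborel)"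
proof -
  let ?nd = "normal_density 0 (sqrt (t - s))"
  have d: "distr M lborel (incr s t) = density lborel (\<lambda>x. ennreal (\<Prod>j\<in>UNIV. ?nd (x $ j)))"
    using wiener st unfolding wiener_process_def incr_def[abs_def] by blast
  have [measurable]: "(\<lambda>x::real^'m. x $ j) \<in> borel_measurable borel" for j
    using borel_measurable_vec_nth[of "\<lambda>x. x" borel j] by simp
  have m: "incr s t \<in> measurable M lborel"
    using measurable_incr'[OF st(1) less_imp_le[OF st(2)]] by simp
  have "(\<integral>\<^sup>+\<omega>. (\<Prod>j\<in>UNIV. f j (incr s t \<omega> $ j)) \<partial>M) = (\<integral>\<^sup>+x. (\<Prod>j\<in>UNIV. f j (x $ j)) \<partial>distr M lborel (incr s t))"
    by (subst nn_integral_distr[OF m]) auto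
  also have "\<dots> = (\<integral>\<^sup>+x. ennreal (\<Prod>j\<in>UNIV. ?nd (x $ j)) * (\<Prod>j\<in>UNIV. f j (x $ j)) \<partial>lborel)"
    unfolding d by (subst nn_integral_density) auto
  also have "\<dots> = (\<integral>\<^sup>+x. (\<Prod>j\<in>UNIV. ennreal (?nd ((x::real^'m) $ j)) * f j (x $ j)) \<partial>lborel)"
    by (simp add: prod.distrib prod_ennreal)
  also have "\<dots> = (\<Prod>j\<in>UNIV. \<integral>\<^sup>+x. ennreal (?nd x) * f j x \<partial>lborel)"
    by (intro nn_integral_lborel_prod_vec) auto
  finally show ?thesis .
qed

lemma nn_integral_normal_density: "0 < \<sigma> \<Longrightarrow> (\<integral>\<^sup>+x. ennreal (normal_density \<mu> \<sigma> x) \<partial>lborel) = 1"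
  by (subst nn_integral_eq_integral) (auto simp: integrable_normal_density integral_normal_density)

lemma emeasure_incr_component:
  assumes st: "0 \<le> s" "s < t" and [measurable]: "A \<in> sets borel"
  shows "emeasure M {\<omega>\<in>space M. incr s t \<omega> $ i \<in> A}
     = (\<integral>\<^sup>+x. ennreal (normal_density 0 (sqrt (t - s)) x) * indicator A x \<partial>lborel)"
proof -
  let ?f = "\<lambda>j x. if j = i then indicator A x else (1::ennreal)"
  have [measurable]: "incr s t \<in> borel_measurable M" using measurable_incr'[OF st(1) less_imp_le[OF st(2)]] .
  have "emeasure M {\<omega>\<in>space M. incr s t \<omega> $ i \<in> A}
      = (\<integral>\<^sup>+\<omega>. indicator {\<omega>\<in>space M. incr s t \<omega> $ i \<in> A} \<omega> \<partial>M)"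
    by (subst nn_integral_indicator) auto
  also have "\<dots> = (\<integral>\<^sup>+\<omega>. (\<Prod>j\<in>UNIV. ?f j (incr s t \<omega> $ j)) \<partial>M)"
    by (intro nn_integral_cong) (simp add: prod.delta indicator_def)
  also have "\<dots> = (\<Prod>j\<in>UNIV. \<integral>\<^sup>+x. ennreal (normal_density 0 (sqrt (t - s)) x) * ?f j x \<partial>lborel)"
    by (rule nn_integral_incr_prod[OF st]) auto
  also have "\<dots> = (\<Prod>j\<in>UNIV. if j = i then (\<integral>\<^sup>+x. ennreal (normal_density 0 (sqrt (t - s)) x) * indicator A x \<partial>lborel) else 1)"
    using st by (intro prod.cong) (auto simp: nn_integral_normal_density)
  finally show ?thesis by (simp add: prod.delta)
qed

lemma emeasure_incr_components:
  assumes st: "0 \<le> s" "s < t" and [measurable]: "A \<in> sets borel" "B \<in> sets borel" and ij: "i \<noteq> j"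
  shows "emeasure M {\<omega>\<in>space M. incr s t \<omega> $ i \<in> A \<and> incr s t \<omega> $ j \<in> B}
     = emeasure M {\<omega>\<in>space M. incr s t \<omega> $ i \<in> A} * emeasure M {\<omega>\<in>space M. incr s t \<omega> $ j \<in> B}"
proof -
  let ?f = "\<lambda>k x. (if k = i then indicator A x else (1::ennreal)) * (if k = j then indicator B x else 1)"
  let ?N = "\<lambda>A. \<integral>\<^sup>+x. ennreal (normal_density 0 (sqrt (t - s)) x) * indicator A x \<partial>lborel"
  have [measurable]: "incr s t \<in> borel_measurable M" using measurable_incr'[OF st(1) less_imp_le[OF st(2)]] .
  have "emeasure M {\<omega>\<in>space M. incr s t \<omega> $ i \<in> A \<and> incr s t \<omega> $ j \<in> B}
      = (\<integral>\<^sup>+\<omega>. indicator {\<omega>\<in>space M. incr s t \<omega> $ i \<in> A \<and> incr s t \<omega> $ j \<in> B} \<omega> \<partial>M)"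
    by (subst nn_integral_indicator) auto
  also have "\<dots> = (\<integral>\<^sup>+\<omega>. (\<Prod>k\<in>UNIV. ?f k (incr s t \<omega> $ k)) \<partial>M)"
    by (intro nn_integral_cong) (simp add: prod.delta prod.distrib indicator_def)
  also have "\<dots> = (\<Prod>k\<in>UNIV. \<integral>\<^sup>+x. ennreal (normal_density 0 (sqrt (t - s)) x) * ?f k x \<partial>lborel)"
    by (rule nn_integral_incr_prod[OF st]) auto
  also have "\<dots> = (\<Prod>k\<in>UNIV. (if k = i then ?N A else 1) * (if k = j then ?N B else 1))"
    using st ij by (intro prod.cong) (auto simp: nn_integral_normal_density)
  finally show ?thesis using st by (simp add: prod.delta prod.distrib emeasure_incr_component)
qed

lemma distributed_incr:
  assumes st: "0 \<le> s" "s < t"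
  shows "distributed M lborel (\<lambda>\<omega>. incr s t \<omega> $ i) (normal_density 0 (sqrt (t - s)))"
proof -
  have [measurable]: "incr s t \<in> borel_measurable M" using measurable_incr'[OF st(1) less_imp_le[OF st(2)]] .
  have "distr M lborel (\<lambda>\<omega>. incr s t \<omega> $ i) = density lborel (normal_density 0 (sqrt (t - s)))"
  proof (rule measure_eqI)
    fix A assume "A \<in> sets (distr M lborel (\<lambda>\<omega>. incr s t \<omega> $ i))"
    then have [measurable]: "A \<in> sets borel" by simp
    have "(\<lambda>\<omega>. incr s t \<omega> $ i) -` A \<inter> space M = {\<omega>\<in>space M. incr s t \<omega> $ i \<in> A}" by auto
    then show "emeasure (distr M lborel (\<lambda>\<omega>. incr s t \<omega> $ i)) A
        = emeasure (density lborel (normal_density 0 (sqrt (t - s)))) A"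
      using emeasure_incr_component[OF st, of A i] by (simp add: emeasure_distr emeasure_density)
  qed simp
  then show ?thesis unfolding distributed_def by auto
qed

lemma indep_incr_components:
  assumes st: "0 \<le> s" "s < t" and ij: "i \<noteq> j"
  shows "indep_var borel (\<lambda>\<omega>. incr s t \<omega> $ i) borel (\<lambda>\<omega>. incr s t \<omega> $ j)"
proof (rule indep_varI_prob)
  have [measurable]: "incr s t \<in> borel_measurable M" using measurable_incr'[OF st(1) less_imp_le[OF st(2)]] .
  show "(\<lambda>\<omega>. incr s t \<omega> $ i) \<in> borel_measurable M" "(\<lambda>\<omega>. incr s t \<omega> $ j) \<in> borel_measurable M" by auto
  fix A B :: "real set" assume AB[measurable]: "A \<in> sets borel" "B \<in> sets borel"
  have "(\<lambda>\<omega>. incr s t \<omega> $ i) -` A \<inter> space M = {\<omega>\<in>space M. incr s t \<omega> $ i \<in> A}"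
    "(\<lambda>\<omega>. incr s t \<omega> $ j) -` B \<inter> space M = {\<omega>\<in>space M. incr s t \<omega> $ j \<in> B}"
    "{\<omega>\<in>space M. incr s t \<omega> $ i \<in> A} \<inter> {\<omega>\<in>space M. incr s t \<omega> $ j \<in> B}
       = {\<omega>\<in>space M. incr s t \<omega> $ i \<in> A \<and> incr s t \<omega> $ j \<in> B}" by auto
  then show "prob ((\<lambda>\<omega>. incr s t \<omega> $ i) -` A \<inter> space M \<inter> ((\<lambda>\<omega>. incr s t \<omega> $ j) -` B \<inter> space M))
      = prob ((\<lambda>\<omega>. incr s t \<omega> $ i) -` A \<inter> space M) * prob ((\<lambda>\<omega>. incr s t \<omega> $ j) -` B \<inter> space M)"
    using emeasure_incr_components[OF st AB ij]
    by (simp add: emeasure_eq_measure ennreal_mult[symmetric] del: ennreal_mult)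
qed

lemma incr_moments:
  assumes st: "0 \<le> s" "s < t"
  shows "integrable M (\<lambda>\<omega>. (incr s t \<omega> $ i) ^ k)"
    and "expectation (\<lambda>\<omega>. incr s t \<omega> $ i) = 0"
    and "expectation (\<lambda>\<omega>. (incr s t \<omega> $ i)\<^sup>2) = t - s"
    and "expectation (\<lambda>\<omega>. (incr s t \<omega> $ i) ^ 4) = 3 * (t - s)\<^sup>2"
proof -
  let ?\<sigma> = "sqrt (t - s)"
  have \<sigma>: "?\<sigma> > 0" "?\<sigma>\<^sup>2 = t - s" using st by auto
  note D = distributed_incr[OF st, of i]
  have eq: "expectation (\<lambda>\<omega>. (incr s t \<omega> $ i) ^ k) = (\<integral>x. normal_density 0 ?\<sigma> x * (x - 0) ^ k \<partial>lborel)" for k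
    using distributed_integral[OF D, of "\<lambda>x. x ^ k"] by simp
  show "integrable M (\<lambda>\<omega>. (incr s t \<omega> $ i) ^ k)"
    using distributed_integrable[OF D, of "\<lambda>x. x ^ k"] integrable_normal_moment[OF \<sigma>(1), of 0 k] by simp
  show "expectation (\<lambda>\<omega>. incr s t \<omega> $ i) = 0"
    using eq[of 1] integral_normal_moment_odd[OF \<sigma>(1), of 0 0] by simp
  show "expectation (\<lambda>\<omega>. (incr s t \<omega> $ i)\<^sup>2) = t - s"
    using eq[of 2] integral_normal_moment_even[OF \<sigma>(1), of 0 1] \<sigma> by (simp add: fact_numeral)
  show "expectation (\<lambda>\<omega>. (incr s t \<omega> $ i) ^ 4) = 3 * (t - s)\<^sup>2"
    using eq[of 4] integral_normal_moment_even[OF \<sigma>(1), of 0 2] \<sigma>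
    by (simp add: fact_numeral power2_eq_square field_simps)
qed

lemma incr_covariance:
  assumes st: "0 \<le> s" "s < t"
  shows "integrable M (\<lambda>\<omega>. incr s t \<omega> $ i * incr s t \<omega> $ j)"
    and "expectation (\<lambda>\<omega>. incr s t \<omega> $ i * incr s t \<omega> $ j) = (if i = j then t - s else 0)"
proof -
  have i1: "integrable M (\<lambda>\<omega>. incr s t \<omega> $ i)" for i using incr_moments(1)[OF st, of i 1] by simp
  have "integrable M (\<lambda>\<omega>. incr s t \<omega> $ i * incr s t \<omega> $ j) \<and>
     expectation (\<lambda>\<omega>. incr s t \<omega> $ i * incr s t \<omega> $ j) = (if i = j then t - s else 0)"
  proof (cases "i = j")
    case True
    then show ?thesis
      using incr_moments(1)[OF st, of i 2] incr_moments(3)[OF st, of i] by (simp add: power2_eq_square)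
  next
    case False
    note I = indep_incr_components[OF st False]
    show ?thesis
      using indep_var_integrable[OF I i1 i1] indep_var_lebesgue_integral[OF I i1 i1] incr_moments(2)[OF st] False
      by simp
  qed
  then show "integrable M (\<lambda>\<omega>. incr s t \<omega> $ i * incr s t \<omega> $ j)"
    "expectation (\<lambda>\<omega>. incr s t \<omega> $ i * incr s t \<omega> $ j) = (if i = j then t - s else 0)" by auto
qed

end

section \<open>Iterated integrals\<close>

text \<open>The weight \<open>3/2\<close> lies between \<open>1\<close> and \<open>2\<close>: the increments of the dyadic sums decay like \<open>2\<^sup>-\<^sup>k\<close> in
  mean square, so the weighted series still has finite expectation.\<close>
lemma limit_from_weighted_increments:
  fixes S :: "nat \<Rightarrow> real"
  assumes S0: "S 0 = 0" and sm: "summable (\<lambda>k. (3/2)^k * (S (Suc k) - S k)\<^sup>2)"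
  shows "convergent S" and "(lim S)\<^sup>2 \<le> 3 * (\<Sum>k. (3/2)^k * (S (Suc k) - S k)\<^sup>2)"
proof -
  define d where "d k = S (Suc k) - S k" for k
  let ?Q = "\<Sum>k. (3/2)^k * (d k)\<^sup>2"
  have sm': "summable (\<lambda>k. (3/2)^k * (d k)\<^sup>2)" using sm by (simp add: d_def)
  \<comment> \<open>Arithmetic-geometric mean with weight \<open>(3/2)^k\<close>; both terms on the
    right are summable.\<close>
  have "\<bar>d k\<bar> \<le> (2/3)^k + (3/2)^k * (d k)\<^sup>2" for k
  proof -
    have p: "(3/2::real)^k * (2/3)^k = 1" by (simp flip: power_mult_distrib)
    have "0 \<le> (3/2)^k * (\<bar>d k\<bar> - (2/3)^k)\<^sup>2" by simp
    also have "\<dots> = (3/2)^k * (d k)\<^sup>2 - 2 * ((3/2)^k * (2/3)^k) * \<bar>d k\<bar> + ((3/2)^k * (2/3)^k) * (2/3)^k"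
      by (simp add: power2_diff algebra_simps power2_eq_square)
    finally have "2 * \<bar>d k\<bar> \<le> (3/2)^k * (d k)\<^sup>2 + (2/3)^k" unfolding p by simp
    then show ?thesis by simp
  qed
  moreover have "summable (\<lambda>k. (2/3)^k + (3/2)^k * (d k)\<^sup>2)"
    using sm' by (intro summable_add summable_geometric) auto
  ultimately have "summable d" by (intro summable_comparison_test'[of _ 0 d]) auto
  moreover have Sd: "S n = (\<Sum>k<n. d k)" for n
    using S0 by (induction n) (auto simp: d_def)
  ultimately show conv: "convergent S"
    by (metis (full_types) convergent_def ext summable_LIMSEQ)
  have "(S n)\<^sup>2 \<le> 3 * ?Q" for n
  proof -
    \<comment> \<open>Cauchy-Schwarz with reciprocal weights; the constant 3 is the sum of the
      geometric series of ratio 2/3.\<close>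
    let ?a = "\<lambda>k. sqrt ((2/3)^k)" and ?b = "\<lambda>k. d k * sqrt ((3/2)^k)"
    have ab: "?a k * ?b k = d k" for k
    proof -
      have "?a k * ?b k = d k * sqrt ((2/3)^k * (3/2)^k)" by (simp add: real_sqrt_mult)
      also have "(2/3::real)^k * (3/2)^k = 1" by (simp flip: power_mult_distrib)
      finally show ?thesis by simp
    qed
    have "(S n)\<^sup>2 = (\<Sum>k<n. ?a k * ?b k)\<^sup>2" by (simp only: Sd ab)
    also have "\<dots> \<le> (\<Sum>k<n. (?a k)\<^sup>2) * (\<Sum>k<n. (?b k)\<^sup>2)" by (rule Cauchy_Schwarz_ineq_sum)
    also have "\<dots> = (\<Sum>k<n. (2/3)^k) * (\<Sum>k<n. (3/2)^k * (d k)\<^sup>2)"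
      by (simp add: power_mult_distrib mult.commute)
    also have "\<dots> \<le> (\<Sum>k. (2/3)^k) * ?Q"
      using sm' by (intro mult_mono sum_le_suminf sum_nonneg suminf_nonneg) (auto intro: summable_geometric)
    also have "(\<Sum>k. (2/3::real)^k) = 3" by (subst suminf_geometric) auto
    finally show ?thesis .
  qed
  moreover have "(\<lambda>n. (S n)\<^sup>2) \<longlonglongrightarrow> (lim S)\<^sup>2"
    using conv by (intro tendsto_power) (simp add: convergent_LIMSEQ_iff)
  ultimately show "(lim S)\<^sup>2 \<le> 3 * (\<Sum>k. (3/2)^k * (S (Suc k) - S k)\<^sup>2)"
    unfolding d_def[symmetric] by (intro LIMSEQ_le_const2) auto
qed

lemma sum_lessThan_double:
  fixes f :: "nat \<Rightarrow> 'a::comm_monoid_add"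
  shows "(\<Sum>i<2 * n. f i) = (\<Sum>i<n. f (2 * i) + f (Suc (2 * i)))"
  by (induction n) (auto simp: add.assoc)

context wiener
begin

lemma expectation_indicator_square_incr:
  assumes c: "0 \<le> c" "c < m" "m < e" and A: "A \<in> sets (F c)"
  shows "integrable M (\<lambda>\<omega>. indicator A \<omega> * (incr c m \<omega> $ i * incr m e \<omega> $ j)\<^sup>2)"
    and "expectation (\<lambda>\<omega>. indicator A \<omega> * (incr c m \<omega> $ i * incr m e \<omega> $ j)\<^sup>2) = prob A * ((m - c) * (e - m))"
proof -
  have AM: "A \<in> events" using sets_F c A by blast
  have sq: "(\<lambda>x::real^'m. (x $ i)\<^sup>2) \<in> borel_measurable borel" for i
    by (intro borel_measurable_power borel_measurable_vec_nth) simp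
  have 1: "(indicator A :: 'w \<Rightarrow> real) \<in> borel_measurable (F c)" using A by simp
  have 2: "integrable M (indicator A :: 'w \<Rightarrow> real)"
    using AM by (intro integrable_real_indicator) (auto simp: emeasure_eq_measure)
  note E1 = expectation_mult_incr[OF c(1,2) 1 sq 2 incr_moments(1)[OF c(1,2)], of i]
  have 3: "(\<lambda>\<omega>. indicator A \<omega> * (incr c m \<omega> $ i)\<^sup>2) \<in> borel_measurable (F m)"
    using c A by (intro borel_measurable_times borel_measurable_power borel_measurable_vec_nth measurable_incr
        borel_measurable_indicator sets_F_mono[of c m]) auto
  have m: "0 \<le> m" using c by simp
  note E2 = expectation_mult_incr[OF m c(3) 3 sq E1(2) incr_moments(1)[OF m c(3)], of j]
  show "integrable M (\<lambda>\<omega>. indicator A \<omega> * (incr c m \<omega> $ i * incr m e \<omega> $ j)\<^sup>2)"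
    using E2(2) by (simp add: power_mult_distrib mult.assoc)
  show "expectation (\<lambda>\<omega>. indicator A \<omega> * (incr c m \<omega> $ i * incr m e \<omega> $ j)\<^sup>2) = prob A * ((m - c) * (e - m))"
    using E1(1) E2(1) AM c m by (simp add: power_mult_distrib mult.assoc incr_moments(3))
qed

text \<open>The factor over \<open>[m l, e l]\<close> has mean zero and is independent of everything
  up to \<open>m l\<close>, so each product is orthogonal to the sum of the earlier ones and the
  second moments add up. The induction carries measurability in \<open>F (c n)\<close> because the
  mixed term needs it.\<close>

lemma orthogonal_increment_products:
  fixes c m e :: "nat \<Rightarrow> real" and i j :: 'm
  assumes s: "0 \<le> s" and A: "A \<in> sets (F s)"
    and ord: "\<And>l. s \<le> c l" "\<And>l. c l < m l" "\<And>l. m l < e l" "\<And>l. e l \<le> c (Suc l)"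
  defines "p \<equiv> \<lambda>l \<omega>. incr (c l) (m l) \<omega> $ i * incr (m l) (e l) \<omega> $ j"
  shows "(\<lambda>\<omega>. \<Sum>l<n. p l \<omega>) \<in> borel_measurable (F (c n)) \<and>
    integrable M (\<lambda>\<omega>. indicator A \<omega> * (\<Sum>l<n. p l \<omega>)\<^sup>2) \<and>
    expectation (\<lambda>\<omega>. indicator A \<omega> * (\<Sum>l<n. p l \<omega>)\<^sup>2) = prob A * (\<Sum>l<n. (m l - c l) * (e l - m l))"
proof (induction n)
  case 0
  show ?case by simp
next
  case (Suc n)
  define P where "P \<omega> = (\<Sum>l<n. p l \<omega>)" for \<omega>
  have c0: "0 \<le> c n" "0 \<le> m n" "c n \<le> m n" "0 \<le> e n" "m n \<le> e n" using s ord(1)[of n] ord(2)[of n] ord(3)[of n] by linarith+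
  have AM: "A \<in> events" using sets_F s A by blast
  have Ac: "A \<in> sets (F (c n))" "A \<in> sets (F (m n))" 
    using sets_F_mono[OF s _ A, of "c n"] sets_F_mono[OF s _ A, of "m n"] ord(1)[of n] c0 by linarith+
  have Pm: "P \<in> borel_measurable (F (c n))" and Pi: "integrable M (\<lambda>\<omega>. indicator A \<omega> * (P \<omega>)\<^sup>2)"
    and PE: "expectation (\<lambda>\<omega>. indicator A \<omega> * (P \<omega>)\<^sup>2) = prob A * (\<Sum>l<n. (m l - c l) * (e l - m l))"
    using Suc.IH unfolding P_def[abs_def] by auto
  have pm: "p n \<in> borel_measurable (F (c (Suc n)))"
    unfolding p_def using s ord(4)[of n] c0
    by (intro borel_measurable_times borel_measurable_vec_nth measurable_incr) auto
  have meas: "(\<lambda>\<omega>. \<Sum>l<Suc n. p l \<omega>) \<in> borel_measurable (F (c (Suc n)))"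
    using measurable_F_mono[OF c0(1) _ Pm, of "c (Suc n)"] pm ord(4)[of n] ord(3)[of n] ord(2)[of n]
    by (simp add: P_def[abs_def])
  note E3 = expectation_indicator_square_incr[OF c0(1) ord(2,3) Ac(1), of i j]
  define Y where "Y \<omega> = indicator A \<omega> * P \<omega>" for \<omega>
  have Ym: "Y \<in> borel_measurable (F (c n))"
    unfolding Y_def[abs_def] using Ac Pm by (intro borel_measurable_times) auto
  have YM: "Y \<in> borel_measurable M" using Ym measurable_F c0 by blast
  have "(\<lambda>\<omega>. (Y \<omega>)\<^sup>2) = (\<lambda>\<omega>. indicator A \<omega> * (P \<omega>)\<^sup>2)"
    by (auto simp: Y_def indicator_def)
  then have Yi: "integrable M Y" using Pi square_integrable_imp_integrable[OF YM] by simp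
  have v: "(\<lambda>x::real^'m. x $ i) \<in> borel_measurable borel" for i
    by (intro borel_measurable_vec_nth) simp
  have i1: "integrable M (\<lambda>\<omega>. incr s t \<omega> $ i)" if "0 \<le> s" "s < t" for s t i
    using incr_moments(1)[OF that, of i 1] by simp
  note E1 = expectation_mult_incr[OF c0(1) ord(2) Ym v Yi i1[OF c0(1) ord(2)], of i]
  have Zm: "(\<lambda>\<omega>. Y \<omega> * incr (c n) (m n) \<omega> $ i) \<in> borel_measurable (F (m n))"
    using measurable_F_mono[OF c0(1,3) Ym] c0
    by (intro borel_measurable_times borel_measurable_vec_nth measurable_incr) auto
  note E2 = expectation_mult_incr[OF c0(2) ord(3) Zm v E1(2) i1[OF c0(2) ord(3)], of j]
  have E2': "expectation (\<lambda>\<omega>. Y \<omega> * p n \<omega>) = 0" "integrable M (\<lambda>\<omega>. Y \<omega> * p n \<omega>)"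
    using E2 incr_moments(2)[OF c0(2) ord(3)] by (auto simp: p_def mult.assoc)
  have E3': "integrable M (\<lambda>\<omega>. indicator A \<omega> * (p n \<omega>)\<^sup>2)"
    "expectation (\<lambda>\<omega>. indicator A \<omega> * (p n \<omega>)\<^sup>2) = prob A * ((m n - c n) * (e n - m n))"
    using E3 by (auto simp: p_def)
  have eq: "indicator A \<omega> * (\<Sum>l<Suc n. p l \<omega>)\<^sup>2
     = indicator A \<omega> * (P \<omega>)\<^sup>2 + 2 * (Y \<omega> * p n \<omega>) + indicator A \<omega> * (p n \<omega>)\<^sup>2" for \<omega>
    by (simp add: P_def[symmetric] Y_def power2_sum algebra_simps)
  show ?case
    using meas Pi PE E2' E3' unfolding eq by (simp add: distrib_left)
qed

text \<open>All dyadic nodes lie in \<open>[s, t]\<close>, and \<open>lim\<close> is measurable also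
  where the sums diverge and it falls back to a default value.\<close>

lemma measurable_iter_int:
  assumes "0 \<le> s" "s \<le> t"
  shows "(\<lambda>\<omega>. iter_int W \<omega> s t i j) \<in> borel_measurable (F t)"
proof -
  have pt: "0 \<le> s + real l * (t - s) / 2 ^ k \<and> s + real l * (t - s) / 2 ^ k \<le> t" if "l \<le> 2 ^ k" for l k
  proof -
    have "real l / 2 ^ k \<le> 1" using that by simp
    then have "real l / 2 ^ k * (t - s) \<le> 1 * (t - s)" using assms by (intro mult_right_mono) auto
    moreover have "0 \<le> real l / 2 ^ k * (t - s)" using assms by simp
    ultimately show ?thesis using assms by simp
  qed
  have mW: "(\<lambda>\<omega>. W u \<omega> $ i) \<in> borel_measurable (F t)" if "0 \<le> u \<and> u \<le> t" for u i
    using that by (intro borel_measurable_vec_nth measurable_W) auto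
  show ?thesis
    unfolding iter_int_def using assms
    by (intro borel_measurable_lim_metric borel_measurable_sum borel_measurable_times borel_measurable_diff mW pt) auto
qed

text \<open>Halving every cell changes the dyadic sum by the products of the increments over the
  first and the second half of each cell. By their orthogonality the k-th change has mean square
  \<open>prob A * ((t - s)\<^sup>2 / 4 * (1/2)^k)\<close> on \<open>A\<close>. The weights
  \<open>(3/2)^k\<close> make this a geometric series of ratio 3/4 with sum
  \<open>prob A * (t - s)\<^sup>2\<close>, and the factor 3 comes from
  \<open>limit_from_weighted_increments\<close>.\<close>

lemma iter_int_second_moment:
  assumes st: "0 \<le> s" "s < t" and A: "A \<in> sets (F s)"
  shows "integrable M (\<lambda>\<omega>. indicator A \<omega> * (iter_int W \<omega> s t i j)\<^sup>2)"
    and "expectation (\<lambda>\<omega>. indicator A \<omega> * (iter_int W \<omega> s t i j)\<^sup>2) \<le> 3 * (t - s)\<^sup>2 * prob A"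
proof -
  define u where "u k l = s + real l * (t - s) / 2 ^ k" for k l :: nat
  define S where "S \<omega> k = (\<Sum>l<2^k. (W (u k l) \<omega> $ i - W s \<omega> $ i) * (W (u k (Suc l)) \<omega> $ j - W (u k l) \<omega> $ j))" for \<omega> k
  define d where "d k \<omega> = (\<Sum>l<2^k. incr (u k l) (u (Suc k) (Suc (2 * l))) \<omega> $ i
      * incr (u (Suc k) (Suc (2 * l))) (u k (Suc l)) \<omega> $ j)" for k \<omega>
  have AM: "A \<in> events" using sets_F st A by blast
  have I: "iter_int W \<omega> s t i j = lim (S \<omega>)" for \<omega>
    by (simp add: iter_int_def S_def[abs_def] u_def)
  have S0: "S \<omega> 0 = 0" for \<omega> by (simp add: S_def u_def)
  have u2: "u (Suc k) (2 * l) = u k l" for k l by (simp add: u_def)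
  have Sd: "S \<omega> (Suc k) - S \<omega> k = d k \<omega>" for \<omega> k
  proof -
    have "S \<omega> (Suc k) = (\<Sum>l<2^k.
        (W (u k l) \<omega> $ i - W s \<omega> $ i) * (W (u (Suc k) (Suc (2 * l))) \<omega> $ j - W (u k l) \<omega> $ j)
      + (W (u (Suc k) (Suc (2 * l))) \<omega> $ i - W s \<omega> $ i) * (W (u k (Suc l)) \<omega> $ j - W (u (Suc k) (Suc (2 * l))) \<omega> $ j))"
      unfolding S_def using u2[of k] u2[of k "Suc _"] by (simp add: sum_lessThan_double)
    then show ?thesis
      unfolding S_def d_def incr_def by (simp add: sum_subtractf[symmetric] algebra_simps)
  qed
  have w: "0 < (t - s) / 2 ^ k" for k using st by simp
  have u_le: "s \<le> u k l" for k l using st by (simp add: u_def)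
  have u_mid: "u (Suc k) (Suc (2 * l)) - u k l = (t - s) / 2 ^ Suc k"
      "u k (Suc l) - u (Suc k) (Suc (2 * l)) = (t - s) / 2 ^ Suc k" for k l
    by (auto simp: u_def field_simps)
  have u_lt: "u k l < u (Suc k) (Suc (2 * l))" "u (Suc k) (Suc (2 * l)) < u k (Suc l)" for k l
    using u_mid[of k l] w[of "Suc k"] by linarith+
  have D: "integrable M (\<lambda>\<omega>. indicator A \<omega> * (d k \<omega>)\<^sup>2)"
      "expectation (\<lambda>\<omega>. indicator A \<omega> * (d k \<omega>)\<^sup>2) = prob A * ((t - s)\<^sup>2 / 4 * (1/2)^k)" for k
  proof -
    have "(\<Sum>l<(2::nat)^k. (u (Suc k) (Suc (2 * l)) - u k l) * (u k (Suc l) - u (Suc k) (Suc (2 * l))))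
        = (t - s)\<^sup>2 / 4 * (1/2)^k"
      unfolding u_mid by (simp add: power2_eq_square field_simps flip: power_mult_distrib)
    then show "integrable M (\<lambda>\<omega>. indicator A \<omega> * (d k \<omega>)\<^sup>2)"
      "expectation (\<lambda>\<omega>. indicator A \<omega> * (d k \<omega>)\<^sup>2) = prob A * ((t - s)\<^sup>2 / 4 * (1/2)^k)"
      using orthogonal_increment_products[OF st(1) A, where c = "u k" and m = "\<lambda>l. u (Suc k) (Suc (2 * l))"
          and e = "\<lambda>l. u k (Suc l)" and i = i and j = j and n = "2^k"] u_le u_lt
      unfolding d_def by auto
  qed
  define Q where "Q \<omega> = (\<Sum>k. ennreal ((3/2)^k * (d k \<omega>)\<^sup>2))" for \<omega>
  \<comment> \<open>Where the weighted series diverges the bound is infinite, so it holds at every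
    point and no exceptional null set has to be carried along.\<close>
  have bd: "ennreal ((iter_int W \<omega> s t i j)\<^sup>2) \<le> 3 * Q \<omega>" for \<omega>
  proof (cases "Q \<omega> = \<infinity>")
    case True
    then show ?thesis by (simp add: ennreal_mult_top)
  next
    case False
    then have sm: "summable (\<lambda>k. (3/2)^k * (d k \<omega>)\<^sup>2)"
      unfolding Q_def by (intro summable_suminf_not_top) auto
    then have "Q \<omega> = ennreal (\<Sum>k. (3/2)^k * (d k \<omega>)\<^sup>2)"
      unfolding Q_def by (intro suminf_ennreal2) auto
    moreover have "ennreal ((iter_int W \<omega> s t i j)\<^sup>2) \<le> ennreal (3 * (\<Sum>k. (3/2)^k * (d k \<omega>)\<^sup>2))"
      using limit_from_weighted_increments(2)[of "S \<omega>"] S0 sm unfolding Sd I by (intro ennreal_leI) auto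
    moreover have "ennreal (3 * (\<Sum>k. (3/2)^k * (d k \<omega>)\<^sup>2)) = 3 * ennreal (\<Sum>k. (3/2)^k * (d k \<omega>)\<^sup>2)"
      using sm by (subst ennreal_mult) (auto intro!: suminf_nonneg)
    ultimately show ?thesis by simp
  qed
  have dM: "(\<lambda>\<omega>. indicator A \<omega> * (d k \<omega>)\<^sup>2) \<in> borel_measurable M" for k
    using D(1) by auto
  have "(\<integral>\<^sup>+\<omega>. ennreal (indicator A \<omega> * (iter_int W \<omega> s t i j)\<^sup>2) \<partial>M)
      \<le> (\<integral>\<^sup>+\<omega>. 3 * (\<Sum>k. ennreal ((3/2)^k * (indicator A \<omega> * (d k \<omega>)\<^sup>2))) \<partial>M)"
    using bd by (intro nn_integral_mono) (auto simp: indicator_def Q_def)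
  also have "\<dots> = 3 * (\<Sum>k. \<integral>\<^sup>+\<omega>. ennreal ((3/2)^k * (indicator A \<omega> * (d k \<omega>)\<^sup>2)) \<partial>M)"
    using dM by (subst nn_integral_cmult) (auto intro!: nn_integral_suminf arg_cong[where f = "\<lambda>x. 3 * x"])
  also have "(\<lambda>k. \<integral>\<^sup>+\<omega>. ennreal ((3/2)^k * (indicator A \<omega> * (d k \<omega>)\<^sup>2)) \<partial>M)
      = (\<lambda>k. ennreal (prob A * (t - s)\<^sup>2 / 4 * (3/4)^k))"
  proof
    fix k
    have "(\<integral>\<^sup>+\<omega>. ennreal ((3/2)^k * (indicator A \<omega> * (d k \<omega>)\<^sup>2)) \<partial>M)
        = ennreal (expectation (\<lambda>\<omega>. (3/2)^k * (indicator A \<omega> * (d k \<omega>)\<^sup>2)))"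
      using D(1) by (intro nn_integral_eq_integral) auto
    also have "expectation (\<lambda>\<omega>. (3/2)^k * (indicator A \<omega> * (d k \<omega>)\<^sup>2)) = prob A * (t - s)\<^sup>2 / 4 * ((3/2)^k * (1/2)^k)"
      using D by simp
    also have "(3/2::real)^k * (1/2)^k = (3/4)^k" by (simp flip: power_mult_distrib)
    finally show "(\<integral>\<^sup>+\<omega>. ennreal ((3/2)^k * (indicator A \<omega> * (d k \<omega>)\<^sup>2)) \<partial>M)
        = ennreal (prob A * (t - s)\<^sup>2 / 4 * (3/4)^k)" .
  qed
  also have "(\<Sum>k. ennreal (prob A * (t - s)\<^sup>2 / 4 * (3/4)^k)) = ennreal (\<Sum>k. prob A * (t - s)\<^sup>2 / 4 * (3/4)^k)"
    by (intro suminf_ennreal2 summable_mult summable_geometric) auto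
  also have "(\<Sum>k. prob A * (t - s)\<^sup>2 / 4 * (3/4)^k) = prob A * (t - s)\<^sup>2"
    by (subst suminf_mult) (auto simp: suminf_geometric intro: summable_geometric)
  also have "3 * ennreal (prob A * (t - s)\<^sup>2) = ennreal (3 * (t - s)\<^sup>2 * prob A)"
    by (simp add: ennreal_mult ac_simps)
  finally have fin: "(\<integral>\<^sup>+\<omega>. ennreal (indicator A \<omega> * (iter_int W \<omega> s t i j)\<^sup>2) \<partial>M) \<le> ennreal (3 * (t - s)\<^sup>2 * prob A)" .
  have mI: "(\<lambda>\<omega>. iter_int W \<omega> s t i j) \<in> borel_measurable M"
    using measurable_F[OF _ measurable_iter_int[of s t i j]] st by auto
  have m: "(\<lambda>\<omega>. indicator A \<omega> * (iter_int W \<omega> s t i j)\<^sup>2) \<in> borel_measurable M"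
    using mI AM by (intro borel_measurable_times) auto
  show int: "integrable M (\<lambda>\<omega>. indicator A \<omega> * (iter_int W \<omega> s t i j)\<^sup>2)"
  proof (rule integrableI_nonneg[OF m])
    show "(\<integral>\<^sup>+\<omega>. ennreal (indicator A \<omega> * (iter_int W \<omega> s t i j)\<^sup>2) \<partial>M) < \<infinity>"
      using fin by (rule order.strict_trans1) simp
  qed auto
  have "ennreal (expectation (\<lambda>\<omega>. indicator A \<omega> * (iter_int W \<omega> s t i j)\<^sup>2)) \<le> ennreal (3 * (t - s)\<^sup>2 * prob A)"
    using fin by (subst (asm) nn_integral_eq_integral[OF int]) auto
  then show "expectation (\<lambda>\<omega>. indicator A \<omega> * (iter_int W \<omega> s t i j)\<^sup>2) \<le> 3 * (t - s)\<^sup>2 * prob A"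
    by (subst (asm) ennreal_le_iff) auto
qed

end

section \<open>Conditional expectation of one step\<close>

lemma inner_power2_vec:
  fixes c w :: "real^'m::finite"
  shows "(c \<bullet> w)\<^sup>2 = (\<Sum>i\<in>UNIV. \<Sum>j\<in>UNIV. (c $ i * c $ j) * (w $ i * w $ j))"
  by (simp add: inner_vec_def power2_eq_square sum_product mult_ac)

lemma norm_power2_vec: "norm (w::real^'m::finite) ^ 2 = (\<Sum>j\<in>UNIV. (w $ j)\<^sup>2)"
  unfolding power2_norm_eq_inner by (simp add: inner_vec_def power2_eq_square)

lemma norm_power4_vec_le:
  fixes w :: "real^'m::finite"
  shows "norm w ^ 4 \<le> real CARD('m) * (\<Sum>j\<in>UNIV. (w $ j) ^ 4)"
proof -
  have "norm w ^ 4 = (norm w ^ 2)\<^sup>2" by simp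
  also have "\<dots> = (\<Sum>j\<in>UNIV. 1 * (w $ j)\<^sup>2)\<^sup>2" by (simp add: norm_power2_vec)
  also have "\<dots> \<le> (\<Sum>j\<in>(UNIV::'m set). 1\<^sup>2) * (\<Sum>j\<in>UNIV. ((w $ j)\<^sup>2)\<^sup>2)" by (rule Cauchy_Schwarz_ineq_sum)
  finally show ?thesis by simp
qed

context wiener
begin

text \<open>\<open>H\<close> majorises the change of \<open>V\<close> in one step. On an event of
  \<open>F s\<close> the linear term averages to 0; in the square the mixed products of components
  vanish and the diagonal leaves \<Delta> times the squared norm of \<open>c\<close>, where the
  lower bound \<open>c0\<close> enters. The other terms use the moments \<Delta> and 3 \<Delta>^2 of
  the components and \<open>iter_int_second_moment\<close>.\<close>

lemma expected_quadratic_form: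
  fixes c :: "'w \<Rightarrow> real^'m" and \<alpha> :: "'w \<Rightarrow> real"
  assumes s: "0 \<le> s" and \<Delta>: "0 < \<Delta>" and A: "A \<in> sets (F s)"
    and cm: "c \<in> borel_measurable (F s)" and \<alpha>m: "\<alpha> \<in> borel_measurable (F s)"
    and cB: "\<And>\<omega>. \<omega> \<in> A \<Longrightarrow> norm (c \<omega>) \<le> Bc" and \<alpha>B: "\<And>\<omega>. \<omega> \<in> A \<Longrightarrow> \<bar>\<alpha> \<omega>\<bar> \<le> B\<alpha>"
    and c0: "\<And>\<omega>. \<omega> \<in> A \<Longrightarrow> c0 \<le> norm (c \<omega>) ^ 2"
    and q: "q1 \<ge> 0" "q2 \<ge> 0" "q3 \<ge> 0" "q4 \<ge> 0"
  defines "w \<equiv> incr s (s + \<Delta>)"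
  defines "H \<equiv> \<lambda>\<omega>. \<alpha> \<omega> * (c \<omega> \<bullet> w \<omega>) - (c \<omega> \<bullet> w \<omega>)\<^sup>2 / 2 + q1 * norm (w \<omega>) ^ 2 + q2 * (\<Sum>j\<in>UNIV. (w \<omega> $ j) ^ 4)
      + q3 * (\<Sum>i\<in>UNIV. \<Sum>j\<in>UNIV. (iter_int W \<omega> s (s + \<Delta>) i j)\<^sup>2) + q4"
  shows "integrable M (\<lambda>\<omega>. indicator A \<omega> * H \<omega>)"
    and "expectation (\<lambda>\<omega>. indicator A \<omega> * H \<omega>) \<le> prob A * (- c0 * \<Delta> / 2 + q1 * (real CARD('m) * \<Delta>)
      + q2 * (3 * real CARD('m) * \<Delta>\<^sup>2) + q3 * (3 * (real CARD('m))\<^sup>2 * \<Delta>\<^sup>2) + q4)"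
proof -
  have st: "s < s + \<Delta>" using \<Delta> by simp
  have AM: "A \<in> events" using sets_F s A by blast
  let ?A = "indicator A :: 'w \<Rightarrow> real"
  have Am: "?A \<in> borel_measurable (F s)" using A by simp
  have Ai: "integrable M ?A"
    using AM by (intro integrable_real_indicator) (auto simp: emeasure_eq_measure)
  have AE: "expectation ?A = prob A" using AM by simp
  have cjm: "(\<lambda>\<omega>. c \<omega> $ j) \<in> borel_measurable (F s)" for j using cm by (rule borel_measurable_vec_nth)
  have cjB: "\<bar>c \<omega> $ j\<bar> \<le> Bc" if "\<omega> \<in> A" for \<omega> j
    using component_le_norm_cart[of "c \<omega>" j] cB[OF that] by linarith
  have bdd_int: "integrable M (\<lambda>\<omega>. ?A \<omega> * f \<omega>)"
    if "f \<in> borel_measurable (F s)" "\<And>\<omega>. \<omega> \<in> A \<Longrightarrow> \<bar>f \<omega>\<bar> \<le> B" for f :: "'w \<Rightarrow> real" and B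
  proof (rule integrable_const_bound[where B = "\<bar>B\<bar>"])
    show "AE \<omega> in M. norm (?A \<omega> * f \<omega>) \<le> \<bar>B\<bar>"
      using that(2) by (auto simp: indicator_def intro: order_trans[OF _ abs_ge_self])
    show "(\<lambda>\<omega>. ?A \<omega> * f \<omega>) \<in> borel_measurable M"
      using that(1) measurable_F[OF s] AM by (intro borel_measurable_times) auto
  qed
  have mj: "(\<lambda>x::real^'m. x $ i) \<in> borel_measurable borel" for i
    by (intro borel_measurable_vec_nth) simp
  have w1: "integrable M (\<lambda>\<omega>. w \<omega> $ j)" "expectation (\<lambda>\<omega>. w \<omega> $ j) = 0" for j
    using incr_moments(1)[OF s st, of j 1] incr_moments(2)[OF s st] by (auto simp: w_def)
  have T1: "integrable M (\<lambda>\<omega>. (?A \<omega> * (\<alpha> \<omega> * c \<omega> $ j)) * w \<omega> $ j)"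
       "expectation (\<lambda>\<omega>. (?A \<omega> * (\<alpha> \<omega> * c \<omega> $ j)) * w \<omega> $ j) = 0" for j
  proof -
    have m: "(\<lambda>\<omega>. \<alpha> \<omega> * c \<omega> $ j) \<in> borel_measurable (F s)" using \<alpha>m cjm by (rule borel_measurable_times)
    have "\<bar>\<alpha> \<omega> * c \<omega> $ j\<bar> \<le> B\<alpha> * Bc" if "\<omega> \<in> A" for \<omega>
      using \<alpha>B[OF that] cjB[OF that, of j] unfolding abs_mult by (intro mult_mono) auto
    note i = bdd_int[OF m this]
    note E = expectation_mult_incr[OF s st borel_measurable_times[OF Am m] mj[of j] i] 
    show "integrable M (\<lambda>\<omega>. (?A \<omega> * (\<alpha> \<omega> * c \<omega> $ j)) * w \<omega> $ j)"
       "expectation (\<lambda>\<omega>. (?A \<omega> * (\<alpha> \<omega> * c \<omega> $ j)) * w \<omega> $ j) = 0"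
      using E w1[of j] by (auto simp: w_def)
  qed
  have ccB: "\<bar>c \<omega> $ i * c \<omega> $ j\<bar> \<le> Bc * Bc" if "\<omega> \<in> A" for i j \<omega>
    using cjB[OF that] unfolding abs_mult by (intro mult_mono) (auto intro: order_trans[OF abs_ge_zero])
  have cci: "integrable M (\<lambda>\<omega>. ?A \<omega> * (c \<omega> $ i * c \<omega> $ j))" for i j
    by (intro bdd_int[OF _ ccB] borel_measurable_times cjm)
  have T2: "integrable M (\<lambda>\<omega>. (?A \<omega> * (c \<omega> $ i * c \<omega> $ j)) * (w \<omega> $ i * w \<omega> $ j))"
       "expectation (\<lambda>\<omega>. (?A \<omega> * (c \<omega> $ i * c \<omega> $ j)) * (w \<omega> $ i * w \<omega> $ j))
         = (if i = j then \<Delta> * expectation (\<lambda>\<omega>. ?A \<omega> * (c \<omega> $ i * c \<omega> $ j)) else 0)" for i j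
  proof -
    have "(\<lambda>x::real^'m. x $ i * x $ j) \<in> borel_measurable borel" using mj by (intro borel_measurable_times)
    note E = expectation_mult_incr[OF s st borel_measurable_times[OF Am borel_measurable_times[OF cjm cjm]] this cci
        incr_covariance(1)[OF s st]]
    show "integrable M (\<lambda>\<omega>. (?A \<omega> * (c \<omega> $ i * c \<omega> $ j)) * (w \<omega> $ i * w \<omega> $ j))"
       "expectation (\<lambda>\<omega>. (?A \<omega> * (c \<omega> $ i * c \<omega> $ j)) * (w \<omega> $ i * w \<omega> $ j))
         = (if i = j then \<Delta> * expectation (\<lambda>\<omega>. ?A \<omega> * (c \<omega> $ i * c \<omega> $ j)) else 0)"
      using E incr_covariance(2)[OF s st, of i j] by (auto simp: w_def)
  qed
  have T3: "integrable M (\<lambda>\<omega>. ?A \<omega> * (w \<omega> $ j) ^ k)"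
       "expectation (\<lambda>\<omega>. ?A \<omega> * (w \<omega> $ j) ^ k) = prob A * expectation (\<lambda>\<omega>. (w \<omega> $ j) ^ k)" for j k
  proof -
    have "(\<lambda>x::real^'m. (x $ j) ^ k) \<in> borel_measurable borel" using mj by (intro borel_measurable_power)
    note E = expectation_mult_incr[OF s st Am this Ai incr_moments(1)[OF s st]]
    show "integrable M (\<lambda>\<omega>. ?A \<omega> * (w \<omega> $ j) ^ k)"
       "expectation (\<lambda>\<omega>. ?A \<omega> * (w \<omega> $ j) ^ k) = prob A * expectation (\<lambda>\<omega>. (w \<omega> $ j) ^ k)"
      using E AE by (auto simp: w_def)
  qed
  have T3': "expectation (\<lambda>\<omega>. ?A \<omega> * (w \<omega> $ j)\<^sup>2) = prob A * \<Delta>"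
      "expectation (\<lambda>\<omega>. ?A \<omega> * (w \<omega> $ j) ^ 4) = prob A * (3 * \<Delta>\<^sup>2)" for j
    using T3(2) incr_moments(3,4)[OF s st] by (auto simp: w_def)
  note T4 = iter_int_second_moment[OF s st A]
  \<comment> \<open>The indicator is moved inside the sums, so that every summand is a bounded
    factor from \<open>F s\<close> times a function of the increment, or an iterated integral
    covered by \<open>T4\<close>.\<close>
  define H1 where "H1 \<omega> = (\<Sum>j\<in>UNIV. (?A \<omega> * (\<alpha> \<omega> * c \<omega> $ j)) * w \<omega> $ j)" for \<omega>
  define H2 where "H2 \<omega> = (\<Sum>i\<in>UNIV. \<Sum>j\<in>UNIV. (?A \<omega> * (c \<omega> $ i * c \<omega> $ j)) * (w \<omega> $ i * w \<omega> $ j))" for \<omega>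
  define H3 where "H3 \<omega> = (\<Sum>j\<in>UNIV. ?A \<omega> * (w \<omega> $ j)\<^sup>2)" for \<omega>
  define H4 where "H4 \<omega> = (\<Sum>j\<in>UNIV. ?A \<omega> * (w \<omega> $ j) ^ 4)" for \<omega>
  define H5 where "H5 \<omega> = (\<Sum>i\<in>UNIV. \<Sum>j\<in>UNIV. ?A \<omega> * (iter_int W \<omega> s (s + \<Delta>) i j)\<^sup>2)" for \<omega>
  have Heq: "?A \<omega> * H \<omega> = H1 \<omega> - H2 \<omega> / 2 + q1 * H3 \<omega> + q2 * H4 \<omega> + q3 * H5 \<omega> + q4 * ?A \<omega>" for \<omega>
  proof -
    have 1: "H1 \<omega> = ?A \<omega> * (\<alpha> \<omega> * (c \<omega> \<bullet> w \<omega>))"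
      by (simp add: H1_def inner_vec_def sum_distrib_left mult_ac)
    have 2: "H2 \<omega> = ?A \<omega> * (c \<omega> \<bullet> w \<omega>)\<^sup>2"
      unfolding H2_def inner_power2_vec by (simp add: sum_distrib_left mult_ac)
    have 3: "H3 \<omega> = ?A \<omega> * norm (w \<omega>) ^ 2" "H4 \<omega> = ?A \<omega> * (\<Sum>j\<in>UNIV. (w \<omega> $ j) ^ 4)"
      "H5 \<omega> = ?A \<omega> * (\<Sum>i\<in>UNIV. \<Sum>j\<in>UNIV. (iter_int W \<omega> s (s + \<Delta>) i j)\<^sup>2)"
      unfolding norm_power2_vec by (simp_all add: H3_def H4_def H5_def sum_distrib_left)
    show ?thesis unfolding 1 2 3 H_def by (simp add: algebra_simps)
  qed
  have int: "integrable M H1" "integrable M H2" "integrable M H3" "integrable M H4" "integrable M H5"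
    unfolding H1_def[abs_def] H2_def[abs_def] H3_def[abs_def] H4_def[abs_def] H5_def[abs_def]
    by (intro Bochner_Integration.integrable_sum T1(1) T2(1) T3(1) T4(1))+
  show "integrable M (\<lambda>\<omega>. indicator A \<omega> * H \<omega>)"
    unfolding Heq using int Ai by (intro Bochner_Integration.integrable_add Bochner_Integration.integrable_diff) auto
  have E1: "expectation H1 = 0"
    unfolding H1_def[abs_def] using T1(2) by (subst Bochner_Integration.integral_sum[OF T1(1)]) simp
  have E2: "expectation H2 \<ge> \<Delta> * (c0 * prob A)"
  proof -
    have "expectation H2 = (\<Sum>i\<in>UNIV. \<Sum>j\<in>UNIV. expectation (\<lambda>\<omega>. (?A \<omega> * (c \<omega> $ i * c \<omega> $ j)) * (w \<omega> $ i * w \<omega> $ j)))"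
      unfolding H2_def[abs_def]
      by (subst Bochner_Integration.integral_sum, intro Bochner_Integration.integrable_sum T2(1))
        (subst Bochner_Integration.integral_sum[OF T2(1)], rule refl)
    also have "\<dots> = (\<Sum>i\<in>UNIV. \<Delta> * expectation (\<lambda>\<omega>. ?A \<omega> * (c \<omega> $ i * c \<omega> $ i)))"
      unfolding T2(2) by (simp add: sum.delta)
    also have "\<dots> = \<Delta> * expectation (\<lambda>\<omega>. \<Sum>i\<in>UNIV. ?A \<omega> * (c \<omega> $ i * c \<omega> $ i))"
      by (subst Bochner_Integration.integral_sum[OF cci]) (simp add: sum_distrib_left)
    also have "\<dots> \<ge> \<Delta> * expectation (\<lambda>\<omega>. c0 * ?A \<omega>)"
    proof (intro mult_left_mono integral_mono)
      show "integrable M (\<lambda>\<omega>. c0 * ?A \<omega>)" using Ai by simp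
      show "integrable M (\<lambda>\<omega>. \<Sum>i\<in>UNIV. ?A \<omega> * (c \<omega> $ i * c \<omega> $ i))"
        using cci by (intro Bochner_Integration.integrable_sum)
      show "c0 * ?A \<omega> \<le> (\<Sum>i\<in>UNIV. ?A \<omega> * (c \<omega> $ i * c \<omega> $ i))" for \<omega>
        using c0[of \<omega>] unfolding norm_power2_vec by (auto simp: indicator_def power2_eq_square)
    qed (use \<Delta> in auto)
    finally show ?thesis using AE by simp
  qed
  have E3: "expectation H3 = real CARD('m) * (prob A * \<Delta>)"
    unfolding H3_def[abs_def] using T3' by (subst Bochner_Integration.integral_sum[OF T3(1)]) simp
  have E4: "expectation H4 = real CARD('m) * (prob A * (3 * \<Delta>\<^sup>2))"
    unfolding H4_def[abs_def] using T3' by (subst Bochner_Integration.integral_sum[OF T3(1)]) simp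
  have E5: "expectation H5 \<le> (real CARD('m))\<^sup>2 * (3 * \<Delta>\<^sup>2 * prob A)"
  proof -
    have "expectation H5 = (\<Sum>i\<in>UNIV. \<Sum>j\<in>UNIV. expectation (\<lambda>\<omega>. ?A \<omega> * (iter_int W \<omega> s (s + \<Delta>) i j)\<^sup>2))"
      unfolding H5_def[abs_def]
      by (subst Bochner_Integration.integral_sum, intro Bochner_Integration.integrable_sum T4(1))
        (subst Bochner_Integration.integral_sum[OF T4(1)], rule refl)
    also have "\<dots> \<le> (\<Sum>i\<in>(UNIV::'m set). \<Sum>j\<in>(UNIV::'m set). 3 * \<Delta>\<^sup>2 * prob A)"
      using T4(2) by (intro sum_mono) simp
    finally show ?thesis by (simp add: power2_eq_square mult_ac)
  qed
  have "expectation (\<lambda>\<omega>. ?A \<omega> * H \<omega>) = expectation H1 - expectation H2 / 2 + q1 * expectation H3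
      + q2 * expectation H4 + q3 * expectation H5 + q4 * prob A"
    unfolding Heq using int Ai AE by simp
  also have "\<dots> \<le> 0 - \<Delta> * (c0 * prob A) / 2 + q1 * (real CARD('m) * (prob A * \<Delta>))
      + q2 * (real CARD('m) * (prob A * (3 * \<Delta>\<^sup>2))) + q3 * ((real CARD('m))\<^sup>2 * (3 * \<Delta>\<^sup>2 * prob A)) + q4 * prob A"
    using E1 E2 E3 E4 E5 q by (intro add_mono diff_mono mult_left_mono divide_right_mono) auto
  also have "\<dots> = prob A * (- c0 * \<Delta> / 2 + q1 * (real CARD('m) * \<Delta>)
      + q2 * (3 * real CARD('m) * \<Delta>\<^sup>2) + q3 * (3 * (real CARD('m))\<^sup>2 * \<Delta>\<^sup>2) + q4)"
    by (simp add: algebra_simps)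
  finally show "expectation (\<lambda>\<omega>. indicator A \<omega> * H \<omega>) \<le> prob A * (- c0 * \<Delta> / 2 + q1 * (real CARD('m) * \<Delta>)
      + q2 * (3 * real CARD('m) * \<Delta>\<^sup>2) + q3 * (3 * (real CARD('m))\<^sup>2 * \<Delta>\<^sup>2) + q4)" .
qed

end

lemma sum_sum_power2_le:
  fixes f :: "'m::finite \<Rightarrow> 'm \<Rightarrow> real"
  shows "(\<Sum>i\<in>UNIV. \<Sum>j\<in>UNIV. f i j)\<^sup>2 \<le> (real CARD('m))\<^sup>2 * (\<Sum>i\<in>UNIV. \<Sum>j\<in>UNIV. (f i j)\<^sup>2)"
proof -
  have "(\<Sum>p\<in>UNIV. 1 * case_prod f p)\<^sup>2 \<le> (\<Sum>p\<in>(UNIV::('m \<times> 'm) set). 1\<^sup>2) * (\<Sum>p\<in>UNIV. (case_prod f p)\<^sup>2)"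
    by (rule Cauchy_Schwarz_ineq_sum)
  then show ?thesis
    by (simp add: sum.cartesian_product UNIV_Times_UNIV[symmetric] card_cartesian_product power2_eq_square
        split_def del: UNIV_Times_UNIV)
qed

text \<open>The cap bounds \<open>V\<close> on the whole line, so nothing is required of the law of
  \<open>R\<close>. \<open>V\<close> may jump at -\<delta>, hence measurability comes from the case
  distinction and not from continuity.\<close>

lemma (in prob_space) integrable_indicator_lyap:
  assumes A: "A \<in> events" and R: "R \<in> borel_measurable M" and B: "1 \<le> B" and \<delta>: "0 \<le> \<delta>"
  shows "integrable M (\<lambda>\<omega>. indicator A \<omega> * lyap B \<delta> (R \<omega>))"
proof (rule integrable_const_bound[where B = "(B\<^sup>2 - 1) * \<delta>\<^sup>2 + (2 * B + 1) * \<delta>\<^sup>2"])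
  have "0 \<le> (B\<^sup>2 - 1) * \<delta>\<^sup>2" "0 \<le> (2 * B + 1) * \<delta>\<^sup>2" using B by auto
  then have "\<bar>lyap B \<delta> r\<bar> \<le> (B\<^sup>2 - 1) * \<delta>\<^sup>2 + (2 * B + 1) * \<delta>\<^sup>2"
    "0 \<le> (B\<^sup>2 - 1) * \<delta>\<^sup>2 + (2 * B + 1) * \<delta>\<^sup>2" for r
    using lyap_le[OF B \<delta>, of r] lyap_ge[OF B \<delta>, of r] by linarith+
  then show "AE \<omega> in M. norm (indicator A \<omega> * lyap B \<delta> (R \<omega>)) \<le> (B\<^sup>2 - 1) * \<delta>\<^sup>2 + (2 * B + 1) * \<delta>\<^sup>2"
    by (intro AE_I2) (simp add: indicator_def)
  have "lyap B \<delta> \<in> borel_measurable borel" unfolding lyap_def[abs_def] by measurable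
  from measurable_compose[OF R this]
  show "(\<lambda>\<omega>. indicator A \<omega> * lyap B \<delta> (R \<omega>)) \<in> borel_measurable M"
    using A by (intro borel_measurable_times) auto
qed

section \<open>The Milstein step split into diffusion part and remainder\<close>

locale milstein = wiener M F W
  for M :: "'w measure" and F and W :: "real \<Rightarrow> 'w \<Rightarrow> real^'m::finite" +
  fixes a :: "real^'d::finite \<Rightarrow> real^'d" and b :: "real^'d \<Rightarrow> real^'m^'d" and K :: real
  assumes a_cont: "\<And>i. continuous_on UNIV (\<lambda>x. a x $ i)"
    and b_cont: "\<And>i j. continuous_on UNIV (\<lambda>x. b x $ i $ j)"
    and db_cont: "\<And>i j k. continuous_on UNIV (pderiv_i k (\<lambda>x. b x $ i $ j))"
    and a_bound: "\<And>i x. \<bar>a x $ i\<bar> \<le> K"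
    and b_bound: "\<And>i j x. \<bar>b x $ i $ j\<bar> \<le> K"
    and db_bound: "\<And>i j k x. \<bar>pderiv_i k (\<lambda>x. b x $ i $ j) x\<bar> \<le> K"
begin

lemma K_nonneg: "0 \<le> K"
  using a_bound order_trans abs_ge_zero by blast

text \<open>The Milstein coefficient: the operator L^j1 applied to the component b_(i,j2).\<close>

definition corr :: "'d \<Rightarrow> 'm \<Rightarrow> 'm \<Rightarrow> real^'d \<Rightarrow> real" where
  "corr i j1 j2 x = (\<Sum>k\<in>UNIV. b x $ k $ j1 * pderiv_i k (\<lambda>y. b y $ i $ j2) x)"

text \<open>Collects what has mean square of order \<Delta>^2, in contrast to the diffusion part,
  whose mean square has order \<Delta>.\<close>

definition remainder :: "real^'d \<Rightarrow> real \<Rightarrow> ('m \<Rightarrow> 'm \<Rightarrow> real) \<Rightarrow> real^'d" where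
  "remainder x \<Delta> I = (\<chi> i. a x $ i * \<Delta> + (\<Sum>j1\<in>UNIV. \<Sum>j2\<in>UNIV. corr i j1 j2 x * I j1 j2))"

lemma milstein_step_eq: "milstein_step a b x \<Delta> w I = x + (b x *v w + remainder x \<Delta> I)"
  by (simp add: milstein_step_def remainder_def corr_def matrix_vector_mult_def vec_eq_iff)

lemma corr_bound: "\<bar>corr i j1 j2 x\<bar> \<le> real CARD('d) * K\<^sup>2"
proof -
  have "\<bar>corr i j1 j2 x\<bar> \<le> (\<Sum>k\<in>(UNIV::'d set). K * K)"
    unfolding corr_def using b_bound db_bound K_nonneg
    by (intro order_trans[OF sum_abs] sum_mono) (auto simp: abs_mult intro!: mult_mono)
  then show ?thesis by (simp add: power2_eq_square)
qed

lemma norm_diffusion_le: "norm (b x *v w) \<le> real CARD('d) * real CARD('m) * K * norm w"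
proof -
  have "\<bar>(b x *v w) $ i\<bar> \<le> real CARD('m) * K * norm w" for i
  proof -
    have "\<bar>(b x *v w) $ i\<bar> \<le> (\<Sum>j\<in>(UNIV::'m set). K * norm w)"
      unfolding matrix_vector_mult_def vec_lambda_beta
    proof (rule order_trans[OF sum_abs], rule sum_mono)
      show "\<bar>b x $ i $ j * w $ j\<bar> \<le> K * norm w" for j
        unfolding abs_mult using b_bound K_nonneg component_le_norm_cart by (intro mult_mono) auto
    qed
    then show ?thesis by simp
  qed
  then have "(\<Sum>i\<in>UNIV. \<bar>(b x *v w) $ i\<bar>) \<le> (\<Sum>i\<in>(UNIV::'d set). real CARD('m) * K * norm w)"
    by (intro sum_mono)
  then show ?thesis using norm_le_l1_cart[of "b x *v w"] by (simp add: mult.assoc)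
qed

lemma norm_remainder_le:
  obtains K2 where "K2 \<ge> 0" "\<And>x \<Delta> I. 0 \<le> \<Delta> \<Longrightarrow>
    norm (remainder x \<Delta> I) ^ 2 \<le> K2 * (\<Delta>\<^sup>2 + (\<Sum>i\<in>UNIV. \<Sum>j\<in>UNIV. (I i j)\<^sup>2))"
proof -
  let ?d = "real CARD('d)" and ?m = "real CARD('m)"
  define C where "C = ?d * (K + ?d * K\<^sup>2)"
  have C0: "C \<ge> 0" using K_nonneg by (simp add: C_def)
  show ?thesis
  proof (rule that[of "2 * C\<^sup>2 * (1 + ?m\<^sup>2)"])
    show "2 * C\<^sup>2 * (1 + ?m\<^sup>2) \<ge> 0" by simp
    fix x and \<Delta> :: real and I :: "'m \<Rightarrow> 'm \<Rightarrow> real" assume \<Delta>: "0 \<le> \<Delta>"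
    define S where "S = (\<Sum>i\<in>UNIV. \<Sum>j\<in>UNIV. \<bar>I i j\<bar>)"
    define Q where "Q = (\<Sum>i\<in>UNIV. \<Sum>j\<in>UNIV. (I i j)\<^sup>2)"
    have S0: "S \<ge> 0" by (auto simp: S_def intro!: sum_nonneg)
    have Q0: "Q \<ge> 0" by (auto simp: Q_def intro!: sum_nonneg)
    have "\<bar>remainder x \<Delta> I $ i\<bar> \<le> K * \<Delta> + ?d * K\<^sup>2 * S" for i
    proof -
      have "\<bar>\<Sum>j1\<in>UNIV. \<Sum>j2\<in>UNIV. corr i j1 j2 x * I j1 j2\<bar> \<le> (\<Sum>j1\<in>UNIV. \<Sum>j2\<in>UNIV. ?d * K\<^sup>2 * \<bar>I j1 j2\<bar>)"
      proof (rule order_trans[OF sum_abs], rule sum_mono, rule order_trans[OF sum_abs], rule sum_mono)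
        show "\<bar>corr i j1 j2 x * I j1 j2\<bar> \<le> ?d * K\<^sup>2 * \<bar>I j1 j2\<bar>" for j1 j2
          unfolding abs_mult using corr_bound by (intro mult_right_mono) auto
      qed
      moreover have "\<bar>a x $ i * \<Delta>\<bar> \<le> K * \<Delta>" using a_bound \<Delta> by (simp add: abs_mult mult_right_mono)
      ultimately show ?thesis
        unfolding remainder_def S_def by (simp add: sum_distrib_left)
    qed
    then have "(\<Sum>i\<in>UNIV. \<bar>remainder x \<Delta> I $ i\<bar>) \<le> (\<Sum>i\<in>(UNIV::'d set). K * \<Delta> + ?d * K\<^sup>2 * S)"
      by (intro sum_mono)
    then have "norm (remainder x \<Delta> I) \<le> ?d * (K * \<Delta> + ?d * K\<^sup>2 * S)"
      using norm_le_l1_cart[of "remainder x \<Delta> I"] by simp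
    also have "\<dots> \<le> C * (\<Delta> + S)"
    proof -
      have "0 \<le> ?d * (K * S)" "0 \<le> ?d * (?d * K\<^sup>2 * \<Delta>)" using K_nonneg S0 \<Delta> by auto
      then show ?thesis by (simp add: C_def algebra_simps)
    qed
    finally have "norm (remainder x \<Delta> I) ^ 2 \<le> (C * (\<Delta> + S))\<^sup>2" by (intro power_mono) auto
    also have "\<dots> \<le> C\<^sup>2 * (2 * \<Delta>\<^sup>2 + 2 * S\<^sup>2)"
      unfolding power_mult_distrib using sum_squares_bound[of \<Delta> S]
      by (intro mult_left_mono) (auto simp: power2_sum)
    also have "\<dots> \<le> C\<^sup>2 * (2 * \<Delta>\<^sup>2 + 2 * (?m\<^sup>2 * Q))"
      using sum_sum_power2_le[of "\<lambda>i j. \<bar>I i j\<bar>"] by (intro mult_left_mono) (auto simp: S_def Q_def)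
    also have "\<dots> \<le> 2 * C\<^sup>2 * (1 + ?m\<^sup>2) * (\<Delta>\<^sup>2 + Q)"
    proof -
      have "0 \<le> C\<^sup>2 * (?m\<^sup>2 * \<Delta>\<^sup>2)" "0 \<le> C\<^sup>2 * Q" using Q0 by auto
      then show ?thesis by (simp add: algebra_simps)
    qed
    finally show "norm (remainder x \<Delta> I) ^ 2 \<le> 2 * C\<^sup>2 * (1 + ?m\<^sup>2) * (\<Delta>\<^sup>2 + (\<Sum>i\<in>UNIV. \<Sum>j\<in>UNIV. (I i j)\<^sup>2))"
      by (simp add: Q_def)
  qed
qed

lemma measurable_milstein_step:
  assumes s: "0 \<le> s" "0 \<le> \<Delta>" and Y: "Y \<in> borel_measurable (F s)"
  shows "(\<lambda>\<omega>. milstein_step a b (Y \<omega>) \<Delta> (W (s + \<Delta>) \<omega> - W s \<omega>) (iter_int W \<omega> s (s + \<Delta>))) \<in> borel_measurable (F (s + \<Delta>))"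
proof -
  have YF: "Y \<in> borel_measurable (F (s + \<Delta>))" using measurable_F_mono[OF _ _ Y] s by auto
  have comp: "(\<lambda>\<omega>. f (Y \<omega>)) \<in> borel_measurable (F (s + \<Delta>))" if "continuous_on UNIV f" for f :: "real^'d \<Rightarrow> real"
    using measurable_compose[OF YF borel_measurable_continuous_onI[OF that]] .
  have w: "(\<lambda>\<omega>. W (s + \<Delta>) \<omega> - W s \<omega>) \<in> borel_measurable (F (s + \<Delta>))"
    using measurable_W s by (intro borel_measurable_diff) auto
  have I: "(\<lambda>\<omega>. iter_int W \<omega> s (s + \<Delta>) i j) \<in> borel_measurable (F (s + \<Delta>))" for i j
    using measurable_iter_int s by auto
  show ?thesis
    unfolding milstein_step_def
    by (intro borel_measurable_vec_lambda borel_measurable_add borel_measurable_sum borel_measurable_times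
        borel_measurable_vec_nth[OF w] borel_measurable_vec_nth[OF YF] I comp[OF a_cont] comp[OF b_cont] comp[OF db_cont]
        borel_measurable_const)
qed

text \<open>\<open>lyap_step\<close> is applied at each point of \<open>A\<close> and integrated by
  \<open>expected_quadratic_form\<close>, with a deterministic time and step size. \<open>A2\<close>
  is fixed before \<delta>, \<Delta>, \<open>s\<close> and \<open>A\<close>, so the error can later
  be made small by the choice of h.\<close>

lemma lyap_expected_step:
  fixes \<rho> :: "real^'d \<Rightarrow> real" and g :: "real^'d \<Rightarrow> real^'d" and D :: "(real^'d) set" and C L c cb Cb :: real
  assumes \<rho>_cont: "continuous_on UNIV \<rho>" and g_cont: "continuous_on UNIV g"
    and C: "C \<ge> 0" and L: "L \<ge> 1" and c: "c > 0"
    and quad: "\<And>x y. x \<in> D \<Longrightarrow> norm (y - x) \<le> 1 \<Longrightarrow> \<bar>\<rho> y - \<rho> x - g x \<bullet> (y - x)\<bar> \<le> C * norm (y - x) ^ 2"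
    and g_bound: "\<And>x. x \<in> D \<Longrightarrow> norm (g x) \<le> L"
    and \<rho>_pos: "\<And>x. x \<in> D \<Longrightarrow> \<rho> x > 0"
    and cb: "cb > 0" "\<And>x \<xi>. x \<in> D \<Longrightarrow> cb * norm \<xi> ^ 2 \<le> \<xi> \<bullet> ((b x ** transpose (b x)) *v \<xi>)"
    and Cb: "Cb > 0" "\<And>x \<xi>. \<xi> \<bullet> ((b x ** transpose (b x)) *v \<xi>) \<le> Cb * norm \<xi> ^ 2"
  obtains A2 where "A2 \<ge> 0" "\<And>\<delta> \<Delta> s A Y. 0 < \<delta> \<Longrightarrow> \<delta> \<le> 1 \<Longrightarrow> 0 < \<Delta> \<Longrightarrow> 0 \<le> s \<Longrightarrow> A \<in> sets (F s) \<Longrightarrow>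
     Y \<in> borel_measurable (F s) \<Longrightarrow> (\<And>\<omega>. \<omega> \<in> A \<Longrightarrow> Y \<omega> \<in> D \<and> \<rho> (Y \<omega>) \<le> L * \<delta> \<and> c \<le> norm (g (Y \<omega>))) \<Longrightarrow>
     expectation (\<lambda>\<omega>. indicator A \<omega> * lyap (L + 1) \<delta> (\<rho> (milstein_step a b (Y \<omega>) \<Delta>
         (W (s + \<Delta>) \<omega> - W s \<omega>) (iter_int W \<omega> s (s + \<Delta>)))))
       \<le> expectation (\<lambda>\<omega>. indicator A \<omega> * lyap (L + 1) \<delta> (\<rho> (Y \<omega>)))
         - \<Delta> * prob A * (cb * c\<^sup>2 / 2 - A2 * (\<delta> + \<Delta> + \<Delta> / \<delta>\<^sup>2))"
proof -
  define B where "B = L + 1"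
  have B: "B \<ge> 1" using L by (simp add: B_def)
  let ?m = "real CARD('m)"
  define K1 where "K1 = real CARD('d) * ?m * K"
  have K1: "K1 \<ge> 0" using K_nonneg by (simp add: K1_def)
  have K1': "norm (b x *v w) \<le> K1 * norm w" for x w using norm_diffusion_le by (simp add: K1_def)
  obtain K2 where K2: "K2 \<ge> 0" "\<And>x \<Delta> I. 0 \<le> \<Delta> \<Longrightarrow>
    norm (remainder x \<Delta> I) ^ 2 \<le> K2 * (\<Delta>\<^sup>2 + (\<Sum>i\<in>UNIV. \<Sum>j\<in>UNIV. (I i j)\<^sup>2))"
    by (rule norm_remainder_le) blast
  obtain A1 where A1: "A1 \<ge> 0" "\<And>\<delta> \<Delta> r r' (n :: real^'d) G R.
    0 < \<delta> \<Longrightarrow> \<delta> \<le> 1 \<Longrightarrow> 0 < \<Delta> \<Longrightarrow> 0 < r \<Longrightarrow> r \<le> L * \<delta> \<Longrightarrow> norm n \<le> L \<Longrightarrow>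
    (norm (G + R) \<le> 1 \<Longrightarrow> \<bar>r' - r - n \<bullet> (G + R)\<bar> \<le> C * norm (G + R) ^ 2) \<Longrightarrow>
    lyap B \<delta> r' \<le> lyap B \<delta> r + 2 * (B * \<delta> - r) * (n \<bullet> G) - (n \<bullet> G)\<^sup>2 / 2
      + A1 * (\<delta> * norm G ^ 2 + norm R ^ 2 + \<delta> * \<Delta> + \<delta> * norm R ^ 2 / \<Delta> + norm G ^ 4 / \<delta>\<^sup>2)"
    unfolding B_def by (rule lyap_step[OF L C, where 'a = "real^'d"]) blast
  \<comment> \<open>Sum of the contributions of \<open>q1\<close> to \<open>q4\<close> below, each
    divided by \<Delta> and estimated by a multiple of \<delta> + \<Delta> + \<Delta> /
    \<delta>^2.\<close>
  define A2 where "A2 = A1 * (K1\<^sup>2 * ?m + 3 * K1 ^ 4 * ?m\<^sup>2 + 3 * ?m\<^sup>2 * K2 + K2 + 1)"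
  \<comment> \<open>The noise acts on \<open>\<rho>\<close> to first order through
    \<open>e \<bullet> w\<close>, and the squared norm of \<open>e\<close> is the quadratic form in
    the hypotheses on \<open>b\<close>, taken at the gradient: at least cb c^2 and at most Cb L^2 on
    \<open>A\<close>.\<close>
  define e where "e x = transpose (b x) *v g x" for x
  have e_inner: "g x \<bullet> (b x *v w) = e x \<bullet> w" for x w
    unfolding e_def by (simp add: dot_lmul_matrix[symmetric] vector_transpose_matrix)
  have e_norm: "norm (e x) ^ 2 = g x \<bullet> ((b x ** transpose (b x)) *v g x)" for x
  proof -
    have "norm (e x) ^ 2 = e x \<bullet> e x" by (rule power2_norm_eq_inner)
    also have "\<dots> = g x \<bullet> (b x *v e x)" by (simp add: e_inner)
    also have "b x *v e x = (b x ** transpose (b x)) *v g x"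
      unfolding e_def matrix_vector_mul_assoc ..
    finally show ?thesis .
  qed
  have e_cont: "continuous_on UNIV e"
    unfolding e_def[abs_def] matrix_vector_mult_def transpose_def vec_lambda_beta
    by (intro continuous_on_vec_lambda continuous_on_sum continuous_on_mult b_cont
        continuous_on_component[OF g_cont])
  show ?thesis
  proof (rule that[of A2])
    show "A2 \<ge> 0" using A1 K1 K2 by (auto simp: A2_def intro!: mult_nonneg_nonneg add_nonneg_nonneg)
    fix \<delta> \<Delta> s :: real and A :: "'w set" and Y :: "'w \<Rightarrow> real^'d"
    assume \<delta>: "0 < \<delta>" "\<delta> \<le> 1" and \<Delta>: "0 < \<Delta>" and s: "0 \<le> s" and A: "A \<in> sets (F s)"
      and Y: "Y \<in> borel_measurable (F s)"
      and YA: "\<And>\<omega>. \<omega> \<in> A \<Longrightarrow> Y \<omega> \<in> D \<and> \<rho> (Y \<omega>) \<le> L * \<delta> \<and> c \<le> norm (g (Y \<omega>))"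
    define X where "X \<omega> = milstein_step a b (Y \<omega>) \<Delta> (W (s + \<Delta>) \<omega> - W s \<omega>) (iter_int W \<omega> s (s + \<Delta>))" for \<omega>
    define w where "w = incr s (s + \<Delta>)"
    define \<alpha> where "\<alpha> \<omega> = 2 * (B * \<delta> - \<rho> (Y \<omega>))" for \<omega>
    define Q where "Q \<omega> = (\<Sum>i\<in>UNIV. \<Sum>j\<in>UNIV. (iter_int W \<omega> s (s + \<Delta>) i j)\<^sup>2)" for \<omega>
    \<comment> \<open>Coefficients of the errors in \<open>lyap_step\<close>: \<open>q1\<close> from
      \<open>\<delta> * norm G ^ 2\<close>, \<open>q2\<close> from
      \<open>norm G ^ 4 / \<delta>\<^sup>2\<close>; the terms in \<open>R\<close> split into
      iterated integrals (\<open>q3\<close>) and a deterministic rest, which joins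
      \<open>\<delta> * \<Delta>\<close> in \<open>q4\<close>.\<close>
    define q1 where "q1 = A1 * \<delta> * K1\<^sup>2"
    define q2 where "q2 = A1 * K1 ^ 4 * ?m / \<delta>\<^sup>2"
    define q3 where "q3 = A1 * K2 * (1 + \<delta> / \<Delta>)"
    define q4 where "q4 = A1 * (K2 * \<Delta>\<^sup>2 * (1 + \<delta> / \<Delta>) + \<delta> * \<Delta>)"
    have q: "q1 \<ge> 0" "q2 \<ge> 0" "q3 \<ge> 0" "q4 \<ge> 0"
      using A1 K1 K2 \<delta> \<Delta> by (auto simp: q1_def q2_def q3_def q4_def)
    define H where "H \<omega> = \<alpha> \<omega> * (e (Y \<omega>) \<bullet> w \<omega>) - (e (Y \<omega>) \<bullet> w \<omega>)\<^sup>2 / 2 + q1 * norm (w \<omega>) ^ 2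
       + q2 * (\<Sum>j\<in>UNIV. (w \<omega> $ j) ^ 4) + q3 * Q \<omega> + q4" for \<omega>
    have pw: "lyap B \<delta> (\<rho> (X \<omega>)) \<le> lyap B \<delta> (\<rho> (Y \<omega>)) + H \<omega>" if \<omega>: "\<omega> \<in> A" for \<omega>
    proof -
      let ?G = "b (Y \<omega>) *v w \<omega>" and ?R = "remainder (Y \<omega>) \<Delta> (iter_int W \<omega> s (s + \<Delta>))"
      have YD: "Y \<omega> \<in> D" using YA \<omega> by blast
      have Xeq: "X \<omega> - Y \<omega> = ?G + ?R"
        by (simp add: X_def milstein_step_eq w_def incr_def)
      have "lyap B \<delta> (\<rho> (X \<omega>)) \<le> lyap B \<delta> (\<rho> (Y \<omega>)) + 2 * (B * \<delta> - \<rho> (Y \<omega>)) * (g (Y \<omega>) \<bullet> ?G) - (g (Y \<omega>) \<bullet> ?G)\<^sup>2 / 2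
        + A1 * (\<delta> * norm ?G ^ 2 + norm ?R ^ 2 + \<delta> * \<Delta> + \<delta> * norm ?R ^ 2 / \<Delta> + norm ?G ^ 4 / \<delta>\<^sup>2)"
      proof (rule A1(2)[OF \<delta> \<Delta>])
        show "0 < \<rho> (Y \<omega>)" "\<rho> (Y \<omega>) \<le> L * \<delta>" "norm (g (Y \<omega>)) \<le> L"
          using YA[OF \<omega>] \<rho>_pos g_bound by auto
        show "\<bar>\<rho> (X \<omega>) - \<rho> (Y \<omega>) - g (Y \<omega>) \<bullet> (?G + ?R)\<bar> \<le> C * norm (?G + ?R) ^ 2" if "norm (?G + ?R) \<le> 1"
          using quad[OF YD, of "X \<omega>"] that unfolding Xeq by blast
      qed
      moreover have "A1 * (\<delta> * norm ?G ^ 2 + norm ?R ^ 2 + \<delta> * \<Delta> + \<delta> * norm ?R ^ 2 / \<Delta> + norm ?G ^ 4 / \<delta>\<^sup>2)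
          \<le> A1 * (\<delta> * (K1\<^sup>2 * norm (w \<omega>) ^ 2) + K2 * (\<Delta>\<^sup>2 + Q \<omega>) + \<delta> * \<Delta> + \<delta> * (K2 * (\<Delta>\<^sup>2 + Q \<omega>)) / \<Delta>
             + K1 ^ 4 * (?m * (\<Sum>j\<in>UNIV. (w \<omega> $ j) ^ 4)) / \<delta>\<^sup>2)"
      proof (intro mult_left_mono add_mono divide_right_mono)
        show "norm ?G ^ 2 \<le> K1\<^sup>2 * norm (w \<omega>) ^ 2"
          using power_mono[OF K1'[of "Y \<omega>" "w \<omega>"], of 2] by (simp add: power_mult_distrib)
        show "norm ?R ^ 2 \<le> K2 * (\<Delta>\<^sup>2 + Q \<omega>)" "norm ?R ^ 2 \<le> K2 * (\<Delta>\<^sup>2 + Q \<omega>)"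
          using K2(2)[of \<Delta>] \<Delta> by (auto simp: Q_def)
        have "norm ?G ^ 4 \<le> K1 ^ 4 * norm (w \<omega>) ^ 4"
          using power_mono[OF K1'[of "Y \<omega>" "w \<omega>"], of 4] by (simp add: power_mult_distrib)
        also have "\<dots> \<le> K1 ^ 4 * (?m * (\<Sum>j\<in>UNIV. (w \<omega> $ j) ^ 4))"
          using norm_power4_vec_le by (intro mult_left_mono) auto
        finally show "norm ?G ^ 4 \<le> K1 ^ 4 * (?m * (\<Sum>j\<in>UNIV. (w \<omega> $ j) ^ 4))" .
      qed (use \<delta> \<Delta> A1 in auto)
      ultimately show ?thesis
        unfolding e_inner H_def \<alpha>_def q1_def q2_def q3_def q4_def
        by (simp add: algebra_simps add_divide_distrib)
    qed
    have comp: "(\<lambda>\<omega>. f (Y \<omega>)) \<in> borel_measurable (F s)" if "continuous_on UNIV f" for f :: "real^'d \<Rightarrow> 'z::topological_space"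
      using measurable_compose[OF Y borel_measurable_continuous_onI[OF that]] .
    have LB: "L * \<delta> \<le> B * \<delta>" using \<delta> by (simp add: B_def)
    have HE: "integrable M (\<lambda>\<omega>. indicator A \<omega> * H \<omega>)"
      "expectation (\<lambda>\<omega>. indicator A \<omega> * H \<omega>) \<le> prob A * (- (cb * c\<^sup>2) * \<Delta> / 2 + q1 * (?m * \<Delta>)
      + q2 * (3 * ?m * \<Delta>\<^sup>2) + q3 * (3 * ?m\<^sup>2 * \<Delta>\<^sup>2) + q4)"
    proof -
      have cm: "(\<lambda>\<omega>. e (Y \<omega>)) \<in> borel_measurable (F s)" by (rule comp[OF e_cont])
      have \<alpha>m: "\<alpha> \<in> borel_measurable (F s)"
        unfolding \<alpha>_def[abs_def] by (intro borel_measurable_times borel_measurable_diff comp[OF \<rho>_cont]) auto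
      have cB: "norm (e (Y \<omega>)) \<le> sqrt (Cb * L\<^sup>2)" if "\<omega> \<in> A" for \<omega>
      proof (rule real_le_rsqrt)
        have "norm (e (Y \<omega>)) ^ 2 \<le> Cb * norm (g (Y \<omega>)) ^ 2" unfolding e_norm by (rule Cb(2))
        also have "\<dots> \<le> Cb * L\<^sup>2" using YA[OF that] g_bound Cb by (intro mult_left_mono power_mono) auto
        finally show "norm (e (Y \<omega>)) ^ 2 \<le> Cb * L\<^sup>2" .
      qed
      have \<alpha>B: "\<bar>\<alpha> \<omega>\<bar> \<le> 2 * (B * \<delta>)" if "\<omega> \<in> A" for \<omega>
        using YA[OF that] \<rho>_pos[of "Y \<omega>"] LB by (auto simp: \<alpha>_def)
      have c0: "cb * c\<^sup>2 \<le> norm (e (Y \<omega>)) ^ 2" if "\<omega> \<in> A" for \<omega>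
      proof -
        have "cb * c\<^sup>2 \<le> cb * norm (g (Y \<omega>)) ^ 2" using YA[OF that] c cb by (intro mult_left_mono power_mono) auto
        also have "\<dots> \<le> norm (e (Y \<omega>)) ^ 2" unfolding e_norm using YA[OF that] by (intro cb(2)) auto
        finally show ?thesis .
      qed
      show "integrable M (\<lambda>\<omega>. indicator A \<omega> * H \<omega>)"
        unfolding H_def Q_def w_def by (rule expected_quadratic_form(1)[OF s \<Delta> A cm \<alpha>m cB \<alpha>B c0 q])
      show "expectation (\<lambda>\<omega>. indicator A \<omega> * H \<omega>) \<le> prob A * (- (cb * c\<^sup>2) * \<Delta> / 2 + q1 * (?m * \<Delta>)
        + q2 * (3 * ?m * \<Delta>\<^sup>2) + q3 * (3 * ?m\<^sup>2 * \<Delta>\<^sup>2) + q4)"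
        unfolding H_def Q_def w_def by (rule expected_quadratic_form(2)[OF s \<Delta> A cm \<alpha>m cB \<alpha>B c0 q])
    qed
    have AM: "A \<in> events" using sets_F s A by blast
    have lyap_int: "integrable M (\<lambda>\<omega>. indicator A \<omega> * lyap B \<delta> (\<rho> (Z \<omega>)))" if Z: "Z \<in> borel_measurable M" for Z
      using measurable_compose[OF Z borel_measurable_continuous_onI[OF \<rho>_cont]] AM B \<delta>
      by (intro integrable_indicator_lyap) auto
    have XM: "X \<in> borel_measurable M"
      unfolding X_def[abs_def] using measurable_F[OF _ measurable_milstein_step[OF s _ Y]] s \<Delta> by simp
    have YM: "Y \<in> borel_measurable M" using Y s measurable_F by blast
    have "expectation (\<lambda>\<omega>. indicator A \<omega> * lyap B \<delta> (\<rho> (X \<omega>)))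
       \<le> expectation (\<lambda>\<omega>. indicator A \<omega> * lyap B \<delta> (\<rho> (Y \<omega>)) + indicator A \<omega> * H \<omega>)"
      using pw by (intro integral_mono lyap_int XM YM HE Bochner_Integration.integrable_add) (auto simp: indicator_def)
    also have "\<dots> = expectation (\<lambda>\<omega>. indicator A \<omega> * lyap B \<delta> (\<rho> (Y \<omega>))) + expectation (\<lambda>\<omega>. indicator A \<omega> * H \<omega>)"
      by (intro Bochner_Integration.integral_add lyap_int YM HE)
    also have "expectation (\<lambda>\<omega>. indicator A \<omega> * H \<omega>) \<le> - (\<Delta> * prob A * (cb * c\<^sup>2 / 2 - A2 * (\<delta> + \<Delta> + \<Delta> / \<delta>\<^sup>2)))"
    proof -
      have "q1 * (?m * \<Delta>) + q2 * (3 * ?m * \<Delta>\<^sup>2) + q3 * (3 * ?m\<^sup>2 * \<Delta>\<^sup>2) + q4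
         = \<Delta> * (A1 * (K1\<^sup>2 * ?m * \<delta> + 3 * K1 ^ 4 * ?m\<^sup>2 * (\<Delta> / \<delta>\<^sup>2) + (3 * ?m\<^sup>2 * K2 + K2) * (\<delta> + \<Delta>) + \<delta>))"
        using \<delta> \<Delta> unfolding q1_def q2_def q3_def q4_def by (simp add: field_simps power2_eq_square)
      also have "\<dots> \<le> \<Delta> * (A2 * (\<delta> + \<Delta> + \<Delta> / \<delta>\<^sup>2))"
      proof -
        define t where "t = \<delta> + \<Delta> + \<Delta> / \<delta>\<^sup>2"
        have t: "\<delta> \<le> t" "\<Delta> / \<delta>\<^sup>2 \<le> t" "\<delta> + \<Delta> \<le> t" using \<delta> \<Delta> by (auto simp: t_def)
        have "K1\<^sup>2 * ?m * \<delta> + 3 * K1 ^ 4 * ?m\<^sup>2 * (\<Delta> / \<delta>\<^sup>2) + (3 * ?m\<^sup>2 * K2 + K2) * (\<delta> + \<Delta>) + \<delta>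
           \<le> K1\<^sup>2 * ?m * t + 3 * K1 ^ 4 * ?m\<^sup>2 * t + (3 * ?m\<^sup>2 * K2 + K2) * t + t"
          using t K1 K2 by (intro add_mono mult_left_mono) auto
        also have "\<dots> = (K1\<^sup>2 * ?m + 3 * K1 ^ 4 * ?m\<^sup>2 + 3 * ?m\<^sup>2 * K2 + K2 + 1) * t" by (simp add: algebra_simps)
        finally have "A1 * (K1\<^sup>2 * ?m * \<delta> + 3 * K1 ^ 4 * ?m\<^sup>2 * (\<Delta> / \<delta>\<^sup>2) + (3 * ?m\<^sup>2 * K2 + K2) * (\<delta> + \<Delta>) + \<delta>) \<le> A2 * t"
          unfolding A2_def mult.assoc using A1(1) by (intro mult_left_mono) (auto simp: mult.assoc)
        then show ?thesis using \<Delta> unfolding t_def by (intro mult_left_mono) auto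
      qed
      finally have "- (cb * c\<^sup>2) * \<Delta> / 2 + q1 * (?m * \<Delta>) + q2 * (3 * ?m * \<Delta>\<^sup>2) + q3 * (3 * ?m\<^sup>2 * \<Delta>\<^sup>2) + q4
         \<le> - (\<Delta> * (cb * c\<^sup>2 / 2 - A2 * (\<delta> + \<Delta> + \<Delta> / \<delta>\<^sup>2)))" by (simp add: algebra_simps)
      then have "prob A * (- (cb * c\<^sup>2) * \<Delta> / 2 + q1 * (?m * \<Delta>) + q2 * (3 * ?m * \<Delta>\<^sup>2) + q3 * (3 * ?m\<^sup>2 * \<Delta>\<^sup>2) + q4)
         \<le> prob A * - (\<Delta> * (cb * c\<^sup>2 / 2 - A2 * (\<delta> + \<Delta> + \<Delta> / \<delta>\<^sup>2)))"
        by (intro mult_left_mono) auto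
      then show ?thesis using HE(2) by (simp add: mult_ac)
    qed
    finally show "expectation (\<lambda>\<omega>. indicator A \<omega> * lyap (L + 1) \<delta> (\<rho> (milstein_step a b (Y \<omega>) \<Delta>
         (W (s + \<Delta>) \<omega> - W s \<omega>) (iter_int W \<omega> s (s + \<Delta>)))))
       \<le> expectation (\<lambda>\<omega>. indicator A \<omega> * lyap (L + 1) \<delta> (\<rho> (Y \<omega>)))
         - \<Delta> * prob A * (cb * c\<^sup>2 / 2 - A2 * (\<delta> + \<Delta> + \<Delta> / \<delta>\<^sup>2))"
      by (simp add: B_def X_def)
  qed
qed

end

section \<open>Pathwise cost\<close>

text \<open>Says that step \<open>n\<close> begins before the numerical exit time. Requiring all
  earlier positions in \<open>D\<close> makes the property pass to smaller \<open>n\<close>.\<close>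

definition alive :: "'x set \<Rightarrow> real \<Rightarrow> (nat \<Rightarrow> real) \<Rightarrow> (nat \<Rightarrow> 'x) \<Rightarrow> nat \<Rightarrow> bool" where
  "alive D T t X n \<longleftrightarrow> (\<forall>k\<le>n. X k \<in> D) \<and> t n < T"

locale time_steps =
  fixes t :: "nat \<Rightarrow> real" and X :: "nat \<Rightarrow> 'x" and dt :: "'x \<Rightarrow> real" and h :: real
  assumes t0: "t 0 = 0" and tSuc: "t (Suc n) = t n + dt (X n)"
    and h: "0 < h" "h < 1" and dt: "dt x = h \<or> dt x = h\<^sup>2"
begin

lemma h2_le: "h\<^sup>2 \<le> h"
  using h by (simp add: power2_eq_square mult_left_le)

lemma dt_pos: "0 < dt x" and dt_ge: "h\<^sup>2 \<le> dt x" and dt_le: "dt x \<le> h"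
  using dt[of x] h h2_le by auto

lemma t_strict_mono: "m < n \<Longrightarrow> t m < t n"
  by (rule lift_Suc_mono_less[of t]) (use dt_pos in \<open>auto simp: tSuc\<close>)

lemma t_mono: "m \<le> n \<Longrightarrow> t m \<le> t n"
  using t_strict_mono[of m n] by (cases "m = n") auto

lemma t_ge: "real n * h\<^sup>2 \<le> t n"
proof (induction n)
  case (Suc n)
  then show ?case using dt_ge[of "X n"] by (simp add: tSuc algebra_simps)
qed (simp add: t0)

lemma t_nonneg: "0 \<le> t n"
  using t_mono[of 0 n] t0 by simp

lemma alive_mono: "alive D T t X n \<Longrightarrow> m \<le> n \<Longrightarrow> alive D T t X m"
  using t_mono[of m n] by (auto simp: alive_def)

text \<open>As \<open>alive\<close> passes to smaller indices, the sum telescopes up to the last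
  live step. The second conjunct pins down the end index while all steps are alive, which the
  induction needs; for the occupation bound an unspecified \<open>k\<close> is enough.\<close>

lemma alive_telescope:
  "(\<exists>k. (\<Sum>n<N. if alive D T t X n then v (Suc n) - v n else 0) = v k - v 0) \<and>
   ((\<forall>n<N. alive D T t X n) \<longrightarrow> (\<Sum>n<N. if alive D T t X n then v (Suc n) - v n else 0) = (v N - v 0 :: real))"
proof (induction N)
  case 0
  show ?case by auto
next
  case (Suc N)
  show ?case
  proof (cases "alive D T t X N")
    case True
    then have "\<forall>n<N. alive D T t X n" using alive_mono by auto
    then have "(\<Sum>n<N. if alive D T t X n then v (Suc n) - v n else 0) = v N - v 0" using Suc.IH by blast
    then have "(\<Sum>n<Suc N. if alive D T t X n then v (Suc n) - v n else 0) = v (Suc N) - v 0"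
      using True by simp
    then show ?thesis by blast
  next
    case False
    then show ?thesis using Suc.IH by auto
  qed
qed

text \<open>The last live step starts before \<open>T\<close> and overshoots by at most
  \<open>h\<close>.\<close>

lemma alive_time_le:
  assumes "0 < T"
  shows "(\<Sum>n<N. if alive D T t X n then dt (X n) else 0) \<le> T + h"
proof (induction N)
  case 0
  show ?case using assms h by simp
next
  case (Suc N)
  show ?case
  proof (cases "alive D T t X N")
    case True
    then have "\<forall>n<N. alive D T t X n" using alive_mono by auto
    then have "(\<Sum>n<N. if alive D T t X n then t (Suc n) - t n else 0) = t N - t 0"
      using alive_telescope[where N = N and D = D and T = T and v = t] by blast
    then have "(\<Sum>n<N. if alive D T t X n then dt (X n) else 0) = t N" by (simp add: tSuc t0 cong: if_cong)
    moreover have "t N < T" using True by (simp add: alive_def)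
    ultimately show ?thesis using True dt_le[of "X N"] by simp
  next
    case False
    then show ?thesis using Suc.IH by simp
  qed
qed

text \<open>Before \<open>nu\<close>, the integrand on \<open>[t n, t (Suc n))\<close> is the
  reciprocal of the length of this interval, so each live step contributes at most 1. As steps are
  at least h^2 long, every time before \<open>T\<close> belongs to a step with index below
  \<open>N\<close>.\<close>

lemma integral_cost_le:
  fixes D :: "'x set" and T :: real
  assumes T: "0 < T" and N: "T \<le> real N * h\<^sup>2"
  defines "nu \<equiv> (if \<exists>n. X n \<notin> D then min (t (LEAST n. X n \<notin> D)) T else T)"
  shows "integral {0..nu} (\<lambda>r. 1 / dt (X (LEAST n. r < t (Suc n)))) \<le> (\<Sum>n<N. if alive D T t X n then 1 else 0)"
proof -
  define f where "f r = 1 / dt (X (LEAST n. r < t (Suc n)))" for r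
  \<comment> \<open>At \<open>r = nu\<close> the \<open>LEAST\<close> index may already belong to a
    step that is not alive; this single point is set to 0.\<close>
  define f' where "f' r = (if r = nu then 0 else f r)" for r
  \<comment> \<open>The closed intervals overlap at their endpoints, which only enlarges the
    majorant.\<close>
  define g where "g r = (\<Sum>n<N. if r \<in> {t n..t (Suc n)} then (if alive D T t X n then 1 / dt (X n) else 0) else 0)" for r
  have nuT: "nu \<le> T" by (simp add: nu_def)
  have tN: "T \<le> t N" using N t_ge[of N] by linarith
  have g0: "0 \<le> g r" for r
    unfolding g_def using dt_pos by (intro sum_nonneg) (auto intro: less_imp_le)
  have fg: "f' r \<le> g r" if r: "r \<in> {0..nu}" for r
  proof (cases "r = nu")
    case True
    then show ?thesis using g0 by (simp add: f'_def)
  next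
    case False
    then have rnu: "r < nu" "0 \<le> r" using r by auto
    define n where "n = (LEAST n. r < t (Suc n))"
    have "r < t N" using rnu nuT tN by linarith
    also have "t N \<le> t (Suc N)" by (intro t_mono) simp
    finally have lt: "r < t (Suc n)" unfolding n_def by (rule LeastI)
    have tn: "t n \<le> r"
    proof (cases n)
      case 0
      then show ?thesis using t0 rnu by simp
    next
      case (Suc k)
      then have "k < (LEAST n. r < t (Suc n))" using n_def by simp
      from not_less_Least[OF this] show ?thesis using Suc by simp
    qed
    have al: "alive D T t X n"
    proof -
      have "X k \<in> D" if k: "k \<le> n" for k
      proof (rule ccontr)
        assume nk: "X k \<notin> D"
        then have "(LEAST n. X n \<notin> D) \<le> k" by (rule Least_le)
        then have "t (LEAST n. X n \<notin> D) \<le> t n" using k by (intro t_mono) simp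
        moreover have "nu \<le> t (LEAST n. X n \<notin> D)" using nk by (auto simp: nu_def)
        ultimately show False using tn rnu by linarith
      qed
      then show ?thesis using tn rnu nuT by (auto simp: alive_def)
    qed
    have "real n * h\<^sup>2 < real N * h\<^sup>2" using t_ge[of n] tn rnu nuT N by linarith
    then have nN: "n < N" using h by simp
    have "f' r = (if r \<in> {t n..t (Suc n)} then (if alive D T t X n then 1 / dt (X n) else 0) else 0)"
      using False lt tn al by (simp add: f'_def f_def n_def)
    also have "\<dots> \<le> g r"
      unfolding g_def using nN dt_pos
      by (intro member_le_sum) (auto intro: less_imp_le)
    finally show ?thesis .
  qed
  have gi: "((\<lambda>r. if r \<in> {t n..t (Suc n)} then (if alive D T t X n then 1 / dt (X n) else 0) else 0)
      has_integral (if alive D T t X n then 1 else 0)) {0..t N}" if n: "n < N" for n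
  proof -
    have le: "t n \<le> t (Suc n)" using t_mono[of n "Suc n"] by simp
    have sub: "{t n..t (Suc n)} \<subseteq> {0..t N}" using t_nonneg[of n] t_mono[of "Suc n" N] n by auto
    let ?c = "if alive D T t X n then 1 / dt (X n) else (0::real)"
    have "((\<lambda>r. ?c) has_integral ((t (Suc n) - t n) *\<^sub>R ?c)) {t n..t (Suc n)}"
      using has_integral_const_real[of ?c "t n" "t (Suc n)"] le by simp
    moreover have "(t (Suc n) - t n) *\<^sub>R ?c = (if alive D T t X n then 1 else 0)"
      using dt_pos[of "X n"] by (simp add: tSuc)
    ultimately show ?thesis unfolding has_integral_restrict[OF sub] by simp
  qed
  have gI: "(g has_integral (\<Sum>n<N. if alive D T t X n then 1 else 0)) {0..t N}"
    unfolding g_def[abs_def] using gi by (intro has_integral_sum) auto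
  have gsub: "g integrable_on {0..nu}"
    using integrable_subinterval_real[OF has_integral_integrable[OF gI], of 0 nu] nuT tN by auto
  have gle: "integral {0..nu} g \<le> (\<Sum>n<N. if alive D T t X n then 1 else 0)"
    using integral_subset_le[OF _ gsub has_integral_integrable[OF gI]] g0 nuT tN integral_unique[OF gI] by auto
  show ?thesis
  proof (cases "f integrable_on {0..nu}")
    case True
    have "integral {0..nu} f = integral {0..nu} f'"
      by (rule integral_spike[of "{nu}"]) (auto simp: f'_def)
    also have "\<dots> \<le> integral {0..nu} g"
    proof (rule integral_le[OF _ gsub])
      show "f' integrable_on {0..nu}"
        by (rule integrable_spike[OF True, of "{nu}"]) (auto simp: f'_def)
    qed (use fg in auto)
    finally show ?thesis using gle by (simp add: f_def[abs_def])
  next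
    \<comment> \<open>Here \<open>integral\<close> takes its default value 0.\<close>
    case False
    then have "integral {0..nu} f = 0" by (rule not_integrable_integral)
    moreover have "0 \<le> (\<Sum>n<N. if alive D T t X n then 1 else (0::real))" by (intro sum_nonneg) auto
    ultimately show ?thesis by (simp add: f_def[abs_def])
  qed
qed

text \<open>A step of length \<open>h\<close> is counted as its length over \<open>h\<close>, a step
  of length h^2 as its length over h^2; the small live steps all satisfy \<open>P\<close> and are
  covered by the second sum.\<close>

lemma alive_count_le:
  assumes T: "0 < T" and small: "\<And>n. alive D T t X n \<Longrightarrow> dt (X n) \<noteq> h \<Longrightarrow> P n"
  shows "(\<Sum>n<N. if alive D T t X n then 1 else 0)
     \<le> (T + h) / h + (\<Sum>n<N. if alive D T t X n \<and> P n then dt (X n) else 0) / h\<^sup>2"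
proof -
  have "(\<Sum>n<N. if alive D T t X n then 1 else 0)
     \<le> (\<Sum>n<N. (if alive D T t X n then dt (X n) else 0) / h + (if alive D T t X n \<and> P n then dt (X n) else 0) / h\<^sup>2)"
  proof (rule sum_mono)
    fix n
    show "(if alive D T t X n then 1 else 0)
       \<le> (if alive D T t X n then dt (X n) else 0) / h + (if alive D T t X n \<and> P n then dt (X n) else 0) / h\<^sup>2"
      using dt[of "X n"] small[of n] h dt_pos[of "X n"] by (cases "dt (X n) = h") auto
  qed
  also have "\<dots> = (\<Sum>n<N. if alive D T t X n then dt (X n) else 0) / h
      + (\<Sum>n<N. if alive D T t X n \<and> P n then dt (X n) else 0) / h\<^sup>2"
    by (simp add: sum.distrib sum_divide_distrib)
  also have "\<dots> \<le> (T + h) / h + (\<Sum>n<N. if alive D T t X n \<and> P n then dt (X n) else 0) / h\<^sup>2"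
    using alive_time_le[OF T, where N = N and D = D] h by (intro add_mono divide_right_mono) auto
  finally show ?thesis .
qed

end

section \<open>The scheme and its occupation time near the boundary\<close>

locale milstein_scheme = milstein M F W a b K
  for M :: "'w measure" and F and W :: "real \<Rightarrow> 'w \<Rightarrow> real^'m::finite"
    and a :: "real^'d::finite \<Rightarrow> real^'d" and b K +
  fixes D :: "(real^'d) set" and dt :: "real^'d \<Rightarrow> real" and x0 :: "real^'d" and h :: real
  assumes D: "open D" and dt_meas: "dt \<in> borel_measurable borel"
    and dt: "\<And>x. dt x = h \<or> dt x = h\<^sup>2" and h: "0 < h" "h < 1"
begin

section \<open>Adaptedness of the scheme at deterministic times\<close>

definition tt :: "nat \<Rightarrow> 'w \<Rightarrow> real" where
  "tt n \<omega> = fst (scheme a b W dt x0 \<omega> n)"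

definition XX :: "nat \<Rightarrow> 'w \<Rightarrow> real^'d" where
  "XX n \<omega> = snd (scheme a b W dt x0 \<omega> n)"

definition step :: "real \<Rightarrow> real \<Rightarrow> real^'d \<Rightarrow> 'w \<Rightarrow> real^'d" where
  "step s \<Delta> y \<omega> = milstein_step a b y \<Delta> (W (s + \<Delta>) \<omega> - W s \<omega>) (iter_int W \<omega> s (s + \<Delta>))"

lemma tt_0: "tt 0 \<omega> = 0" and XX_0: "XX 0 \<omega> = x0"
  by (auto simp: tt_def XX_def)

lemma tt_Suc: "tt (Suc n) \<omega> = tt n \<omega> + dt (XX n \<omega>)"
  and XX_Suc: "XX (Suc n) \<omega> = step (tt n \<omega>) (dt (XX n \<omega>)) (XX n \<omega>) \<omega>"
  by (auto simp: tt_def XX_def step_def Let_def)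

sublocale steps: time_steps "\<lambda>n. tt n \<omega>" "\<lambda>n. XX n \<omega>" dt h for \<omega>
  by unfold_locales (use dt h in \<open>auto simp: tt_0 tt_Suc\<close>)

text \<open>Fixing the random time t_n to the value \<open>s\<close> makes the event and the
  position on it measurable with respect to \<open>F s\<close>, without a stopped
  sigma-algebra.\<close>

definition live :: "nat \<Rightarrow> real \<Rightarrow> 'w set" where
  "live n s = {\<omega>\<in>space M. tt n \<omega> = s \<and> (\<forall>k\<le>n. XX k \<omega> \<in> D)}"

text \<open>The default \<open>x0\<close> off the event gives a variable on the whole space that is
  measurable with respect to \<open>F s\<close>, as the one-step estimate demands.\<close>

definition val :: "nat \<Rightarrow> real \<Rightarrow> 'w \<Rightarrow> real^'d" where
  "val n s \<omega> = (if \<omega> \<in> live n s then XX n \<omega> else x0)"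

lemma val_live: "\<omega> \<in> live n s \<Longrightarrow> val n s \<omega> = XX n \<omega>"
  by (simp add: val_def)

lemma measurable_step:
  assumes "0 \<le> s" "0 \<le> \<Delta>" "Y \<in> borel_measurable (F s)"
  shows "(\<lambda>\<omega>. step s \<Delta> (Y \<omega>) \<omega>) \<in> borel_measurable (F (s + \<Delta>))"
  unfolding step_def using measurable_milstein_step[OF assms] .

text \<open>A step that ends at \<open>s\<close> started at \<open>s - h\<close> or at
  \<open>s - h\<^sup>2\<close>. On each of these two pieces the new position is a step of
  deterministic length from \<open>val n (s - \<Delta>)\<close>; a negative starting time gives an
  empty piece.\<close>

lemma adapted:
  "0 \<le> s \<Longrightarrow> live n s \<in> sets (F s) \<and> val n s \<in> borel_measurable (F s)"
proof (induction n arbitrary: s)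
  case 0
  have "live 0 s = (if s = 0 \<and> x0 \<in> D then space (F s) else {})"
    using 0 by (auto simp: live_def tt_0 XX_0 space_F)
  moreover have "val 0 s = (\<lambda>_. x0)" by (auto simp: val_def XX_0)
  ultimately show ?case by simp
next
  case (Suc n)
  define piece where "piece \<Delta> = {\<omega>\<in>space M. tt n \<omega> = s - \<Delta> \<and> dt (XX n \<omega>) = \<Delta> \<and> (\<forall>k\<le>Suc n. XX k \<omega> \<in> D)}" for \<Delta>
  have piece: "\<exists>Z. piece \<Delta> \<in> sets (F s) \<and> Z \<in> borel_measurable (F s) \<and> (\<forall>\<omega>\<in>piece \<Delta>. Z \<omega> = XX (Suc n) \<omega>)"
    if \<Delta>: "0 < \<Delta>" for \<Delta>
  proof (cases "0 \<le> s - \<Delta>")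
    case True
    let ?s = "s - \<Delta>"
    have L: "live n ?s \<in> sets (F ?s)" and V: "val n ?s \<in> borel_measurable (F ?s)" using Suc.IH[OF True] by auto
    define Z where "Z \<omega> = step ?s \<Delta> (val n ?s \<omega>) \<omega>" for \<omega>
    have Zm: "Z \<in> borel_measurable (F s)"
      using measurable_step[OF True _ V, of \<Delta>] \<Delta> by (simp add: Z_def[abs_def])
    have "(\<lambda>\<omega>. dt (val n ?s \<omega>)) \<in> borel_measurable (F ?s)" using measurable_compose[OF V dt_meas] .
    from measurable_F_mono[OF True _ this, of s]
    have dm: "(\<lambda>\<omega>. dt (val n ?s \<omega>)) \<in> borel_measurable (F s)" using \<Delta> by simp
    have ZX: "Z \<omega> = XX (Suc n) \<omega>" if "\<omega> \<in> live n ?s" "dt (XX n \<omega>) = \<Delta>" for \<omega>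
      using that by (simp add: Z_def val_live XX_Suc) (simp add: live_def)
    have eq: "piece \<Delta> = live n ?s \<inter> ((\<lambda>\<omega>. dt (val n ?s \<omega>)) -` {\<Delta>} \<inter> space (F s)) \<inter> (Z -` D \<inter> space (F s))"
    proof (intro set_eqI)
      fix \<omega>
      show "\<omega> \<in> piece \<Delta> \<longleftrightarrow> \<omega> \<in> live n ?s \<inter> ((\<lambda>\<omega>. dt (val n ?s \<omega>)) -` {\<Delta>} \<inter> space (F s)) \<inter> (Z -` D \<inter> space (F s))"
      proof (cases "\<omega> \<in> live n ?s \<and> dt (XX n \<omega>) = \<Delta>")
        case True
        then show ?thesis using ZX[of \<omega>] Suc.prems
          by (auto simp: piece_def val_live space_F live_def le_Suc_eq)
      next
        case False
        then show ?thesis by (auto simp: piece_def val_live live_def)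
      qed
    qed
    have "piece \<Delta> \<in> sets (F s)"
      unfolding eq using sets_F_mono[OF True _ L, of s] \<Delta> measurable_sets[OF dm, of "{\<Delta>}"] measurable_sets[OF Zm, of D] D
      by (simp add: sets.Int)
    moreover have "Z \<omega> = XX (Suc n) \<omega>" if "\<omega> \<in> piece \<Delta>" for \<omega>
      using that by (intro ZX) (auto simp: piece_def live_def)
    ultimately show ?thesis using Zm by blast
  next
    case False
    then have "tt n \<omega> \<noteq> s - \<Delta>" for \<omega> using steps.t_nonneg[of n \<omega>] by linarith
    then have "piece \<Delta> = {}" by (simp add: piece_def)
    then show ?thesis by (intro exI[of _ "\<lambda>_. x0"]) auto
  qed
  obtain Z1 where Z1: "piece h \<in> sets (F s)" "Z1 \<in> borel_measurable (F s)" "\<And>\<omega>. \<omega> \<in> piece h \<Longrightarrow> Z1 \<omega> = XX (Suc n) \<omega>"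
    using piece[of h] h by blast
  obtain Z2 where Z2: "piece (h\<^sup>2) \<in> sets (F s)" "Z2 \<in> borel_measurable (F s)" "\<And>\<omega>. \<omega> \<in> piece (h\<^sup>2) \<Longrightarrow> Z2 \<omega> = XX (Suc n) \<omega>"
    using piece[of "h\<^sup>2"] h by auto
  have live_eq: "live (Suc n) s = piece h \<union> piece (h\<^sup>2)"
  proof (intro set_eqI)
    fix \<omega> show "\<omega> \<in> live (Suc n) s \<longleftrightarrow> \<omega> \<in> piece h \<union> piece (h\<^sup>2)"
      using dt[of "XX n \<omega>"] by (auto simp: live_def piece_def tt_Suc)
  qed
  have val_eq: "val (Suc n) s = (\<lambda>\<omega>. if \<omega> \<in> piece h then Z1 \<omega> else if \<omega> \<in> piece (h\<^sup>2) then Z2 \<omega> else x0)"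
    using Z1(3) Z2(3) by (auto simp: val_def live_eq)
  have sp: "A \<inter> space (F s) \<in> sets (F s)" if "A \<in> sets (F s)" for A using that by auto
  show ?case
    unfolding val_eq live_eq using Z1 Z2 sp
    by (intro conjI sets.Un measurable_If_set measurable_const) auto
qed

text \<open>A finite superset of the values of t_n, so that splitting by times gives finite
  sums.\<close>

definition grid :: "nat \<Rightarrow> real set" where
  "grid n = (\<lambda>(i, j). real i * h + real j * h\<^sup>2) ` ({..n} \<times> {..n})"

lemma finite_grid: "finite (grid n)"
  by (simp add: grid_def)

lemma tt_grid: "tt n \<omega> \<in> grid n"
proof (induction n)
  case 0
  show ?case by (auto simp: grid_def tt_0)
next
  case (Suc n)
  then obtain i j where ij: "i \<le> n" "j \<le> n" "tt n \<omega> = real i * h + real j * h\<^sup>2" by (auto simp: grid_def)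
  from dt[of "XX n \<omega>"] show ?case
  proof
    assume "dt (XX n \<omega>) = h"
    then have "tt (Suc n) \<omega> = (\<lambda>(i, j). real i * h + real j * h\<^sup>2) (Suc i, j)" using ij by (simp add: tt_Suc algebra_simps)
    then show ?thesis unfolding grid_def using ij by (intro image_eqI[where x = "(Suc i, j)"]) auto
  next
    assume "dt (XX n \<omega>) = h\<^sup>2"
    then have "tt (Suc n) \<omega> = (\<lambda>(i, j). real i * h + real j * h\<^sup>2) (i, Suc j)" using ij by (simp add: tt_Suc algebra_simps)
    then show ?thesis unfolding grid_def using ij by (intro image_eqI[where x = "(i, Suc j)"]) auto
  qed
qed

text \<open>\<open>Tot\<close> adds up the increments of \<open>V\<close> in the strip, compensated
  by \<kappa> \<Delta> and split by the values of t_n and of the step size, so that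
  \<open>step_ineq\<close> makes each term nonpositive in the mean. At each \<omega> at most one
  pair per \<open>n\<close> is active. The constant is the oscillation of \<open>V\<close> over
  \<delta>^2: (B^2 - 1) + (2B + 1) with B = L + 1.\<close>

lemma occupation_time_bound:
  fixes \<rho> :: "real^'d \<Rightarrow> real" and L \<delta> \<kappa> T :: real
  assumes \<rho>: "continuous_on UNIV \<rho>" and \<delta>: "0 < \<delta>" and L: "1 \<le> L"
    and step_ineq: "\<And>\<Delta> s A Y. \<Delta> = h \<or> \<Delta> = h\<^sup>2 \<Longrightarrow> 0 \<le> s \<Longrightarrow> A \<in> sets (F s) \<Longrightarrow> Y \<in> borel_measurable (F s) \<Longrightarrow>
      (\<And>\<omega>. \<omega> \<in> A \<Longrightarrow> Y \<omega> \<in> D \<and> \<rho> (Y \<omega>) \<le> L * \<delta>) \<Longrightarrow>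
      expectation (\<lambda>\<omega>. indicator A \<omega> * lyap (L + 1) \<delta> (\<rho> (step s \<Delta> (Y \<omega>) \<omega>)))
       \<le> expectation (\<lambda>\<omega>. indicator A \<omega> * lyap (L + 1) \<delta> (\<rho> (Y \<omega>))) - \<Delta> * prob A * \<kappa>"
  obtains Tot where "integrable M Tot" "expectation Tot \<le> 0"
    "\<And>\<omega>. \<omega> \<in> space M \<Longrightarrow> \<kappa> * (\<Sum>n<N. if alive D T (\<lambda>n. tt n \<omega>) (\<lambda>n. XX n \<omega>) n \<and> \<rho> (XX n \<omega>) \<le> L * \<delta> then dt (XX n \<omega>) else 0)
       \<le> Tot \<omega> + ((L + 1)\<^sup>2 + 2 * (L + 1)) * \<delta>\<^sup>2"
proof -
  define B where "B = L + 1"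
  have B: "1 \<le> B" using L by (simp add: B_def)
  define V where "V x = lyap B \<delta> (\<rho> x)" for x
  define A where "A n s \<Delta> = {\<omega>\<in>live n s. dt (val n s \<omega>) = \<Delta> \<and> \<rho> (val n s \<omega>) \<le> L * \<delta>}" for n s \<Delta>
  define trm where "trm n s \<Delta> \<omega> = indicator (A n s \<Delta>) \<omega> * V (step s \<Delta> (val n s \<omega>) \<omega>)
     - indicator (A n s \<Delta>) \<omega> * V (val n s \<omega>) + \<kappa> * \<Delta> * indicator (A n s \<Delta>) \<omega>" for n s \<Delta> \<omega>
  \<comment> \<open>Times from \<open>T\<close> on are left out, to match
    \<open>alive\<close>.\<close>
  define P where "P n = (grid n \<inter> {0..<T}) \<times> {h, h\<^sup>2}" for n
  define Tot where "Tot \<omega> = (\<Sum>n<N. \<Sum>p\<in>P n. trm n (fst p) (snd p) \<omega>)" for \<omega>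
  have finP: "finite (P n)" for n using finite_grid by (simp add: P_def)
  have trm: "integrable M (trm n s \<Delta>)" "expectation (trm n s \<Delta>) \<le> 0" if s: "0 \<le> s" and \<Delta>: "\<Delta> = h \<or> \<Delta> = h\<^sup>2" for n s \<Delta>
  proof -
    have \<Delta>0: "0 \<le> \<Delta>" using \<Delta> h by auto
    have lv: "live n s \<in> sets (F s)" and vm: "val n s \<in> borel_measurable (F s)" using adapted[OF s] by auto
    have "(\<lambda>\<omega>. dt (val n s \<omega>)) \<in> borel_measurable (F s)" using measurable_compose[OF vm dt_meas] .
    moreover have rm: "(\<lambda>\<omega>. \<rho> (val n s \<omega>)) \<in> borel_measurable (F s)"
      using measurable_compose[OF vm borel_measurable_continuous_onI[OF \<rho>]] .
    moreover have "A n s \<Delta> = live n s \<inter> {\<omega>\<in>space (F s). dt (val n s \<omega>) = \<Delta> \<and> \<rho> (val n s \<omega>) \<le> L * \<delta>}"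
      using space_F[OF s] by (auto simp: A_def live_def)
    ultimately have AF: "A n s \<Delta> \<in> sets (F s)" using lv by simp
    have AM: "A n s \<Delta> \<in> events" using sets_F s AF by blast
    have sm: "(\<lambda>\<omega>. \<rho> (step s \<Delta> (val n s \<omega>) \<omega>)) \<in> borel_measurable M"
      using measurable_compose[OF measurable_F[OF _ measurable_step[OF s \<Delta>0 vm]] borel_measurable_continuous_onI[OF \<rho>]] s \<Delta>0 by simp
    have i1: "integrable M (\<lambda>\<omega>. indicator (A n s \<Delta>) \<omega> * V (step s \<Delta> (val n s \<omega>) \<omega>))"
      unfolding V_def using integrable_indicator_lyap[OF AM sm B] \<delta> by simp
    have i2: "integrable M (\<lambda>\<omega>. indicator (A n s \<Delta>) \<omega> * V (val n s \<omega>))"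
      unfolding V_def using integrable_indicator_lyap[OF AM measurable_F[OF s rm] B] \<delta> by simp
    have i3: "integrable M (indicator (A n s \<Delta>) :: 'w \<Rightarrow> real)"
      using AM by (intro integrable_real_indicator) (auto simp: emeasure_eq_measure)
    show "integrable M (trm n s \<Delta>)"
      unfolding trm_def[abs_def] using i1 i2 i3 by (intro Bochner_Integration.integrable_add Bochner_Integration.integrable_diff) auto
    have "expectation (trm n s \<Delta>) = expectation (\<lambda>\<omega>. indicator (A n s \<Delta>) \<omega> * V (step s \<Delta> (val n s \<omega>) \<omega>))
       - expectation (\<lambda>\<omega>. indicator (A n s \<Delta>) \<omega> * V (val n s \<omega>)) + \<kappa> * \<Delta> * prob (A n s \<Delta>)"
      unfolding trm_def[abs_def] using i1 i2 i3 AM by simp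
    also have "\<dots> \<le> 0"
    proof -
      have "val n s \<omega> \<in> D \<and> \<rho> (val n s \<omega>) \<le> L * \<delta>" if "\<omega> \<in> A n s \<Delta>" for \<omega>
        using that val_live[of \<omega> n s] by (auto simp: A_def live_def)
      from step_ineq[OF \<Delta> s AF vm this] show ?thesis unfolding V_def B_def by (simp add: mult_ac)
    qed
    finally show "expectation (trm n s \<Delta>) \<le> 0" .
  qed
  have Pd: "0 \<le> fst p" "snd p = h \<or> snd p = h\<^sup>2" if "p \<in> P n" for p n using that by (auto simp: P_def)
  show ?thesis
  proof (rule that[of Tot])
    show "integrable M Tot"
      unfolding Tot_def[abs_def] using Pd by (intro Bochner_Integration.integrable_sum trm)
    have "expectation Tot = (\<Sum>n<N. \<Sum>p\<in>P n. expectation (trm n (fst p) (snd p)))"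
      unfolding Tot_def[abs_def]
      using Pd by (simp add: Bochner_Integration.integral_sum Bochner_Integration.integrable_sum trm)
    also have "\<dots> \<le> 0" using Pd by (intro sum_nonpos trm)
    finally show "expectation Tot \<le> 0" .
    fix \<omega> assume \<omega>: "\<omega> \<in> space M"
    let ?al = "alive D T (\<lambda>n. tt n \<omega>) (\<lambda>n. XX n \<omega>)"
    have sumP: "(\<Sum>p\<in>P n. trm n (fst p) (snd p) \<omega>)
      = (if ?al n \<and> \<rho> (XX n \<omega>) \<le> L * \<delta> then V (XX (Suc n) \<omega>) - V (XX n \<omega>) + \<kappa> * dt (XX n \<omega>) else 0)" for n
    proof -
      define R where "R = (if (\<forall>k\<le>n. XX k \<omega> \<in> D) \<and> \<rho> (XX n \<omega>) \<le> L * \<delta>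
          then V (XX (Suc n) \<omega>) - V (XX n \<omega>) + \<kappa> * dt (XX n \<omega>) else 0)"
      have "trm n s \<Delta> \<omega> = (if (s, \<Delta>) = (tt n \<omega>, dt (XX n \<omega>)) then R else 0)" for s \<Delta>
      proof (cases "\<omega> \<in> A n s \<Delta>")
        case True
        then have lv: "\<omega> \<in> live n s" by (simp add: A_def)
        then have "s = tt n \<omega>" "\<forall>k\<le>n. XX k \<omega> \<in> D" by (auto simp: live_def)
        moreover have "\<Delta> = dt (XX n \<omega>)" "\<rho> (XX n \<omega>) \<le> L * \<delta>" using True val_live[OF lv] by (auto simp: A_def)
        ultimately show ?thesis using True val_live[OF lv] by (simp add: trm_def R_def XX_Suc)
      next
        case False
        have "R = 0" if "s = tt n \<omega>" "\<Delta> = dt (XX n \<omega>)"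
        proof (rule ccontr)
          assume "R \<noteq> 0"
          then have *: "\<forall>k\<le>n. XX k \<omega> \<in> D" "\<rho> (XX n \<omega>) \<le> L * \<delta>" by (auto simp: R_def split: if_splits)
          then have lv: "\<omega> \<in> live n s" using that \<omega> by (auto simp: live_def)
          then show False using False * that val_live[OF lv] by (simp add: A_def)
        qed
        then show ?thesis using False by (auto simp: trm_def)
      qed
      then have "(\<Sum>p\<in>P n. trm n (fst p) (snd p) \<omega>) = (\<Sum>p\<in>P n. if p = (tt n \<omega>, dt (XX n \<omega>)) then R else 0)"
        by (intro sum.cong) auto
      also have "\<dots> = (if (tt n \<omega>, dt (XX n \<omega>)) \<in> P n then R else 0)" using finP by (simp add: sum.delta)
      also have "(tt n \<omega>, dt (XX n \<omega>)) \<in> P n \<longleftrightarrow> tt n \<omega> < T"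
        using tt_grid[of n \<omega>] steps.t_nonneg[of n \<omega>] dt[of "XX n \<omega>"] by (auto simp: P_def)
      finally show ?thesis by (auto simp: R_def alive_def)
    qed
    have "(if ?al n then V (XX (Suc n) \<omega>) - V (XX n \<omega>) else 0)
        + \<kappa> * (if ?al n \<and> \<rho> (XX n \<omega>) \<le> L * \<delta> then dt (XX n \<omega>) else 0) \<le> (\<Sum>p\<in>P n. trm n (fst p) (snd p) \<omega>)" for n
    proof -
      \<comment> \<open>Live steps off the strip have no term in \<open>Tot\<close> but do belong to
        the telescoping sum; they may be added since \<open>V\<close> starts from its maximum
        there.\<close>
      have "V (XX (Suc n) \<omega>) \<le> V (XX n \<omega>)" if "\<not> \<rho> (XX n \<omega>) \<le> L * \<delta>"
      proof -
        have "V (XX n \<omega>) = (B\<^sup>2 - 1) * \<delta>\<^sup>2" using that by (simp add: V_def lyap_def B_def)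
        then show ?thesis using lyap_le[OF B, of \<delta>] \<delta> by (simp add: V_def)
      qed
      then show ?thesis unfolding sumP by auto
    qed
    then have "(\<Sum>n<N. (if ?al n then V (XX (Suc n) \<omega>) - V (XX n \<omega>) else 0)
        + \<kappa> * (if ?al n \<and> \<rho> (XX n \<omega>) \<le> L * \<delta> then dt (XX n \<omega>) else 0)) \<le> Tot \<omega>"
      unfolding Tot_def by (intro sum_mono)
    then have "(\<Sum>n<N. if ?al n then V (XX (Suc n) \<omega>) - V (XX n \<omega>) else 0)
        + \<kappa> * (\<Sum>n<N. if ?al n \<and> \<rho> (XX n \<omega>) \<le> L * \<delta> then dt (XX n \<omega>) else 0) \<le> Tot \<omega>"
      unfolding sum.distrib sum_distrib_left .
    moreover obtain k where "(\<Sum>n<N. if ?al n then V (XX (Suc n) \<omega>) - V (XX n \<omega>) else 0) = V (XX k \<omega>) - V (XX 0 \<omega>)"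
      using steps.alive_telescope[where \<omega> = \<omega> and N = N and D = D and T = T and v = "\<lambda>n. V (XX n \<omega>)"] by blast
    moreover have "V (XX k \<omega>) \<ge> - ((2 * B + 1) * \<delta>\<^sup>2)" "V (XX 0 \<omega>) \<le> (B\<^sup>2 - 1) * \<delta>\<^sup>2"
      using lyap_ge[OF B] lyap_le[OF B] \<delta> by (auto simp: V_def)
    moreover have "(2 * B + 1) * \<delta>\<^sup>2 + (B\<^sup>2 - 1) * \<delta>\<^sup>2 = (B\<^sup>2 + 2 * B) * \<delta>\<^sup>2" by (simp add: algebra_simps)
    ultimately show "\<kappa> * (\<Sum>n<N. if ?al n \<and> \<rho> (XX n \<omega>) \<le> L * \<delta> then dt (XX n \<omega>) else 0)
       \<le> Tot \<omega> + ((L + 1)\<^sup>2 + 2 * (L + 1)) * \<delta>\<^sup>2"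
      unfolding B_def by linarith
  qed
qed

end

section \<open>The cost bound\<close>

lemma Ck_bdd_continuous: "Ck_bdd k f \<Longrightarrow> continuous_on UNIV f"
  and Ck_bdd_bounded: "Ck_bdd k f \<Longrightarrow> bounded (range f)"
  by (cases k; simp)+

text \<open>Controls the relative error of \<open>lyap_expected_step\<close> at the larger step
  \<open>\<Delta> = h\<close>, which dominates the one at h^2.\<close>

lemma strip_width_tendsto_0:
  fixes k :: real
  assumes "0 < k"
  shows "((\<lambda>h. sqrt (k * h * ln (1 / h)) + h + h / (sqrt (k * h * ln (1 / h)))\<^sup>2) \<longlongrightarrow> 0) (at_right 0)"
  using assms by real_asymp

lemma measurable_step_size: "step_size D Cb h \<in> borel_measurable borel"
proof -
  have "(\<lambda>x. infdist x (frontier D)) \<in> borel_measurable borel"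
    by (intro borel_measurable_continuous_onI continuous_on_infdist continuous_on_id)
  then show ?thesis unfolding step_size_def[abs_def] by measurable
qed

lemma uniform_coefficient_bound:
  fixes a :: "real^'d::finite \<Rightarrow> real^'d" and b :: "real^'d \<Rightarrow> real^'m::finite^'d"
  assumes a: "\<And>i. bounded (range (\<lambda>x. a x $ i))" and b: "\<And>i j. bounded (range (\<lambda>x. b x $ i $ j))"
    and db: "\<And>i j k. bounded (range (pderiv_i k (\<lambda>x. b x $ i $ j)))"
  obtains K where "\<And>i x. \<bar>a x $ i\<bar> \<le> K" "\<And>i j x. \<bar>b x $ i $ j\<bar> \<le> K"
    "\<And>i j k x. \<bar>pderiv_i k (\<lambda>x. b x $ i $ j) x\<bar> \<le> K"
proof -
  define S where "S = (\<Union>i. range (\<lambda>x. a x $ i)) \<union> (\<Union>i. \<Union>j. range (\<lambda>x. b x $ i $ j))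
      \<union> (\<Union>i. \<Union>j. \<Union>k. range (pderiv_i k (\<lambda>x. b x $ i $ j)))"
  have "bounded S"
    unfolding S_def by (intro bounded_Un[THEN iffD2] conjI bounded_UN ballI finite a b db)
  then obtain K where K: "\<And>y. y \<in> S \<Longrightarrow> norm y \<le> K" unfolding bounded_iff by blast
  show ?thesis
  proof (rule that[of K])
    show "\<bar>a x $ i\<bar> \<le> K" for i x 
    proof -
      have "a x $ i \<in> S" unfolding S_def by blast
      then show ?thesis using K by fastforce
    qed
    show "\<bar>b x $ i $ j\<bar> \<le> K" for i j x 
    proof -
      have "b x $ i $ j \<in> S" unfolding S_def by blast
      then show ?thesis using K by fastforce
    qed
    show "\<bar>pderiv_i k (\<lambda>x. b x $ i $ j) x\<bar> \<le> K" for i j k x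
      
    proof -
      have "pderiv_i k (\<lambda>x. b x $ i $ j) x \<in> S"
        unfolding S_def by (intro UnI2 UN_I[of i] UN_I[of j] UN_I[of k] UNIV_I rangeI)
      then show ?thesis using K by fastforce
    qed
  qed
qed

context milstein
begin

text \<open>The cost is bounded pathwise by an integrable \<open>B\<close> in which
  \<open>Tot\<close> has nonpositive mean; monotonicity of the nonnegative integral does the
  rest.\<close>

lemma expected_cost_bound:
  fixes D :: "(real^'d) set" and Cb T h \<kappa> L \<delta> :: real
  assumes D: "open D" and h: "0 < h" "h < 1" and T: "0 < T" and \<kappa>: "0 < \<kappa>" and L: "1 \<le> L"
    and \<rho>: "continuous_on UNIV \<rho>" "\<And>x. x \<in> D \<Longrightarrow> \<rho> x \<le> L * infdist x (frontier D)"
    and \<delta>: "\<delta> = sqrt (8 * Cb * real CARD('d) * h * ln (1 / h))" "0 < \<delta>"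
    and step_ineq: "\<And>\<Delta> s A Y. \<Delta> = h \<or> \<Delta> = h\<^sup>2 \<Longrightarrow> 0 \<le> s \<Longrightarrow> A \<in> sets (F s) \<Longrightarrow> Y \<in> borel_measurable (F s) \<Longrightarrow>
      (\<And>\<omega>. \<omega> \<in> A \<Longrightarrow> Y \<omega> \<in> D \<and> \<rho> (Y \<omega>) \<le> L * \<delta>) \<Longrightarrow>
      expectation (\<lambda>\<omega>. indicator A \<omega> * lyap (L + 1) \<delta> (\<rho> (milstein_step a b (Y \<omega>) \<Delta>
         (W (s + \<Delta>) \<omega> - W s \<omega>) (iter_int W \<omega> s (s + \<Delta>)))))
       \<le> expectation (\<lambda>\<omega>. indicator A \<omega> * lyap (L + 1) \<delta> (\<rho> (Y \<omega>))) - \<Delta> * prob A * \<kappa>"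
  shows "(\<integral>\<^sup>+\<omega>. ennreal (cost a b W D Cb T x0 h \<omega>) \<partial>M)
    \<le> ennreal ((T + h) / h + ((L + 1)\<^sup>2 + 2 * (L + 1)) * \<delta>\<^sup>2 / (\<kappa> * h\<^sup>2))"
proof -
  let ?dt = "step_size D Cb h"
  interpret S: milstein_scheme M F W a b K D ?dt x0 h
    by unfold_locales (use D h measurable_step_size in \<open>auto simp: step_size_def\<close>)
  \<comment> \<open>All steps are at least h^2 long, so this deterministic number of steps covers
    \<open>[0, T]\<close> on every path.\<close>
  obtain N where N: "T / h\<^sup>2 \<le> real N" using real_arch_simple by blast
  then have N': "T \<le> real N * h\<^sup>2" using h by (simp add: field_simps)
  define E where "E = ((L + 1)\<^sup>2 + 2 * (L + 1)) * \<delta>\<^sup>2"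
  obtain Tot where Tot: "integrable M Tot" "expectation Tot \<le> 0"
    "\<And>\<omega>. \<omega> \<in> space M \<Longrightarrow> \<kappa> * (\<Sum>n<N. if alive D T (\<lambda>n. S.tt n \<omega>) (\<lambda>n. S.XX n \<omega>) n \<and> \<rho> (S.XX n \<omega>) \<le> L * \<delta>
         then ?dt (S.XX n \<omega>) else 0) \<le> Tot \<omega> + E"
    using S.occupation_time_bound[OF \<rho>(1) \<delta>(2) L step_ineq[folded S.step_def], where N = N and T = T]
    unfolding E_def by blast
  define B where "B \<omega> = (T + h) / h + (Tot \<omega> + E) / (\<kappa> * h\<^sup>2)" for \<omega>
  \<comment> \<open>\<open>Tot\<close> alone may be negative; \<open>Tot \<omega> + E\<close>
    majorises \<kappa> times an occupation time. The resulting sign of \<open>B\<close> identifies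
    its nonnegative integral with its expectation.\<close>
  have Tot0: "0 \<le> Tot \<omega> + E" if "\<omega> \<in> space M" for \<omega>
    using \<kappa> less_imp_le[OF S.steps.dt_pos]
    by (intro order_trans[OF _ Tot(3)[OF that]] mult_nonneg_nonneg sum_nonneg) auto
  have B0: "0 \<le> B \<omega>" if "\<omega> \<in> space M" for \<omega>
    using Tot0[OF that] T h \<kappa> by (simp add: B_def)
  have costB: "cost a b W D Cb T x0 h \<omega> \<le> B \<omega>" if \<omega>: "\<omega> \<in> space M" for \<omega>
  proof -
    let ?al = "alive D T (\<lambda>n. S.tt n \<omega>) (\<lambda>n. S.XX n \<omega>)"
    have "cost a b W D Cb T x0 h \<omega> \<le> (\<Sum>n<N. if ?al n then 1 else 0)"
      using S.steps.integral_cost_le[OF T N', of \<omega> D] unfolding cost_def Let_def S.tt_def S.XX_def .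
    also have "\<dots> \<le> (T + h) / h + (\<Sum>n<N. if ?al n \<and> \<rho> (S.XX n \<omega>) \<le> L * \<delta> then ?dt (S.XX n \<omega>) else 0) / h\<^sup>2"
    proof (rule S.steps.alive_count_le[OF T])
      \<comment> \<open>Small steps occur only within distance \<delta> of the frontier, hence in
        the strip of \<open>\<rho>\<close>.\<close>
      fix n assume al: "?al n" and "?dt (S.XX n \<omega>) \<noteq> h"
      then have "infdist (S.XX n \<omega>) (frontier D) \<le> \<delta>" by (auto simp: step_size_def \<delta> split: if_splits)
      then have "L * infdist (S.XX n \<omega>) (frontier D) \<le> L * \<delta>" using L by (intro mult_left_mono) auto
      moreover have "S.XX n \<omega> \<in> D" using al by (auto simp: alive_def)
      ultimately show "\<rho> (S.XX n \<omega>) \<le> L * \<delta>" using \<rho>(2) by fastforce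
    qed
    also have "\<dots> \<le> (T + h) / h + ((Tot \<omega> + E) / \<kappa>) / h\<^sup>2"
      using Tot(3)[OF \<omega>] \<kappa> by (intro add_left_mono divide_right_mono) (auto simp: field_simps)
    finally show ?thesis by (simp add: B_def mult.commute)
  qed
  have Bi: "integrable M B" unfolding B_def[abs_def] using Tot(1) by simp
  have "(\<integral>\<^sup>+\<omega>. ennreal (cost a b W D Cb T x0 h \<omega>) \<partial>M) \<le> (\<integral>\<^sup>+\<omega>. ennreal (B \<omega>) \<partial>M)"
    using costB by (intro nn_integral_mono ennreal_leI) auto
  also have "\<dots> = ennreal (expectation B)"
    using Bi B0 by (intro nn_integral_eq_integral) auto
  also have "expectation B = (T + h) / h + (expectation Tot + E) / (\<kappa> * h\<^sup>2)"
    unfolding B_def[abs_def] using Tot(1) by (simp add: prob_space)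
  also have "ennreal \<dots> \<le> ennreal ((T + h) / h + E / (\<kappa> * h\<^sup>2))"
    using Tot(2) \<kappa> h by (intro ennreal_leI add_left_mono divide_right_mono) auto
  finally show ?thesis by (simp add: E_def)
qed

end

theorem mainTheorem2:
  fixes D :: "(real^'d::finite) set"
    and a :: "real^'d \<Rightarrow> real^'d"
    and b :: "real^'d \<Rightarrow> real^'m::finite^'d"
    and T Rbar cb Cb :: real
    and M :: "'w measure" and F :: "real \<Rightarrow> 'w measure"
    and W :: "real \<Rightarrow> 'w \<Rightarrow> real^'m"
    and x0 :: "real^'d"
  assumes "T > 0"
    and "open D" "connected D" "D \<noteq> {}" "bounded D" "Ck_boundary 4 D"
    and "reach D > 0"
    and B1a: "\<forall>i. Ck_bdd 3 (\<lambda>x. a x $ i)"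
    and B1b: "\<forall>i j. Ck_bdd 3 (\<lambda>x. b x $ i $ j)"
    and B2: "0 < Rbar" "Rbar < reach D / 2" "cb > 0"
       "\<forall>x\<in>enlarge D Rbar. \<forall>\<xi>. \<xi> \<bullet> ((b x ** transpose (b x)) *v \<xi>) \<ge> cb * norm \<xi> ^ 2"
    and B3: "Cb > 0" "\<forall>x \<xi>. \<xi> \<bullet> ((b x ** transpose (b x)) *v \<xi>) \<le> Cb * norm \<xi> ^ 2"
    and "wiener_process M F W"
    and "x0 \<in> D"
  shows "\<exists>C>0. \<exists>h0. 0 < h0 \<and> h0 < 1 \<and>
           (\<forall>h. 0 < h \<and> h < h0 \<longrightarrow>
              (\<integral>\<^sup>+ \<omega>. ennreal (cost a b W D Cb T x0 h \<omega>) \<partial>M) \<le> ennreal (C * (1 / h) * ln (1 / h)))"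
proof -
  have Suc3: "(3::nat) = Suc 2" and Suc4: "(4::nat) = Suc (Suc 2)" by simp_all
  have db: "Ck_bdd 2 (pderiv_i k (\<lambda>x. b x $ i $ j))" for i j k
    using B1b unfolding Suc3 Ck_bdd.simps by blast
  obtain K where K: "\<And>i x. \<bar>a x $ i\<bar> \<le> K" "\<And>i j x. \<bar>b x $ i $ j\<bar> \<le> K"
    "\<And>i j k x. \<bar>pderiv_i k (\<lambda>x. b x $ i $ j) x\<bar> \<le> K"
    using uniform_coefficient_bound[of a b] Ck_bdd_bounded B1a B1b db by metis
  interpret milstein M F W a b K
  proof unfold_locales
    show "wiener_process M F W" by fact
    show "continuous_on UNIV (\<lambda>x. a x $ i)" for i using B1a Ck_bdd_continuous by blast
    show "continuous_on UNIV (\<lambda>x. b x $ i $ j)" for i j using B1b Ck_bdd_continuous by blast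
    show "continuous_on UNIV (pderiv_i k (\<lambda>x. b x $ i $ j))" for i j k using db by (rule Ck_bdd_continuous)
  qed (rule K)+
  have bd: "Ck_boundary (Suc (Suc 2)) D" using \<open>Ck_boundary 4 D\<close> unfolding Suc4 .
  obtain \<rho> g C L c \<eta> where geo:
    "continuous_on UNIV \<rho>" "continuous_on UNIV g" "C \<ge> 0" "L \<ge> 1" "c > 0" "\<eta> > 0"
    "\<And>x y. x \<in> D \<Longrightarrow> norm (y - x) \<le> 1 \<Longrightarrow> \<bar>\<rho> y - \<rho> x - g x \<bullet> (y - x)\<bar> \<le> C * norm (y - x) ^ 2"
    "\<And>x. x \<in> D \<Longrightarrow> norm (g x) \<le> L"
    "\<And>x. x \<in> D \<Longrightarrow> \<rho> x > 0"
    "\<And>x. x \<in> D \<Longrightarrow> \<rho> x \<le> L * infdist x (frontier D)"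
    "\<And>x. x \<in> D \<Longrightarrow> \<rho> x \<le> \<eta> \<Longrightarrow> c \<le> norm (g x)"
    by (rule global_defining_function[OF \<open>open D\<close> \<open>bounded D\<close> \<open>D \<noteq> {}\<close> bd]) blast
  have "x \<in> enlarge D Rbar" if "x \<in> D" for x using that B2(1) by (simp add: enlarge_def)
  then have cb: "cb * norm \<xi> ^ 2 \<le> \<xi> \<bullet> ((b x ** transpose (b x)) *v \<xi>)" if "x \<in> D" for x \<xi>
    using B2(4) that by blast
  have Cb: "\<xi> \<bullet> ((b x ** transpose (b x)) *v \<xi>) \<le> Cb * norm \<xi> ^ 2" for x \<xi> using B3(2) by blast
  show ?thesis
  proof (rule lyap_expected_step[OF geo(1-5) geo(7-9) \<open>cb > 0\<close> cb \<open>Cb > 0\<close> Cb])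
    fix A :: real assume A: "A \<ge> 0" "\<And>\<delta> \<Delta> s A' Y. 0 < \<delta> \<Longrightarrow> \<delta> \<le> 1 \<Longrightarrow> 0 < \<Delta> \<Longrightarrow> 0 \<le> s \<Longrightarrow> A' \<in> sets (F s) \<Longrightarrow>
       Y \<in> borel_measurable (F s) \<Longrightarrow> (\<And>\<omega>. \<omega> \<in> A' \<Longrightarrow> Y \<omega> \<in> D \<and> \<rho> (Y \<omega>) \<le> L * \<delta> \<and> c \<le> norm (g (Y \<omega>))) \<Longrightarrow>
       expectation (\<lambda>\<omega>. indicator A' \<omega> * lyap (L + 1) \<delta> (\<rho> (milstein_step a b (Y \<omega>) \<Delta>
           (W (s + \<Delta>) \<omega> - W s \<omega>) (iter_int W \<omega> s (s + \<Delta>)))))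
         \<le> expectation (\<lambda>\<omega>. indicator A' \<omega> * lyap (L + 1) \<delta> (\<rho> (Y \<omega>)))
           - \<Delta> * prob A' * (cb * c\<^sup>2 / 2 - A * (\<delta> + \<Delta> + \<Delta> / \<delta>\<^sup>2))"
    \<comment> \<open>Half of the mean decrease \<open>cb * c\<^sup>2 / 2\<close>; the other half
      absorbs the errors.\<close>
    define \<kappa> where "\<kappa> = cb * c\<^sup>2 / 4"
    have \<kappa>: "\<kappa> > 0" using \<open>cb > 0\<close> \<open>c > 0\<close> by (simp add: \<kappa>_def)
    define k where "k = 8 * Cb * real CARD('d)"
    have k: "k > 0" using \<open>Cb > 0\<close> by (simp add: k_def)
    define \<delta> where "\<delta> h = sqrt (k * h * ln (1 / h))" for h
    \<comment> \<open>The three entries ensure \<open>\<delta> h \<le> 1\<close>, that the strip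
      lies where the gradient has norm at least \<open>c\<close>, and that \<open>A\<close> times
      the error stays below \<kappa>; \<open>A + 1\<close> avoids division by zero.\<close>
    define \<epsilon> where "\<epsilon> = min 1 (min (\<eta> / L) (\<kappa> / (A + 1)))"
    have \<epsilon>: "\<epsilon> > 0" using geo(4,6) \<kappa> A(1) by (simp add: \<epsilon>_def)
    have "\<forall>\<^sub>F h in at_right 0. \<delta> h + h + h / (\<delta> h)\<^sup>2 < \<epsilon>"
      using order_tendstoD(2)[OF strip_width_tendsto_0[OF k] \<epsilon>] by (simp add: \<delta>_def)
    \<comment> \<open>Lets the term of order 1/h be absorbed into log(1/h)/h, and makes
      \<open>\<delta> h\<close> positive.\<close>
    moreover have "\<forall>\<^sub>F h::real in at_right 0. 1 < ln (1 / h)" by real_asymp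
    ultimately have "\<forall>\<^sub>F h in at_right 0. \<delta> h + h + h / (\<delta> h)\<^sup>2 < \<epsilon> \<and> 1 < ln (1 / h)"
      by eventually_elim simp
    then obtain h1 where h1: "h1 > 0" "\<And>h. 0 < h \<Longrightarrow> h < h1 \<Longrightarrow> \<delta> h + h + h / (\<delta> h)\<^sup>2 < \<epsilon> \<and> 1 < ln (1 / h)"
      unfolding eventually_at_right_field by blast
    \<comment> \<open>\<open>T + 1\<close> covers the term (T + h)/h of the large steps; the rest is
      the strip term, where \<delta>^2 = k h log(1/h) turns 1/h^2 into log(1/h)/h.\<close>
    define C' where "C' = T + 1 + ((L + 1)\<^sup>2 + 2 * (L + 1)) * k / \<kappa>"
    have C': "C' > 0"
      using \<open>T > 0\<close> geo(4) k \<kappa> by (auto simp: C'_def intro!: add_pos_nonneg divide_nonneg_pos mult_nonneg_nonneg)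
    have bound: "(\<integral>\<^sup>+ \<omega>. ennreal (cost a b W D Cb T x0 h \<omega>) \<partial>M) \<le> ennreal (C' * (1 / h) * ln (1 / h))"
      if h: "0 < h" "h < min h1 (1/2)" for h
    proof -
      have small: "\<delta> h + h + h / (\<delta> h)\<^sup>2 < \<epsilon>" and ln1: "1 < ln (1 / h)" using h1(2) h by auto
      have \<delta>2: "(\<delta> h)\<^sup>2 = k * h * ln (1 / h)" using k h ln1 by (simp add: \<delta>_def)
      have \<delta>0: "0 < \<delta> h" using k h ln1 by (simp add: \<delta>_def)
      have "0 \<le> h / (\<delta> h)\<^sup>2" using h by simp
      then have "\<delta> h < \<epsilon>" using small h by linarith
      then have \<delta>1: "\<delta> h \<le> 1" and \<delta>\<eta>: "L * \<delta> h \<le> \<eta>"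
        using geo(4) by (auto simp: \<epsilon>_def field_simps)
      have "(\<integral>\<^sup>+ \<omega>. ennreal (cost a b W D Cb T x0 h \<omega>) \<partial>M)
          \<le> ennreal ((T + h) / h + ((L + 1)\<^sup>2 + 2 * (L + 1)) * (\<delta> h)\<^sup>2 / (\<kappa> * h\<^sup>2))"
      proof (rule expected_cost_bound[OF \<open>open D\<close> _ _ \<open>T > 0\<close> \<kappa> geo(4,1,10) _ \<delta>0])
        show "0 < h" "h < 1" using h by auto
        show "\<delta> h = sqrt (8 * Cb * real CARD('d) * h * ln (1 / h))" by (simp add: \<delta>_def k_def)
        fix \<Delta> s :: real and A' :: "'w set" and Y :: "'w \<Rightarrow> real^'d"
        assume \<Delta>: "\<Delta> = h \<or> \<Delta> = h\<^sup>2" and s: "0 \<le> s" and A': "A' \<in> sets (F s)" and Y: "Y \<in> borel_measurable (F s)"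
          and YA: "\<And>\<omega>. \<omega> \<in> A' \<Longrightarrow> Y \<omega> \<in> D \<and> \<rho> (Y \<omega>) \<le> L * \<delta> h"
        have "h\<^sup>2 \<le> h" using h by (simp add: power2_eq_square mult_left_le)
        then have \<Delta>h: "0 < \<Delta>" "\<Delta> \<le> h" using \<Delta> h by auto
        have "\<Delta> / (\<delta> h)\<^sup>2 \<le> h / (\<delta> h)\<^sup>2" using \<Delta>h by (intro divide_right_mono) auto
        then have "\<delta> h + \<Delta> + \<Delta> / (\<delta> h)\<^sup>2 \<le> \<kappa> / (A + 1)" using small \<Delta>h by (auto simp: \<epsilon>_def)
        then have "A * (\<delta> h + \<Delta> + \<Delta> / (\<delta> h)\<^sup>2) \<le> A * (\<kappa> / (A + 1))" using A(1) by (intro mult_left_mono) auto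
        also have "\<dots> \<le> \<kappa>" using A(1) \<kappa> by (simp add: field_simps)
        finally have "\<kappa> \<le> cb * c\<^sup>2 / 2 - A * (\<delta> h + \<Delta> + \<Delta> / (\<delta> h)\<^sup>2)" by (simp add: \<kappa>_def)
        then have "\<Delta> * prob A' * \<kappa> \<le> \<Delta> * prob A' * (cb * c\<^sup>2 / 2 - A * (\<delta> h + \<Delta> + \<Delta> / (\<delta> h)\<^sup>2))"
          using \<Delta>h by (intro mult_left_mono) auto
        moreover have "Y \<omega> \<in> D \<and> \<rho> (Y \<omega>) \<le> L * \<delta> h \<and> c \<le> norm (g (Y \<omega>))" if "\<omega> \<in> A'" for \<omega>
          using YA[OF that] geo(11)[of "Y \<omega>"] \<delta>\<eta> by auto
        note A(2)[OF \<delta>0 \<delta>1 \<Delta>h(1) s A' Y this]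
        ultimately show "expectation (\<lambda>\<omega>. indicator A' \<omega> * lyap (L + 1) (\<delta> h) (\<rho> (milstein_step a b (Y \<omega>) \<Delta>
           (W (s + \<Delta>) \<omega> - W s \<omega>) (iter_int W \<omega> s (s + \<Delta>)))))
         \<le> expectation (\<lambda>\<omega>. indicator A' \<omega> * lyap (L + 1) (\<delta> h) (\<rho> (Y \<omega>))) - \<Delta> * prob A' * \<kappa>"
          by linarith
      qed
      also have "\<dots> \<le> ennreal (C' * (1 / h) * ln (1 / h))"
      proof (rule ennreal_leI)
        have "(T + h) / h \<le> (T + 1) * (1 / h) * ln (1 / h)"
        proof -
          have "(T + h) / h \<le> (T + 1) * (1 / h) * 1" using h by (simp add: divide_right_mono)
          also have "\<dots> \<le> (T + 1) * (1 / h) * ln (1 / h)" using h \<open>T > 0\<close> ln1 by (intro mult_left_mono) auto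
          finally show ?thesis .
        qed
        moreover have "((L + 1)\<^sup>2 + 2 * (L + 1)) * (\<delta> h)\<^sup>2 / (\<kappa> * h\<^sup>2)
            = ((L + 1)\<^sup>2 + 2 * (L + 1)) * k / \<kappa> * (1 / h) * ln (1 / h)"
          unfolding \<delta>2 using h by (simp add: power2_eq_square)
        ultimately show "(T + h) / h + ((L + 1)\<^sup>2 + 2 * (L + 1)) * (\<delta> h)\<^sup>2 / (\<kappa> * h\<^sup>2) \<le> C' * (1 / h) * ln (1 / h)"
          unfolding C'_def distrib_right by linarith
      qed
      finally show ?thesis .
    qed
    show ?thesis
      using C' bound h1(1) by (intro exI[of _ C'] conjI exI[of _ "min h1 (1/2)"]) auto
  qed
qed

end
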